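(* $\mathsf{OG\mapsto\alpha0}<_{\mathsf{W}}\mathsf{OG\mapsto\alpha1}\equiv_{\mathsf{W}}\mathsf{OG\mapsto\alpha}<_{\mathsf{W}}\mathsf{OG\mapsto\alpha\epsilon}$, where the problems are as follows. $\mathsf{OG\mapsto\alpha\epsilon}$: given a countable ordered group $(G,\leq)$, output a copy of a well-order $\alpha$ and a bit $\epsilon\in\{0,1\}$ such that the order type of $G$ is $\mathbb{Z}^{\alpha}\mathbb{Q}^{\epsilon}$. $\mathsf{OG\mapsto\alpha}$: same input, but output only a copy of $\alpha$. $\mathsf{OG\mapsto\alpha0}$: the restriction of $\mathsf{OG\mapsto\alpha}$ to groups whose order type is $\mathbb{Z}^{\alpha}$ for some ordinal $\alpha$. $\mathsf{OG\mapsto\alpha1}$: the restriction of $\mathsf{OG\mapsto\alpha}$ to groups whose order type is $\mathbb{Z}^{\alpha}\mathbb{Q}$ for some ordinal $\alpha$.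
   Context: Weihrauch reducibility: a represented space is a set $X$ with a partial surjection $\delta_X:\subseteq\mathbb{N}^{\mathbb{N}}\to X$; if $\delta_X(p)=x$, $p$ is a name of $x$. A problem is a partial multi-valued function between represented spaces. $f\leq_{\mathsf{W}}g$ iff there are computable partial functions $\Phi,\Psi$ on Baire space such that whenever $p$ is a name of some $x\in\mathrm{dom}(f)$, $\Phi(p)$ is a name of some $z\in\mathrm{dom}(g)$, and for every name $q$ of an element of $g(z)$, $\Psi(p,q)$ is a name of an element of $f(x)$. $f\equiv_{\mathsf{W}}g$ means $f\leq_{\mathsf{W}}g$ and $g\leq_{\mathsf{W}}f$; $f<_{\mathsf{W}}g$ means $f\leq_{\mathsf{W}}g$ and $g\not\leq_{\mathsf{W}}f$. Ordered groups: an ordered group is a group $G$ with a linear order $\leq$ such that $a\leq b$ implies $ag\leq bg$ and $ga\leq gb$ for all $g$. Countable ordered groups are presented on subsets of $\mathbb{N}$, a name coding the universe, operation and order. The order type of $G$ is a linear order $X$ such that there is an order-preserving bijection $G\to X$. For linear orders $X,Y$, the product $XY$ is $X\times Y$ with $\langle x_0,y_0\rangle<\langle x_1,y_1\rangle$ iff $y_0<y_1$, or $y_0=y_1$ and $x_0<x_1$. $\mathbb{Z}^X$ is the set of finitely supported functions $X\to\mathbb{Z}$, where for $f\neq g$, $f<g$ iff $f(x)<g(x)$ at the maximum $x$ where they differ. $\mathbb{Z}^\alpha\mathbb{Q}^0=\mathbb{Z}^\alpha$ and $\mathbb{Z}^\alpha\mathbb{Q}^1=\mathbb{Z}^\alpha\mathbb{Q}$.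 By Maltsev's theorem every countable ordered group has order type $\mathbb{Z}^\alpha\mathbb{Q}^\epsilon$ for some ordinal $\alpha$ and $\epsilon\in\{0,1\}$. A copy of an ordinal $\alpha$ is a pair $(A,<_A)$ with $A\subseteq\mathbb{N}$, $<_A\subseteq A\times A$ a well-order of $A$ isomorphic to $\alpha$, coded in Baire space. *)

theory Defs
  imports Complex_Main "HOL-Library.Nat_Bijection" "HOL-Algebra.Group"
begin

section \<open>Computable partial functions on Baire space\<close>

type_synonym baire = "nat \<Rightarrow> nat"

text \<open>
  Programs for the partial recursive functions relative to an oracle. Arities are not tracked:
  an ill-formed application simply has no value.
\<close>

datatype prog =
    Zero | Succ | Proj nat | Query | Comp prog "prog list" | PrimRec prog prog | Mu prog

text \<open>\<open>computes p e xs y\<close>: with oracle \<open>p\<close>, the program \<open>e\<close> halts on input \<open>xs\<close> with output \<open>y\<close>.\<close>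

inductive computes :: "baire \<Rightarrow> prog \<Rightarrow> nat list \<Rightarrow> nat \<Rightarrow> bool" for p :: baire where
  zero: "computes p Zero xs 0"
| succ: "computes p Succ [x] (Suc x)"
| project: "i < length xs \<Longrightarrow> computes p (Proj i) xs (xs ! i)"
| query: "computes p Query [x] (p x)"
| compose: "list_all2 (\<lambda>e y. computes p e xs y) es ys \<Longrightarrow> computes p e ys z
    \<Longrightarrow> computes p (Comp e es) xs z"
| rec_0: "computes p e xs y \<Longrightarrow> computes p (PrimRec e e') (0 # xs) y"
| rec_Suc: "computes p (PrimRec e e') (n # xs) y \<Longrightarrow> computes p e' (n # y # xs) z
    \<Longrightarrow> computes p (PrimRec e e') (Suc n # xs) z"
| mu: "computes p e (n # xs) 0 \<Longrightarrow> (\<forall>m<n. \<exists>k. computes p e (m # xs) (Suc k))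
    \<Longrightarrow> computes p (Mu e) xs n"

text \<open>
  As usual in computable analysis, the program has to be correct on the domain of the function
  only; a restriction of a computable partial function is computable.
\<close>

definition computable :: "(baire \<Rightarrow> baire option) \<Rightarrow> bool" where
  "computable F \<longleftrightarrow>
    (\<exists>e. \<forall>p q. F p = Some q \<longrightarrow> (\<forall>n. computes p e [n] (q n)))"

definition baire_pair :: "baire \<Rightarrow> baire \<Rightarrow> baire" where
  "baire_pair p q = (\<lambda>n. if even n then p (n div 2) else q (n div 2))"

definition baire_fst :: "baire \<Rightarrow> baire" where
  "baire_fst p = (\<lambda>n. p (2 * n))"

definition baire_snd :: "baire \<Rightarrow> baire" where
  "baire_snd p = (\<lambda>n. p (2 * n + 1))"

lemma baire_fst_pair [simp]: "baire_fst (baire_pair p q) = p"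
  by (simp add: baire_fst_def baire_pair_def)

lemma baire_snd_pair [simp]: "baire_snd (baire_pair p q) = q"
  by (simp add: baire_snd_def baire_pair_def)


section \<open>Represented spaces, problems and Weihrauch reducibility\<close>

text \<open>
  A represented space is given by its representation; the underlying set is the range, so that
  representations are surjective by construction.
\<close>

type_synonym 'a representation = "baire \<Rightarrow> 'a option"

abbreviation points :: "'a representation \<Rightarrow> 'a set" where
  "points \<delta> \<equiv> ran \<delta>"

record ('a, 'b) problem =
  in_rep :: "'a representation"
  out_rep :: "'b representation"
  solutions :: "'a \<Rightarrow> 'b set"

definition problem_dom :: "('a, 'b) problem \<Rightarrow> 'a set" where
  "problem_dom f = {x. solutions f x \<noteq> {}}"

definition is_problem :: "('a, 'b) problem \<Rightarrow> bool" where
  "is_problem f \<longleftrightarrow> problem_dom f \<subseteq> points (in_rep f) \<and>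
     (\<forall>x. solutions f x \<subseteq> points (out_rep f))"

definition restrict_problem :: "('a, 'b) problem \<Rightarrow> 'a set \<Rightarrow> ('a, 'b) problem" where
  "restrict_problem f D = f \<lparr>solutions := (\<lambda>x. if x \<in> D then solutions f x else {})\<rparr>"

definition weihrauch_le :: "('a, 'b) problem \<Rightarrow> ('c, 'd) problem \<Rightarrow> bool"
    (infix \<open>\<le>\<^sub>W\<close> 50) where
  "f \<le>\<^sub>W g \<longleftrightarrow>
    (\<exists>\<Phi> \<Psi>. computable \<Phi> \<and> computable \<Psi> \<and>
      (\<forall>p x. in_rep f p = Some x \<and> x \<in> problem_dom f \<longrightarrow>
        (\<exists>r z. \<Phi> p = Some r \<and> in_rep g r = Some z \<and> z \<in> problem_dom g \<and>
          (\<forall>q y. out_rep g q = Some y \<and> y \<in> solutions g z \<longrightarrow>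
            (\<exists>s w. \<Psi> (baire_pair p q) = Some s \<and> out_rep f s = Some w \<and>
              w \<in> solutions f x)))))"

definition weihrauch_equiv :: "('a, 'b) problem \<Rightarrow> ('c, 'd) problem \<Rightarrow> bool"
    (infix \<open>\<equiv>\<^sub>W\<close> 50) where
  "f \<equiv>\<^sub>W g \<longleftrightarrow> f \<le>\<^sub>W g \<and> g \<le>\<^sub>W f"

definition weihrauch_less :: "('a, 'b) problem \<Rightarrow> ('c, 'd) problem \<Rightarrow> bool"
    (infix \<open><\<^sub>W\<close> 50) where
  "f <\<^sub>W g \<longleftrightarrow> f \<le>\<^sub>W g \<and> \<not> g \<le>\<^sub>W f"


section \<open>Linear orders\<close>

text \<open>A linear order is given by its carrier and its strict order relation on the carrier.\<close>

type_synonym 'a lin = "'a set \<times> 'a rel"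

definition same_order_type :: "'a lin \<Rightarrow> 'b lin \<Rightarrow> bool" where
  "same_order_type X Y \<longleftrightarrow>
    (\<exists>h. bij_betw h (fst X) (fst Y) \<and>
      (\<forall>a\<in>fst X. \<forall>b\<in>fst X. (a, b) \<in> snd X \<longleftrightarrow> (h a, h b) \<in> snd Y))"

definition lin_prod :: "'a lin \<Rightarrow> 'b lin \<Rightarrow> ('a \<times> 'b) lin" where
  "lin_prod X Y =
    (fst X \<times> fst Y,
     {((x0, y0), (x1, y1)). x0 \<in> fst X \<and> x1 \<in> fst X \<and> y0 \<in> fst Y \<and> y1 \<in> fst Y \<and>
        ((y0, y1) \<in> snd Y \<or> y0 = y1 \<and> (x0, x1) \<in> snd X)})"

definition fin_supp :: "'a set \<Rightarrow> ('a \<Rightarrow> int) set" where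
  "fin_supp A = {f. finite {x. f x \<noteq> 0} \<and> {x. f x \<noteq> 0} \<subseteq> A}"

definition Z_pow :: "'a lin \<Rightarrow> ('a \<Rightarrow> int) lin" where
  "Z_pow X =
    (fin_supp (fst X),
     {(f, g). f \<in> fin_supp (fst X) \<and> g \<in> fin_supp (fst X) \<and>
        (\<exists>x\<in>fst X. f x \<noteq> g x \<and>
           (\<forall>y\<in>fst X. f y \<noteq> g y \<longrightarrow> y = x \<or> (y, x) \<in> snd X) \<and> f x < g x)})"

definition Q_lin :: "rat lin" where
  "Q_lin = (UNIV, {(a, b). a < b})"

definition has_type_ZQ :: "'b lin \<Rightarrow> 'a lin \<Rightarrow> nat \<Rightarrow> bool" where
  "has_type_ZQ L X \<epsilon> \<longleftrightarrow>
    (\<epsilon> = 0 \<and> same_order_type L (Z_pow X) \<or>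
     \<epsilon> = 1 \<and> same_order_type L (lin_prod (Z_pow X) Q_lin))"


section \<open>The represented space of copies of countable ordinals\<close>

definition ordinal_copies :: "nat lin set" where
  "ordinal_copies = {(A, R). R \<subseteq> A \<times> A \<and> strict_linear_order_on A R \<and> wf R}"

text \<open>
  A name of \<open>(A, R)\<close> consists of characteristic functions of \<open>A\<close> and of \<open>R\<close>, where any nonzero
  value means membership and pairs are coded by \<^const>\<open>prod_encode\<close>.
\<close>

definition decode_set :: "baire \<Rightarrow> nat set" where
  "decode_set p = {n. p n \<noteq> 0}"

definition decode_rel :: "baire \<Rightarrow> nat rel" where
  "decode_rel p = {(a, b). p (prod_encode (a, b)) \<noteq> 0}"

definition ordinal_rep :: "nat lin representation" where
  "ordinal_rep p =
    (let X = (decode_set (baire_fst p), decode_rel (baire_snd p))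
     in if X \<in> ordinal_copies then Some X else None)"

definition bit_rep :: "nat representation" where
  "bit_rep p = (if p 0 \<in> {0, 1} then Some (p 0) else None)"

definition prod_rep :: "'a representation \<Rightarrow> 'b representation \<Rightarrow> ('a \<times> 'b) representation" where
  "prod_rep \<delta> \<delta>' p =
    (case (\<delta> (baire_fst p), \<delta>' (baire_snd p)) of
       (Some x, Some y) \<Rightarrow> Some (x, y)
     | _ \<Rightarrow> None)"


section \<open>The represented space of countable ordered groups\<close>

record 'a ord_grp = "'a monoid" +
  le_rel :: "'a rel"

locale ordered_group = group G for G (structure) +
  assumes linear_order: "linear_order_on (carrier G) (le_rel G)"
    and mult_right_mono:
      "\<lbrakk>(a, b) \<in> le_rel G; g \<in> carrier G\<rbrakk> \<Longrightarrow> (a \<otimes> g, b \<otimes> g) \<in> le_rel G"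
    and mult_left_mono:
      "\<lbrakk>(a, b) \<in> le_rel G; g \<in> carrier G\<rbrakk> \<Longrightarrow> (g \<otimes> a, g \<otimes> b) \<in> le_rel G"

definition order_of :: "'a ord_grp \<Rightarrow> 'a lin" where
  "order_of G = (carrier G, le_rel G - Id)"

text \<open>
  A name codes the universe, the operation and the order. The unit is not part of the name, as it
  is determined by the operation. The operation is made \<^const>\<open>undefined\<close> outside the
  universe, so that equal groups are equal as records.
\<close>

definition decode_grp :: "baire \<Rightarrow> nat ord_grp" where
  "decode_grp p =
    (let A = decode_set (baire_fst p);
         m = (\<lambda>a b. if a \<in> A \<and> b \<in> A then baire_fst (baire_snd p) (prod_encode (a, b))
                    else undefined)
     in \<lparr>carrier = A, mult = m, one = (THE e. e \<in> A \<and> (\<forall>a\<in>A. m e a = a \<and> m a e = a)),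
         le_rel = decode_rel (baire_snd (baire_snd p))\<rparr>)"

definition ord_grp_rep :: "nat ord_grp representation" where
  "ord_grp_rep p = (if ordered_group (decode_grp p) then Some (decode_grp p) else None)"


section \<open>The problems\<close>

definition OG_alpha_eps :: "(nat ord_grp, nat lin \<times> nat) problem" where
  "OG_alpha_eps =
    \<lparr>in_rep = ord_grp_rep, out_rep = prod_rep ordinal_rep bit_rep,
     solutions = (\<lambda>G. {(X, \<epsilon>). G \<in> points ord_grp_rep \<and> X \<in> ordinal_copies \<and> \<epsilon> \<in> {0, 1} \<and>
                       has_type_ZQ (order_of G) X \<epsilon>})\<rparr>"

definition OG_alpha :: "(nat ord_grp, nat lin) problem" where
  "OG_alpha =
    \<lparr>in_rep = ord_grp_rep, out_rep = ordinal_rep,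
     solutions = (\<lambda>G. {X. G \<in> points ord_grp_rep \<and> X \<in> ordinal_copies \<and>
                       (\<exists>\<epsilon>\<in>{0, 1}. has_type_ZQ (order_of G) X \<epsilon>)})\<rparr>"

text \<open>
  In the following two definitions it is enough to let the ordinal range over the copies on
  subsets of the natural numbers: if \<open>\<int>\<^sup>\<alpha>\<close> is countable, then so is \<open>\<alpha>\<close>.
\<close>

definition OG_alpha_0 :: "(nat ord_grp, nat lin) problem" where
  "OG_alpha_0 = restrict_problem OG_alpha
     {G. \<exists>X\<in>ordinal_copies. has_type_ZQ (order_of G) X 0}"

definition OG_alpha_1 :: "(nat ord_grp, nat lin) problem" where
  "OG_alpha_1 = restrict_problem OG_alpha
     {G. \<exists>X\<in>ordinal_copies. has_type_ZQ (order_of G) X 1}"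


section \<open>Well-formedness of the definitions\<close>

lemma points_ordinal_rep: "points ordinal_rep = ordinal_copies"
proof
  show "points ordinal_rep \<subseteq> ordinal_copies"
    by (auto simp: ran_def ordinal_rep_def Let_def split: if_splits)
  show "ordinal_copies \<subseteq> points ordinal_rep"
  proof
    fix X :: "nat lin" assume X: "X \<in> ordinal_copies"
    let ?p = "baire_pair (\<lambda>n. if n \<in> fst X then 1 else 0)
                (\<lambda>n. if prod_decode n \<in> snd X then 1 else 0)"
    have "ordinal_rep ?p = Some X"
      using X by (simp add: ordinal_rep_def decode_set_def decode_rel_def)
    then show "X \<in> points ordinal_rep" by (auto simp: ran_def)
  qed
qed

lemma points_bit_rep: "points bit_rep = {0, 1}"
proof -
  have "bit_rep (\<lambda>_. 0) = Some 0" "bit_rep (\<lambda>_. 1) = Some 1"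
    by (auto simp: bit_rep_def)
  then have "{0, 1} \<subseteq> points bit_rep" by (blast intro: ranI)
  then show ?thesis by (auto simp: ran_def bit_rep_def split: if_splits)
qed

lemma points_prod_rep: "points (prod_rep \<delta> \<delta>') = points \<delta> \<times> points \<delta>'"
proof
  show "points (prod_rep \<delta> \<delta>') \<subseteq> points \<delta> \<times> points \<delta>'"
    by (auto simp: ran_def prod_rep_def split: option.splits)
  show "points \<delta> \<times> points \<delta>' \<subseteq> points (prod_rep \<delta> \<delta>')"
  proof clarify
    fix x y assume "x \<in> points \<delta>" "y \<in> points \<delta>'"
    then obtain p q where "\<delta> p = Some x" "\<delta>' q = Some y" by (auto simp: ran_def)
    then have "prod_rep \<delta> \<delta>' (baire_pair p q) = Some (x, y)" by (simp add: prod_rep_def)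
    then show "(x, y) \<in> points (prod_rep \<delta> \<delta>')" unfolding ran_def by blast
  qed
qed

lemma is_problem_OG:
  "is_problem OG_alpha_0" "is_problem OG_alpha_1" "is_problem OG_alpha" "is_problem OG_alpha_eps"
  by (auto simp: is_problem_def problem_dom_def OG_alpha_0_def OG_alpha_1_def OG_alpha_def
      OG_alpha_eps_def restrict_problem_def points_ordinal_rep points_bit_rep points_prod_rep)

text \<open>Every ordered group on a set of natural numbers has a name.\<close>

lemma ordered_group_has_name:
  fixes G :: "nat ord_grp"
  assumes "ordered_group G"
  obtains p H where "ord_grp_rep p = Some H" "carrier H = carrier G" "one H = one G"
    "le_rel H = le_rel G"
    "\<And>a b. a \<in> carrier G \<Longrightarrow> b \<in> carrier G \<Longrightarrow> mult H a b = mult G a b"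
proof -
  interpret ordered_group G by fact
  define p where "p = baire_pair (\<lambda>n. if n \<in> carrier G then 1 else 0)
    (baire_pair (\<lambda>n. case prod_decode n of (a, b) \<Rightarrow> mult G a b)
       (\<lambda>n. if prod_decode n \<in> le_rel G then 1 else 0))"
  define H where "H = decode_grp p"
  have set: "decode_set (\<lambda>n. if n \<in> carrier G then 1 else 0) = carrier G"
    by (simp add: decode_set_def)
  have c: "carrier H = carrier G"
    by (simp add: H_def decode_grp_def p_def set Let_def)
  have l: "le_rel H = le_rel G"
    by (simp add: H_def decode_grp_def p_def Let_def decode_rel_def)
  have m: "mult H a b = mult G a b" if "a \<in> carrier G" "b \<in> carrier G" for a b
    using that by (simp add: H_def decode_grp_def p_def set Let_def)
  have "one H = (THE e. e \<in> carrier G \<and> (\<forall>a\<in>carrier G. mult H e a = a \<and> mult H a e = a))"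
    by (simp add: H_def decode_grp_def p_def set Let_def)
  also have "\<dots> = one G"
    by (rule the_equality) (auto simp: m intro: one_unique)
  finally have o: "one H = one G" .
  have "group H"
    by (rule groupI) (auto simp: c m o m_assoc intro: l_inv_ex)
  moreover have cl: "a \<in> carrier G \<and> b \<in> carrier G" if "(a, b) \<in> le_rel G" for a b
    using that linear_order by (auto simp: order_on_defs)
  have "ordered_group_axioms H"
    using linear_order mult_right_mono mult_left_mono cl
    by (auto simp: ordered_group_axioms_def c l) (metis cl m)+
  ultimately have "ordered_group H" by (simp add: ordered_group_def)
  then have "ord_grp_rep p = Some H" by (simp add: ord_grp_rep_def H_def)
  with c o l m show thesis using that by blast
qed

end

theory Submission
  imports Defs "HOL-Library.Countable_Set"
begin

text \<open>
  Multiplying a group by the ordered group \<open>\<int>[\<surd>2]\<close>, as the most significant factor, turns the type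
  \<open>\<int>\<^sup>\<alpha>\<rat>\<^sup>\<epsilon>\<close> into \<open>\<int>\<^sup>\<alpha>\<rat>\<close>, by Cantor's theorem on countable dense orders. As the type determines \<open>\<alpha>\<close> and
  \<open>\<epsilon>\<close> (the finite condensation, iterated along \<open>\<alpha>\<close>, has quotient \<open>\<rat>\<^sup>\<epsilon>\<close>), this reduces all the
  problems without the bit to the one for the types \<open>\<int>\<^sup>\<alpha>\<rat>\<close>.

  For the separations, a linear order \<open>L\<close> gives the group \<open>\<int>\<^sup>L\<close> of type \<open>\<int>\<^sup>L\<close> if \<open>L\<close> is a well-order and
  of type \<open>\<int>\<^sup>W\<rat>\<close> otherwise, where \<open>W\<close> is the well-founded part of \<open>L\<close>. By the
  boundedness theorem, an analytic set of well-orders (the image of a closed set of witnesses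
  under a continuous map) has countable supremum. Each of the reductions to be refuted yields such a
  set which contains all countable ordinals, up to isomorphism. Only the continuity of computable
  functions is used there.
\<close>

section \<open>Computations\<close>

text \<open>The two separations need different witnesses. Being a well-order is not a closed
  condition, so the set given to the boundedness theorem can only record an isomorphism with a power
  of an arbitrary linear order \<open>x\<close>. If the queried group has type
  \<open>\<int>\<^sup>\<beta>\<close>, uniqueness of the type forces \<open>x\<close> to be a
  well-order. If its type may be \<open>\<int>\<^sup>\<beta>\<rat>\<close>, it does not, as
  ill-founded orders give that type too. The second separation therefore certifies only a finite
  part of the exponent, as much as the program reads before it outputs its bit.

  Uniqueness rests on a contrast: \<open>\<rat>\<^sup>\<epsilon>\<close> has no two adjacent
  elements, while an unexhausted exponent would leave a factor \<open>\<int>\<close>, which has. The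
  dense factor is \<open>\<int>[\<surd>2]\<close> because its elements have unique codes without
  reduction to lowest terms, its order is decided by comparing squares, and multiplication by
  \<open>\<surd>2 - 1\<close> finds elements in between.\<close>

lemma computes_deterministic:
  "computes p e xs y \<Longrightarrow> computes p e xs z \<Longrightarrow> y = z"
proof (induction arbitrary: z rule: computes.induct)
  case (compose xs es ys e y)
  from compose.prems obtain ys' where
    ys': "list_all2 (\<lambda>e y. computes p e xs y) es ys'" and y: "computes p e ys' z"
    by (cases rule: computes.cases) auto
  have "ys = ys'"
  proof (rule nth_equalityI)
    show "length ys = length ys'"
      using list_all2_lengthD[OF compose.IH(1)] list_all2_lengthD[OF ys'] by simp
    show "ys ! i = ys' ! i" if "i < length ys" for i
    proof -
      from that have "i < length es" using list_all2_lengthD[OF compose.IH(1)] by simp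
      then show ?thesis using list_all2_nthD[OF compose.IH(1)] list_all2_nthD[OF ys'] by blast
    qed
  qed
  with y compose.IH show ?case by blast
next
  case (rec_0 e xs y e')
  from rec_0.prems show ?case by (cases rule: computes.cases) (auto intro: rec_0.IH)
next
  case (rec_Suc e e' n xs y z)
  from rec_Suc.prems show ?case by (cases rule: computes.cases) (auto dest: rec_Suc.IH)
next
  case (mu e n xs)
  from mu.prems obtain "computes p e (z # xs) 0" "\<forall>m<z. \<exists>k. computes p e (m # xs) (Suc k)"
    by (cases rule: computes.cases) auto
  with mu show ?case
    by (metis Suc_neq_Zero linorder_neqE_nat)
qed (auto elim: computes.cases)

section \<open>Finite use of the oracle\<close>

definition agree :: "nat \<Rightarrow> (nat \<Rightarrow> 'a) \<Rightarrow> (nat \<Rightarrow> 'a) \<Rightarrow> bool" where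
  "agree n s t \<longleftrightarrow> (\<forall>i<n. s i = t i)"

lemma agree_refl [simp]: "agree n s s"
  by (simp add: agree_def)

lemma agree_mono: "agree n s t \<Longrightarrow> m \<le> n \<Longrightarrow> agree m s t"
  by (simp add: agree_def)

lemma agree_sym: "agree n s t \<Longrightarrow> agree n t s"
  by (simp add: agree_def)

lemma agree_trans: "agree n s t \<Longrightarrow> agree n t u \<Longrightarrow> agree n s u"
  by (simp add: agree_def)

lemma agree_max [simp]: "agree (max m n) s t \<longleftrightarrow> agree m s t \<and> agree n s t"
  by (auto simp: agree_def less_max_iff_disj)

text \<open>The maximum of finitely many bounds works for all of them; this is the compactness used
  for lists of subprograms, for earlier values of a search and for finite supports.\<close>

lemma common_bound:
  assumes "finite I" "\<And>i. i \<in> I \<Longrightarrow> \<exists>N. \<forall>t. agree N s t \<longrightarrow> P i t"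
  shows "\<exists>N. \<forall>t. agree N s t \<longrightarrow> (\<forall>i\<in>I. P i t)"
  using assms
proof (induction I rule: finite_induct)
  case (insert i I)
  then obtain N M where "\<forall>t. agree N s t \<longrightarrow> (\<forall>i\<in>I. P i t)" "\<forall>t. agree M s t \<longrightarrow> P i t"
    by (metis insert_iff)
  then have "\<forall>t. agree (max N M) s t \<longrightarrow> (\<forall>i\<in>insert i I. P i t)"
    by auto
  then show ?case ..
qed simp

text \<open>The use principle: a halting computation asks its oracle finitely many questions. For
  \<open>Mu\<close> the bound must also cover the computations at all smaller arguments, which halt
  with a nonzero value.\<close>

lemma computes_use:
  "computes p e xs y \<Longrightarrow> \<exists>N. \<forall>q. agree N p q \<longrightarrow> computes q e xs y"
proof (induction rule: computes.induct)
  case (query x)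
  have "computes q Query [x] (p x)" if "agree (Suc x) p q" for q
    using computes.query[of q x] that by (simp add: agree_def)
  then show ?case by blast
next
  case (compose xs es ys e z)
  then have len: "length es = length ys" by (auto dest: list_all2_lengthD)
  have "\<exists>N. \<forall>q. agree N p q \<longrightarrow> (\<forall>i\<in>{..<length es}. computes q (es ! i) xs (ys ! i))"
    using compose.IH(1) by (intro common_bound) (auto dest: list_all2_nthD)
  then obtain N where
    N: "\<And>q. agree N p q \<Longrightarrow> list_all2 (\<lambda>e y. computes q e xs y) es ys"
    using len by (auto simp: list_all2_conv_all_nth)
  obtain M where "\<And>q. agree M p q \<Longrightarrow> computes q e ys z" using compose.IH by blast
  with N have "agree (max N M) p q \<Longrightarrow> computes q (Comp e es) xs z" for q
    by (auto intro!: computes.compose[where ys = ys])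
  then show ?case by blast
next
  case (rec_0 e xs y e')
  then show ?case by (blast intro: computes.rec_0)
next
  case (rec_Suc e e' n xs y z)
  then obtain N M where "\<And>q. agree N p q \<Longrightarrow> computes q (PrimRec e e') (n # xs) y"
    "\<And>q. agree M p q \<Longrightarrow> computes q e' (n # y # xs) z" by blast
  then have "agree (max N M) p q \<Longrightarrow> computes q (PrimRec e e') (Suc n # xs) z" for q
    by (auto intro: computes.rec_Suc)
  then show ?case by blast
next
  case (mu e n xs)
  from mu.IH(2) obtain k where
    k: "\<And>m. m < n \<Longrightarrow> \<exists>N. \<forall>q. agree N p q \<longrightarrow> computes q e (m # xs) (Suc (k m))"
    by metis
  have "\<exists>N. \<forall>q. agree N p q \<longrightarrow> (\<forall>m\<in>{..<n}. computes q e (m # xs) (Suc (k m)))"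
    using k by (intro common_bound) auto
  then obtain N where N: "\<And>q m. agree N p q \<Longrightarrow> m < n \<Longrightarrow> computes q e (m # xs) (Suc (k m))"
    by auto
  obtain M where M: "\<And>q. agree M p q \<Longrightarrow> computes q e (n # xs) 0" using mu.IH(1) by blast
  have "computes q (Mu e) xs n" if "agree (max N M) p q" for q
  proof -
    have "agree N p q" "agree M p q" using that by (auto intro: agree_mono)
    with N M show ?thesis by (blast intro: computes.mu)
  qed
  then show ?case by blast
qed (auto intro: computes.intros)

section \<open>Functions of an oracle and \<open>k\<close> numbers that one program computes for all
  oracles\<close>

definition total_rec :: "nat \<Rightarrow> (baire \<Rightarrow> nat list \<Rightarrow> nat) \<Rightarrow> bool" where
  "total_rec k f \<longleftrightarrow> (\<exists>e. \<forall>p xs. length xs = k \<longrightarrow> computes p e xs (f p xs))"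

lemma total_rec_comp:
  assumes g: "total_rec (length fs) g" and fs: "\<And>f. f \<in> set fs \<Longrightarrow> total_rec k f"
  shows "total_rec k (\<lambda>p xs. g p (map (\<lambda>f. f p xs) fs))"
proof -
  obtain e where e: "\<And>p xs. length xs = length fs \<Longrightarrow> computes p e xs (g p xs)"
    using g by (auto simp: total_rec_def)
  have "\<exists>es. length es = length fs \<and>
    (\<forall>i<length fs. \<forall>p xs. length xs = k \<longrightarrow> computes p (es ! i) xs ((fs ! i) p xs))"
    using fs by (subst Skolem_list_nth[symmetric]) (auto simp: total_rec_def)
  then obtain es where es: "length es = length fs"
    "\<And>i p xs. i < length fs \<Longrightarrow> length xs = k \<Longrightarrow> computes p (es ! i) xs ((fs ! i) p xs)"
    by auto
  have "computes p (Comp e es) xs (g p (map (\<lambda>f. f p xs) fs))" if "length xs = k" for p xs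
    by (rule computes.compose[OF _ e]) (use es that in \<open>auto simp: list_all2_conv_all_nth\<close>)
  then show ?thesis by (auto simp: total_rec_def)
qed

lemma total_rec_comp1:
  assumes "total_rec 1 (\<lambda>p xs. g p (xs ! 0))" "total_rec k f"
  shows "total_rec k (\<lambda>p xs. g p (f p xs))"
  using total_rec_comp[of "[f]" "\<lambda>p xs. g p (xs ! 0)" k] assms by simp

lemma total_rec_comp2:
  assumes "total_rec 2 (\<lambda>p xs. g p (xs ! 0) (xs ! 1))" "total_rec k f" "total_rec k f'"
  shows "total_rec k (\<lambda>p xs. g p (f p xs) (f' p xs))"
  using total_rec_comp[of "[f, f']" "\<lambda>p xs. g p (xs ! 0) (xs ! 1)" k] assms
  by (auto simp: numeral_2_eq_2)

lemma total_rec_zero: "total_rec k (\<lambda>p xs. 0)"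
  unfolding total_rec_def by (blast intro: computes.zero)

lemma total_rec_nth: "i < k \<Longrightarrow> total_rec k (\<lambda>p xs. xs ! i)"
  unfolding total_rec_def by (blast intro: computes.project)

lemma total_rec_Suc: "total_rec k f \<Longrightarrow> total_rec k (\<lambda>p xs. Suc (f p xs))"
proof (erule total_rec_comp1[rotated])
  show "total_rec 1 (\<lambda>p xs. Suc (xs ! 0))"
    unfolding total_rec_def
    by (rule exI[of _ Succ]) (auto simp: length_Suc_conv intro: computes.succ)
qed

lemma total_rec_query: "total_rec k f \<Longrightarrow> total_rec k (\<lambda>p xs. p (f p xs))"
proof (erule total_rec_comp1[rotated])
  show "total_rec 1 (\<lambda>p xs. p (xs ! 0))"
    unfolding total_rec_def
    by (rule exI[of _ Query]) (auto simp: length_Suc_conv intro: computes.query)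
qed

lemma total_rec_const: "total_rec k (\<lambda>p xs. c)"
  by (induction c) (auto intro: total_rec_zero total_rec_Suc)

text \<open>The step program of \<open>PrimRec\<close> receives the counter, the previous value and
  then the parameters, hence \<open>drop 2\<close>. Letting the number of iterations be a computed
  \<open>f\<close> gives a rule that matches goals in lambda form.\<close>

lemma total_rec_primrec:
  assumes g: "total_rec k (\<lambda>p. g p)" and h: "total_rec (Suc (Suc k)) (\<lambda>p xs. h p (xs ! 0) (xs ! 1) (drop 2 xs))"
    and f: "total_rec k f"
  shows "total_rec k (\<lambda>p xs. rec_nat (g p xs) (\<lambda>n y. h p n y xs) (f p xs))"
proof -
  obtain e e' where e: "\<And>p xs. length xs = k \<Longrightarrow> computes p e xs (g p xs)"
    and e': "\<And>p xs. length xs = Suc (Suc k) \<Longrightarrow> computes p e' xs (h p (xs ! 0) (xs ! 1) (drop 2 xs))"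
    using g h by (auto simp: total_rec_def)
  have step: "computes p e' (n # y # xs) (h p n y xs)" if "length xs = k" for p n y xs
    using e'[of "n # y # xs" p] that by simp
  have main: "computes p (PrimRec e e') (n # xs) (rec_nat (g p xs) (\<lambda>n y. h p n y xs) n)"
    if "length xs = k" for p n xs
    by (induction n) (auto intro: computes.rec_0 computes.rec_Suc e step that)
  have R: "total_rec (Suc k) (\<lambda>p xs. rec_nat (g p (tl xs)) (\<lambda>n y. h p n y (tl xs)) (xs ! 0))"
    unfolding total_rec_def
    by (rule exI[of _ "PrimRec e e'"]) (auto simp: length_Suc_conv intro: main)
  \<comment> \<open>The projections hand the parameters on unchanged, behind the computed recursion
    argument \<open>f\<close>.\<close>
  define fs where "fs = map (\<lambda>i (p :: baire) xs. xs ! i :: nat) [0..<k]"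
  have "total_rec k (\<lambda>p xs. (\<lambda>p xs. rec_nat (g p (tl xs)) (\<lambda>n y. h p n y (tl xs)) (xs ! 0)) p
      (map (\<lambda>f. f p xs) (f # fs)))"
    by (rule total_rec_comp) (use R f in \<open>auto simp: fs_def intro: total_rec_nth\<close>)
  moreover have "map (\<lambda>f. f p xs) fs = xs" if "length xs = k" for p xs
    using that by (auto simp: fs_def intro: nth_equalityI)
  ultimately show ?thesis unfolding total_rec_def by simp
qed


lemma total_rec_add:
  assumes "total_rec k f" "total_rec k g"
  shows "total_rec k (\<lambda>p xs. f p xs + g p xs)"
proof -
  have "total_rec k (\<lambda>p xs. rec_nat (f p xs) (\<lambda>n y. Suc y) (g p xs))"
    using assms by (intro total_rec_primrec total_rec_Suc total_rec_nth) auto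
  moreover have "rec_nat a (\<lambda>n y. Suc y) b = a + b" for a b
    by (induction b) auto
  ultimately show ?thesis by simp
qed

lemma total_rec_mult:
  assumes "total_rec k f" "total_rec k g"
  shows "total_rec k (\<lambda>p xs. f p xs * g p xs)"
proof -
  have "total_rec 2 (\<lambda>p xs. xs ! 0 * xs ! 1)"
  proof -
    have "total_rec 2 (\<lambda>p xs. rec_nat 0 (\<lambda>n y. y + xs ! 1) (xs ! 0))"
    proof (rule total_rec_primrec)
      have "total_rec (Suc (Suc 2)) (\<lambda>p xs. xs ! 1 + xs ! 3)"
        by (intro total_rec_add total_rec_nth) auto
      then show "total_rec (Suc (Suc 2)) (\<lambda>p xs. xs ! 1 + drop 2 xs ! 1)"
        by (simp add: total_rec_def)
    qed (auto intro: total_rec_zero total_rec_nth)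
    moreover have "rec_nat 0 (\<lambda>n y. y + b) a = a * b" for a b :: nat
      by (induction a) auto
    ultimately show ?thesis by simp
  qed
  from total_rec_comp2[OF this assms] show ?thesis .
qed

lemma total_rec_diff:
  assumes "total_rec k f" "total_rec k g"
  shows "total_rec k (\<lambda>p xs. f p xs - g p xs)"
proof -
  have pred: "total_rec k (\<lambda>p xs. f p xs - 1)" if "total_rec k f" for k f
  proof -
    have "total_rec k (\<lambda>p xs. rec_nat 0 (\<lambda>n y. n) (f p xs))"
      using that by (intro total_rec_primrec total_rec_nth total_rec_zero) auto
    moreover have "rec_nat 0 (\<lambda>n y. n) b = b - 1" for b :: nat
      by (cases b) auto
    ultimately show ?thesis by simp
  qed
  have "total_rec k (\<lambda>p xs. rec_nat (f p xs) (\<lambda>n y. y - 1) (g p xs))"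
    using assms by (intro total_rec_primrec pred total_rec_nth) auto
  moreover have "rec_nat a (\<lambda>n y. y - 1) b = a - b" for a b :: nat
    by (induction b) auto
  ultimately show ?thesis by simp
qed

text \<open>With truncated subtraction, \<open>1 - a\<close> is the indicator of
  \<open>a = 0\<close>, so a definition by cases becomes a sum of two products. This is why later
  definitions branch on tests for zero only.\<close>

lemma total_rec_if:
  assumes "total_rec k f" "total_rec k g" "total_rec k h"
  shows "total_rec k (\<lambda>p xs. if f p xs = 0 then g p xs else h p xs)"
proof -
  have "total_rec k (\<lambda>p xs. (1 - f p xs) * g p xs + (1 - (1 - f p xs)) * h p xs)"
    using assms by (intro total_rec_add total_rec_mult total_rec_diff total_rec_const)
  moreover have "(1 - a) * b + (1 - (1 - a)) * c = (if a = 0 then b else c)" for a b c :: nat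
    by simp
  ultimately show ?thesis by simp
qed

section \<open>The pairing function and its inverses\<close>

lemma total_rec_triangle:
  assumes "total_rec k f"
  shows "total_rec k (\<lambda>p xs. triangle (f p xs))"
proof -
  have "total_rec k (\<lambda>p xs. rec_nat 0 (\<lambda>n y. y + Suc n) (f p xs))"
    using assms by (intro total_rec_primrec total_rec_add total_rec_Suc total_rec_nth total_rec_zero) auto
  moreover have "rec_nat 0 (\<lambda>n y. y + Suc n) b = triangle b" for b :: nat
    by (induction b) auto
  ultimately show ?thesis by simp
qed

lemma total_rec_prod_encode:
  assumes "total_rec k f" "total_rec k g"
  shows "total_rec k (\<lambda>p xs. prod_encode (f p xs, g p xs))"
  unfolding prod_encode_def split using assms
  by (intro total_rec_add total_rec_triangle)

text \<open>The index of the diagonal containing \<open>n\<close> in the enumeration of pairs.\<close>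

definition diagonal :: "nat \<Rightarrow> nat" where
  "diagonal n = rec_nat 0 (\<lambda>m d. if triangle (Suc d) - Suc m = 0 then Suc d else d) n"

lemma diagonal_bounds: "triangle (diagonal n) \<le> n \<and> n < triangle (Suc (diagonal n))"
  by (induction n) (auto simp: diagonal_def)

lemma diagonal_prod_encode: "diagonal (prod_encode (a, b)) = a + b"
proof -
  have mono: "triangle m \<le> triangle n" if "m \<le> n" for m n
    using that by (induction rule: dec_induct) auto
  let ?n = "prod_encode (a, b)"
  have "triangle (a + b) \<le> ?n" "?n < triangle (Suc (a + b))"
    by (auto simp: prod_encode_def)
  moreover note diagonal_bounds[of ?n]
  ultimately have "\<not> Suc (a + b) \<le> diagonal ?n" "\<not> Suc (diagonal ?n) \<le> a + b"
    using mono by (meson le_less_trans not_less)+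
  then show ?thesis by linarith
qed

definition pfst :: "nat \<Rightarrow> nat" where
  "pfst n = fst (prod_decode n)"

definition psnd :: "nat \<Rightarrow> nat" where
  "psnd n = snd (prod_decode n)"

lemma pfst_encode [simp]: "pfst (prod_encode (a, b)) = a"
  and psnd_encode [simp]: "psnd (prod_encode (a, b)) = b"
  by (simp_all add: pfst_def psnd_def)

lemma prod_encode_pfst_psnd [simp]: "prod_encode (pfst n, psnd n) = n"
  by (simp add: pfst_def psnd_def)

text \<open>As \<open>prod_encode (a, b)\<close> is \<open>triangle (a + b) + a\<close>, removing
  the triangular number of the diagonal leaves \<open>a\<close>, and \<open>b\<close> is the rest of
  \<open>a + b\<close>.\<close>

lemma pfst_diagonal: "pfst n = n - triangle (diagonal n)"
  and psnd_diagonal: "psnd n = diagonal n - pfst n"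
proof -
  obtain a b where n: "n = prod_encode (a, b)" by (metis prod_encode_pfst_psnd)
  show "pfst n = n - triangle (diagonal n)"
    unfolding n diagonal_prod_encode pfst_encode by (simp add: prod_encode_def)
  show "psnd n = diagonal n - pfst n"
    by (simp add: n diagonal_prod_encode)
qed

lemma total_rec_diagonal:
  assumes "total_rec k f"
  shows "total_rec k (\<lambda>p xs. diagonal (f p xs))"
  unfolding diagonal_def using assms
  by (intro total_rec_primrec total_rec_if total_rec_diff total_rec_triangle total_rec_Suc
      total_rec_nth total_rec_zero) auto

lemma total_rec_pfst: "total_rec k f \<Longrightarrow> total_rec k (\<lambda>p xs. pfst (f p xs))"
  unfolding pfst_diagonal by (intro total_rec_diff total_rec_triangle total_rec_diagonal)

lemma total_rec_psnd: "total_rec k f \<Longrightarrow> total_rec k (\<lambda>p xs. psnd (f p xs))"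
  unfolding psnd_diagonal by (intro total_rec_diff total_rec_diagonal total_rec_pfst)

lemma total_rec_div2:
  assumes "total_rec k f"
  shows "total_rec k (\<lambda>p xs. f p xs div 2)" and "total_rec k (\<lambda>p xs. f p xs mod 2)"
proof -
  have m: "total_rec k (\<lambda>p xs. f p xs mod 2)" if f: "total_rec k f" for k f
  proof -
    have "total_rec k (\<lambda>p xs. rec_nat 0 (\<lambda>n y. 1 - y) (f p xs))"
      using f by (intro total_rec_primrec total_rec_diff total_rec_const total_rec_nth) auto
    moreover have "rec_nat 0 (\<lambda>n y. 1 - y) b = b mod 2" for b :: nat
      by (induction b) (auto simp: mod_Suc)
    ultimately show ?thesis by simp
  qed
  then show "total_rec k (\<lambda>p xs. f p xs mod 2)" using assms .
  \<comment> \<open>Half of \<open>b\<close>, rounded down, is the number of odd numbers below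
    \<open>b\<close>.\<close>
  have "total_rec k (\<lambda>p xs. rec_nat 0 (\<lambda>n y. y + n mod 2) (f p xs))"
    using assms by (intro total_rec_primrec total_rec_add m total_rec_const total_rec_nth) auto
  moreover have "rec_nat 0 (\<lambda>n y. y + n mod 2) b = b div 2" for b :: nat
    by (induction b) (auto simp: div_Suc mod_Suc)
  ultimately show "total_rec k (\<lambda>p xs. f p xs div 2)" by simp
qed

lemma total_rec_pair:
  assumes "total_rec 1 (\<lambda>p xs. f p (xs ! 0))" "total_rec 1 (\<lambda>p xs. g p (xs ! 0))"
  shows "total_rec 1 (\<lambda>p xs. baire_pair (f p) (g p) (xs ! 0))"
proof -
  have "total_rec 1 (\<lambda>p xs. if xs ! 0 mod 2 = 0 then f p (xs ! 0 div 2) else g p (xs ! 0 div 2))"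
    by (intro total_rec_if total_rec_comp1[OF assms(1)] total_rec_comp1[OF assms(2)]
        total_rec_div2 total_rec_nth) simp_all
  then show ?thesis
    by (simp add: baire_pair_def even_iff_mod_2_eq_zero)
qed

lemma computable_total_rec:
  assumes "total_rec 1 (\<lambda>p xs. F p (xs ! 0))"
  shows "computable (\<lambda>p. Some (F p))"
proof -
  obtain e where "\<And>p xs. length xs = 1 \<Longrightarrow> computes p e xs (F p (xs ! 0))"
    using assms by (auto simp: total_rec_def)
  from this[of "[n]" for n] show ?thesis by (auto simp: computable_def)
qed

lemma computable_id: "computable (\<lambda>p. Some p)"
  by (rule computable_total_rec) (auto intro: total_rec_query total_rec_nth)

lemma computable_snd: "computable (\<lambda>p. Some (baire_snd p))"
  unfolding baire_snd_def
  by (rule computable_total_rec)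
    (intro total_rec_query total_rec_add total_rec_mult total_rec_const total_rec_nth; simp)

lemma computable_fst_snd: "computable (\<lambda>p. Some (baire_fst (baire_snd p)))"
  unfolding baire_fst_def baire_snd_def
  by (rule computable_total_rec)
    (intro total_rec_query total_rec_add total_rec_mult total_rec_const total_rec_nth; simp)

section \<open>Linear orders\<close>

definition lin_ord :: "'a lin \<Rightarrow> bool" where
  "lin_ord X \<longleftrightarrow> strict_linear_order_on (fst X) (snd X) \<and> snd X \<subseteq> fst X \<times> fst X"

lemma lin_ordI:
  assumes "\<And>a b. (a, b) \<in> snd X \<Longrightarrow> a \<in> fst X \<and> b \<in> fst X"
    "\<And>a. (a, a) \<notin> snd X"
    "\<And>a b c. (a, b) \<in> snd X \<Longrightarrow> (b, c) \<in> snd X \<Longrightarrow> (a, c) \<in> snd X"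
    "\<And>a b. a \<in> fst X \<Longrightarrow> b \<in> fst X \<Longrightarrow> a \<noteq> b \<Longrightarrow> (a, b) \<in> snd X \<or> (b, a) \<in> snd X"
  shows "lin_ord X"
proof -
  have "trans (snd X)" using assms(3) by (rule transI)
  moreover have "irrefl (snd X)" "total_on (fst X) (snd X)"
    using assms(2,4) by (simp_all add: irrefl_def total_on_def)
  moreover have "snd X \<subseteq> fst X \<times> fst X" using assms(1) by auto
  ultimately show ?thesis by (simp add: lin_ord_def strict_linear_order_on_def)
qed

lemma lin_ordD:
  assumes "lin_ord X"
  shows lin_ord_mem: "(a, b) \<in> snd X \<Longrightarrow> a \<in> fst X \<and> b \<in> fst X"
    and lin_ord_irrefl: "(a, a) \<notin> snd X"
    and lin_ord_trans: "(a, b) \<in> snd X \<Longrightarrow> (b, c) \<in> snd X \<Longrightarrow> (a, c) \<in> snd X"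
    and lin_ord_total: "a \<in> fst X \<Longrightarrow> b \<in> fst X \<Longrightarrow> a \<noteq> b \<Longrightarrow> (a, b) \<in> snd X \<or> (b, a) \<in> snd X"
    and lin_ord_asym: "(a, b) \<in> snd X \<Longrightarrow> (b, a) \<notin> snd X"
  using assms unfolding lin_ord_def strict_linear_order_on_def trans_def irrefl_def total_on_def
  by blast+

lemma lin_ord_converse: "lin_ord (A, R) \<Longrightarrow> lin_ord (A, R\<inverse>)"
  unfolding lin_ord_def strict_linear_order_on_def trans_def irrefl_def total_on_def
  by auto

section \<open>Isomorphisms of linear orders\<close>

lemma same_order_typeI:
  assumes "lin_ord X" "lin_ord Y" "bij_betw h (fst X) (fst Y)"
    and "\<And>a b. (a, b) \<in> snd X \<Longrightarrow> (h a, h b) \<in> snd Y"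
  shows "same_order_type X Y"
  unfolding same_order_type_def
proof (intro exI conjI ballI)
  show "((a, b) \<in> snd X) = ((h a, h b) \<in> snd Y)" if "a \<in> fst X" "b \<in> fst X" for a b
    using assms(4) lin_ord_total[OF assms(1) that] lin_ord_asym[OF assms(2)]
      lin_ord_irrefl[OF assms(2)] by metis
qed (fact assms(3))

lemma same_order_type_refl: "same_order_type X X"
  unfolding same_order_type_def by (rule exI[of _ id]) auto

lemma same_order_type_sym:
  assumes "same_order_type X Y" shows "same_order_type Y X"
proof -
  obtain h where h: "bij_betw h (fst X) (fst Y)"
    "\<And>a b. a \<in> fst X \<Longrightarrow> b \<in> fst X \<Longrightarrow> (a, b) \<in> snd X \<longleftrightarrow> (h a, h b) \<in> snd Y"
    using assms by (auto simp: same_order_type_def)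
  show ?thesis unfolding same_order_type_def
  proof (intro exI conjI ballI)
    show "bij_betw (inv_into (fst X) h) (fst Y) (fst X)" using h(1) by (rule bij_betw_inv_into)
    then have g: "inv_into (fst X) h a \<in> fst X" "h (inv_into (fst X) h a) = a" if "a \<in> fst Y" for a
      using that h(1) by (blast intro: bij_betw_apply bij_betw_inv_into_right)+
    show "(a, b) \<in> snd Y \<longleftrightarrow> (inv_into (fst X) h a, inv_into (fst X) h b) \<in> snd X"
      if "a \<in> fst Y" "b \<in> fst Y" for a b
      using h(2)[OF g(1) g(1)] g(2) that by simp
  qed
qed

lemma same_order_type_trans:
  assumes "same_order_type X Y" "same_order_type Y Z" shows "same_order_type X Z"
proof -
  obtain h where h: "bij_betw h (fst X) (fst Y)"
    "\<And>a b. a \<in> fst X \<Longrightarrow> b \<in> fst X \<Longrightarrow> (a, b) \<in> snd X \<longleftrightarrow> (h a, h b) \<in> snd Y"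
    using assms by (auto simp: same_order_type_def)
  obtain k where k: "bij_betw k (fst Y) (fst Z)"
    "\<And>a b. a \<in> fst Y \<Longrightarrow> b \<in> fst Y \<Longrightarrow> (a, b) \<in> snd Y \<longleftrightarrow> (k a, k b) \<in> snd Z"
    using assms by (auto simp: same_order_type_def)
  show ?thesis unfolding same_order_type_def
  proof (intro exI conjI ballI)
    show "bij_betw (k \<circ> h) (fst X) (fst Z)" using h(1) k(1) by (rule bij_betw_trans)
    show "(a, b) \<in> snd X \<longleftrightarrow> ((k \<circ> h) a, (k \<circ> h) b) \<in> snd Z"
      if "a \<in> fst X" "b \<in> fst X" for a b
      using h(2)[OF that] k(2)[OF bij_betw_apply[OF h(1)] bij_betw_apply[OF h(1)]] that by simp
  qed
qed

text \<open>An isomorphism only compares pairs inside the carriers, so that the relation of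
  \<open>Y\<close> stays on its carrier has to be assumed separately.\<close>

lemma lin_ord_same_order_type:
  assumes "same_order_type X Y" "lin_ord X" "snd Y \<subseteq> fst Y \<times> fst Y" shows "lin_ord Y"
proof -
  obtain h where h: "bij_betw h (fst Y) (fst X)"
    "\<And>a b. a \<in> fst Y \<Longrightarrow> b \<in> fst Y \<Longrightarrow> (a, b) \<in> snd Y \<longleftrightarrow> (h a, h b) \<in> snd X"
    using same_order_type_sym[OF assms(1)] by (auto simp: same_order_type_def)
  have mem: "a \<in> fst Y \<and> b \<in> fst Y" if "(a, b) \<in> snd Y" for a b
    using that assms(3) by auto
  have inj: "h a \<noteq> h b" if "a \<in> fst Y" "b \<in> fst Y" "a \<noteq> b" for a b
    using that h(1) by (auto simp: bij_betw_def inj_on_def)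
  note X = lin_ordD[OF assms(2)]
  show ?thesis
  proof (rule lin_ordI)
    show "(a, a) \<notin> snd Y" for a using mem h X(2) by blast
    show "(a, c) \<in> snd Y" if "(a, b) \<in> snd Y" "(b, c) \<in> snd Y" for a b c
      using mem h X(3) that by metis
    show "(a, b) \<in> snd Y \<or> (b, a) \<in> snd Y" if "a \<in> fst Y" "b \<in> fst Y" "a \<noteq> b" for a b
      using h(2) that X(4)[OF bij_betw_apply[OF h(1)] bij_betw_apply[OF h(1)] inj[OF that]] by simp
  qed (use mem in blast)
qed

lemma wf_same_order_type:
  assumes "same_order_type X Y" "wf (snd Y)" "snd X \<subseteq> fst X \<times> fst X" shows "wf (snd X)"
proof -
  obtain h where "\<And>a b. a \<in> fst X \<Longrightarrow> b \<in> fst X \<Longrightarrow> (a, b) \<in> snd X \<longleftrightarrow> (h a, h b) \<in> snd Y"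
    using assms(1) by (auto simp: same_order_type_def)
  then have "snd X \<subseteq> inv_image (snd Y) h" using assms(3) by (auto simp: inv_image_def)
  then show ?thesis using wf_inv_image[OF assms(2)] wf_subset by blast
qed

lemma ex_max:
  assumes "lin_ord X" "finite F" "F \<noteq> {}" "F \<subseteq> fst X"
  shows "\<exists>m\<in>F. \<forall>x\<in>F. x = m \<or> (x, m) \<in> snd X"
  using assms(2-)
proof (induction F rule: finite_ne_induct)
  case (insert x F)
  then obtain m where m: "m \<in> F" "\<And>y. y \<in> F \<Longrightarrow> y = m \<or> (y, m) \<in> snd X" by auto
  show ?case
  proof (cases "(x, m) \<in> snd X")
    case True
    show ?thesis by (rule bexI[of _ m]) (use m True in auto)
  next
    case False
    have "m \<noteq> x" "x \<in> fst X" "m \<in> fst X" using m(1) insert by auto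
    then have mx: "(m, x) \<in> snd X" using False lin_ord_total[OF assms(1), of m x] by simp
    have "(y, x) \<in> snd X" if "y \<in> F" for y
      using m(2)[OF that] mx lin_ord_trans[OF assms(1), of y m x] by auto
    then show ?thesis by auto
  qed
qed simp

lemma ex_min:
  assumes "lin_ord X" "finite F" "F \<noteq> {}" "F \<subseteq> fst X"
  shows "\<exists>m\<in>F. \<forall>x\<in>F. x = m \<or> (m, x) \<in> snd X"
proof -
  have "lin_ord (fst X, (snd X)\<inverse>)" using assms(1) lin_ord_converse[of "fst X" "snd X"] by simp
  from ex_max[OF this assms(2,3)] assms(4) show ?thesis by simp
qed

section \<open>Initial segments, lexicographic products and suborders of the rationals\<close>

definition restr :: "'a lin \<Rightarrow> 'a set \<Rightarrow> 'a lin" where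
  "restr X I = (fst X \<inter> I, snd X \<inter> I \<times> I)"

lemma fst_restr [simp]: "fst (restr X I) = fst X \<inter> I"
  and mem_snd_restr [simp]: "(a, b) \<in> snd (restr X I) \<longleftrightarrow> (a, b) \<in> snd X \<and> a \<in> I \<and> b \<in> I"
  by (auto simp: restr_def)

lemma lin_ord_restr: assumes "lin_ord X" shows "lin_ord (restr X I)"
proof (rule lin_ordI)
  show "(a, c) \<in> snd (restr X I)" if "(a, b) \<in> snd (restr X I)" "(b, c) \<in> snd (restr X I)" for a b c
    using that lin_ord_trans[OF assms, of a b c] by simp
  show "(a, b) \<in> snd (restr X I) \<or> (b, a) \<in> snd (restr X I)"
    if "a \<in> fst (restr X I)" "b \<in> fst (restr X I)" "a \<noteq> b" for a b
    using that lin_ord_total[OF assms, of a b] by simp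
  show "a \<in> fst (restr X I) \<and> b \<in> fst (restr X I)" if "(a, b) \<in> snd (restr X I)" for a b
    using that lin_ord_mem[OF assms, of a b] by simp
qed (simp add: lin_ord_irrefl[OF assms])

definition initial_seg :: "'a lin \<Rightarrow> 'a set \<Rightarrow> bool" where
  "initial_seg X I \<longleftrightarrow> I \<subseteq> fst X \<and> (\<forall>a b. (a, b) \<in> snd X \<and> b \<in> I \<longrightarrow> a \<in> I)"

lemma lin_ord_prod:
  assumes "lin_ord X" "lin_ord Y" shows "lin_ord (lin_prod X Y)"
proof (rule lin_ordI)
  show "(a, c) \<in> snd (lin_prod X Y)" if "(a, b) \<in> snd (lin_prod X Y)" "(b, c) \<in> snd (lin_prod X Y)" for a b c
    using that lin_ord_trans[OF assms(1), of "fst a" "fst b" "fst c"]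
      lin_ord_trans[OF assms(2), of "snd a" "snd b" "snd c"] by (auto simp: lin_prod_def)
  show "(a, b) \<in> snd (lin_prod X Y) \<or> (b, a) \<in> snd (lin_prod X Y)"
    if "a \<in> fst (lin_prod X Y)" "b \<in> fst (lin_prod X Y)" "a \<noteq> b" for a b
    using that lin_ord_total[OF assms(1), of "fst a" "fst b"]
      lin_ord_total[OF assms(2), of "snd a" "snd b"]
    by (cases "snd a = snd b") (auto simp: lin_prod_def)
qed (use lin_ord_irrefl[OF assms(1)] lin_ord_irrefl[OF assms(2)] in \<open>auto simp: lin_prod_def\<close>)

lemma lin_prod_cong:
  assumes "same_order_type X X'" "same_order_type Y Y'"
  shows "same_order_type (lin_prod X Y) (lin_prod X' Y')"
proof -
  obtain h where h: "bij_betw h (fst X) (fst X')"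
    "\<And>a b. a \<in> fst X \<Longrightarrow> b \<in> fst X \<Longrightarrow> (a, b) \<in> snd X \<longleftrightarrow> (h a, h b) \<in> snd X'"
    using assms by (auto simp: same_order_type_def)
  obtain k where k: "bij_betw k (fst Y) (fst Y')"
    "\<And>a b. a \<in> fst Y \<Longrightarrow> b \<in> fst Y \<Longrightarrow> (a, b) \<in> snd Y \<longleftrightarrow> (k a, k b) \<in> snd Y'"
    using assms by (auto simp: same_order_type_def)
  have inj: "k a = k b \<longleftrightarrow> a = b" if "a \<in> fst Y" "b \<in> fst Y" for a b
    using that k(1) by (auto simp: bij_betw_def inj_on_def)
  show ?thesis unfolding same_order_type_def
    by (rule exI[of _ "map_prod h k"])
      (use h k inj bij_betw_apply[OF h(1)] bij_betw_apply[OF k(1)] in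
        \<open>auto simp: lin_prod_def intro!: bij_betw_map_prod\<close>)
qed

lemma lin_prod_assoc:
  "same_order_type (lin_prod (lin_prod X Y) Z) (lin_prod X (lin_prod Y Z))"
  unfolding same_order_type_def
proof (rule exI[of _ "\<lambda>((x, y), z). (x, (y, z))"], intro conjI)
  show "bij_betw (\<lambda>((x, y), z). (x, (y, z))) (fst (lin_prod (lin_prod X Y) Z))
    (fst (lin_prod X (lin_prod Y Z)))"
    by (rule bij_betw_byWitness[where f' = "\<lambda>(x, (y, z)). ((x, y), z)"])
      (auto simp: lin_prod_def)
qed (auto simp: lin_prod_def)

definition rat_lin :: "rat set \<Rightarrow> rat lin" where
  "rat_lin A = (A, {(a, b). a \<in> A \<and> b \<in> A \<and> a < b})"

lemma fst_rat_lin [simp]: "fst (rat_lin A) = A"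
  and mem_snd_rat_lin [simp]: "(a, b) \<in> snd (rat_lin A) \<longleftrightarrow> a \<in> A \<and> b \<in> A \<and> a < b"
  by (auto simp: rat_lin_def)

lemma lin_ord_rat_lin: "lin_ord (rat_lin A)"
  by (rule lin_ordI) auto

lemma Q_lin_eq: "Q_lin = rat_lin UNIV"
  by (auto simp: Q_lin_def rat_lin_def)

text \<open>The factors \<open>\<rat>\<^sup>0\<close> and \<open>\<rat>\<^sup>1\<close>, on a common type.\<close>

definition q_pow :: "nat \<Rightarrow> rat lin" where
  "q_pow \<epsilon> = rat_lin (if \<epsilon> = 0 then {0} else UNIV)"

lemma lin_prod_singleton: "same_order_type (lin_prod X (rat_lin {c})) X"
  unfolding same_order_type_def
proof (rule exI[of _ fst], intro conjI)
  show "bij_betw fst (fst (lin_prod X (rat_lin {c}))) (fst X)"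
    by (rule bij_betw_byWitness[where f' = "\<lambda>x. (x, c)"]) (auto simp: lin_prod_def)
qed (auto simp: lin_prod_def)

lemma has_type_ZQ_iff:
  assumes "\<epsilon> \<in> {0, 1}"
  shows "has_type_ZQ L X \<epsilon> \<longleftrightarrow> same_order_type L (lin_prod (Z_pow X) (q_pow \<epsilon>))"
proof (cases "\<epsilon> = 0")
  case True
  have "same_order_type (lin_prod (Z_pow X) (q_pow 0)) (Z_pow X)"
    unfolding q_pow_def by (simp add: lin_prod_singleton)
  then show ?thesis unfolding True has_type_ZQ_def
    by (meson same_order_type_sym same_order_type_trans zero_neq_one)
next
  case False
  with assms show ?thesis by (auto simp: has_type_ZQ_def q_pow_def Q_lin_eq)
qed

section \<open>Powers of the integers\<close>

lemma fin_suppI: "finite {x. f x \<noteq> 0} \<Longrightarrow> (\<And>x. f x \<noteq> 0 \<Longrightarrow> x \<in> A) \<Longrightarrow> f \<in> fin_supp A"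
  by (auto simp: fin_supp_def)

lemma fin_supp_outside: "f \<in> fin_supp A \<Longrightarrow> x \<notin> A \<Longrightarrow> f x = 0"
  by (auto simp: fin_supp_def)

lemma fin_supp_zero: "(\<lambda>x. 0) \<in> fin_supp A"
  by (simp add: fin_supp_def)

lemma fin_supp_add: "f \<in> fin_supp A \<Longrightarrow> g \<in> fin_supp A \<Longrightarrow> (\<lambda>x. f x + g x) \<in> fin_supp A"
proof (rule fin_suppI)
  assume fg: "f \<in> fin_supp A" "g \<in> fin_supp A"
  have "{x. f x + g x \<noteq> 0} \<subseteq> {x. f x \<noteq> 0} \<union> {x. g x \<noteq> 0}" by auto
  then show "finite {x. f x + g x \<noteq> 0}"
    by (rule finite_subset) (use fg in \<open>auto simp: fin_supp_def\<close>)
  show "x \<in> A" if "f x + g x \<noteq> 0" for x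
    using that fg fin_supp_outside[of f A x] fin_supp_outside[of g A x] by (cases "x \<in> A") auto
qed

lemma fin_supp_uminus: "f \<in> fin_supp A \<Longrightarrow> (\<lambda>x. - f x) \<in> fin_supp A"
  by (simp add: fin_supp_def)

lemma fin_supp_upd:
  assumes "f \<in> fin_supp A" "x \<in> A" shows "f(x := c) \<in> fin_supp A"
proof (rule fin_suppI)
  have "{y. (f(x := c)) y \<noteq> 0} \<subseteq> insert x {y. f y \<noteq> 0}" by auto
  then show "finite {y. (f(x := c)) y \<noteq> 0}"
    by (rule finite_subset) (use assms in \<open>auto simp: fin_supp_def\<close>)
qed (use assms in \<open>auto simp: fin_supp_def split: if_splits\<close>)

lemma fin_supp_mono: "f \<in> fin_supp A \<Longrightarrow> A \<subseteq> B \<Longrightarrow> f \<in> fin_supp B"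
  by (auto simp: fin_supp_def)

lemma fst_Z_pow [simp]: "fst (Z_pow X) = fin_supp (fst X)"
  by (simp add: Z_pow_def)

text \<open>In a linear order, all other differences lie below \<open>x\<close> exactly if the
  functions agree above \<open>x\<close>. Comparisons are always made in this second form, which
  does not speak of a maximum.\<close>

lemma Z_pow_less:
  assumes "lin_ord X"
  shows "(f, g) \<in> snd (Z_pow X) \<longleftrightarrow> f \<in> fin_supp (fst X) \<and> g \<in> fin_supp (fst X) \<and>
    (\<exists>x\<in>fst X. f x < g x \<and> (\<forall>y. (x, y) \<in> snd X \<longrightarrow> f y = g y))"
proof -
  have "(f x \<noteq> g x \<and> (\<forall>y\<in>fst X. f y \<noteq> g y \<longrightarrow> y = x \<or> (y, x) \<in> snd X) \<and> f x < g x) \<longleftrightarrow>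
      f x < g x \<and> (\<forall>y. (x, y) \<in> snd X \<longrightarrow> f y = g y)" if x: "x \<in> fst X" for x
  proof -
    have "y = x \<or> (y, x) \<in> snd X \<longleftrightarrow> (x, y) \<notin> snd X" if "y \<in> fst X" for y
      using lin_ord_total[OF assms x that] lin_ord_asym[OF assms, of x y] lin_ord_irrefl[OF assms] by auto
    then show ?thesis using lin_ord_mem[OF assms, of x] by auto
  qed
  then show ?thesis by (simp add: Z_pow_def cong: bex_cong)
qed

lemma Z_pow_lessI:
  assumes "lin_ord X" "f \<in> fin_supp (fst X)" "g \<in> fin_supp (fst X)" "x \<in> fst X" "f x < g x"
    "\<And>y. (x, y) \<in> snd X \<Longrightarrow> f y = g y"
  shows "(f, g) \<in> snd (Z_pow X)"
  using assms by (auto simp: Z_pow_less)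

lemma Z_pow_lessE:
  assumes "(f, g) \<in> snd (Z_pow X)" "lin_ord X"
  obtains x where "f \<in> fin_supp (fst X)" "g \<in> fin_supp (fst X)" "x \<in> fst X" "f x < g x"
    "\<And>y. (x, y) \<in> snd X \<Longrightarrow> f y = g y"
  using assms by (auto simp: Z_pow_less)

lemma fin_supp_max_diff:
  assumes "lin_ord X" "f \<in> fin_supp (fst X)" "g \<in> fin_supp (fst X)" "f \<noteq> g"
  shows "\<exists>x\<in>fst X. f x \<noteq> g x \<and> (\<forall>y. (x, y) \<in> snd X \<longrightarrow> f y = g y)"
proof -
  let ?D = "{x. f x \<noteq> g x}"
  have sub: "?D \<subseteq> {x. f x \<noteq> 0} \<union> {x. g x \<noteq> 0}" by auto
  have "finite ?D"
    by (rule finite_subset[OF sub]) (use assms in \<open>auto simp: fin_supp_def\<close>)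
  moreover have "?D \<noteq> {}" "?D \<subseteq> fst X" using assms sub by (auto simp: fin_supp_def)
  ultimately obtain m where m: "m \<in> ?D" "\<forall>x\<in>?D. x = m \<or> (x, m) \<in> snd X"
    using ex_max[OF assms(1), of ?D] by blast
  have "f y = g y" if "(m, y) \<in> snd X" for y
    using m(2) that lin_ord_asym[OF assms(1) that] lin_ord_irrefl[OF assms(1)] by auto
  then show ?thesis using m(1) \<open>?D \<subseteq> fst X\<close> by auto
qed

lemma lin_ord_Z_pow:
  assumes "lin_ord X" shows "lin_ord (Z_pow X)"
proof (rule lin_ordI)
  note X = lin_ordD[OF assms]
  show "(f, h) \<in> snd (Z_pow X)" if fg: "(f, g) \<in> snd (Z_pow X)" and gh: "(g, h) \<in> snd (Z_pow X)" for f g h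
  proof -
    from fg assms obtain x where x: "f \<in> fin_supp (fst X)" "x \<in> fst X" "f x < g x"
      "\<And>y. (x, y) \<in> snd X \<Longrightarrow> f y = g y" by (rule Z_pow_lessE) blast
    from gh assms obtain y where y: "h \<in> fin_supp (fst X)" "y \<in> fst X" "g y < h y"
      "\<And>z. (y, z) \<in> snd X \<Longrightarrow> g z = h z" by (rule Z_pow_lessE) blast
    consider "x = y" | "(x, y) \<in> snd X" | "(y, x) \<in> snd X" using X(4)[of x y] x(2) y(2) by auto
    then show ?thesis
    proof cases
      case 1 with x y show ?thesis by (intro Z_pow_lessI[OF assms, of _ _ x]) auto
    next
      case 2 with x y X(3)[OF 2] show ?thesis by (intro Z_pow_lessI[OF assms, of _ _ y]) auto
    next
      case 3 with x y X(3)[OF 3] show ?thesis by (intro Z_pow_lessI[OF assms, of _ _ x]) auto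
    qed
  qed
  show "(f, g) \<in> snd (Z_pow X) \<or> (g, f) \<in> snd (Z_pow X)"
    if fg: "f \<in> fst (Z_pow X)" "g \<in> fst (Z_pow X)" "f \<noteq> g" for f g
  proof -
    obtain x where "x \<in> fst X" "f x \<noteq> g x" "\<forall>y. (x, y) \<in> snd X \<longrightarrow> f y = g y"
      using fin_supp_max_diff[OF assms, of f g] fg by auto
    then show ?thesis using fg by (cases "f x" "g x" rule: linorder_cases) (auto simp: Z_pow_less[OF assms])
  qed
qed (auto simp: Z_pow_less[OF assms])

lemma Z_pow_cong:
  assumes "same_order_type X Y" "lin_ord X" "lin_ord Y"
  shows "same_order_type (Z_pow X) (Z_pow Y)"
proof -
  obtain h where h: "bij_betw h (fst X) (fst Y)"
    "\<And>a b. a \<in> fst X \<Longrightarrow> b \<in> fst X \<Longrightarrow> (a, b) \<in> snd X \<longleftrightarrow> (h a, h b) \<in> snd Y"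
    using assms by (auto simp: same_order_type_def)
  define k where "k = inv_into (fst X) h"
  have k: "k y \<in> fst X" "h (k y) = y" if "y \<in> fst Y" for y
    using that bij_betw_apply[OF bij_betw_inv_into[OF h(1)]] bij_betw_inv_into_right[OF h(1)]
    by (simp_all add: k_def)
  have hk: "h x \<in> fst Y" "k (h x) = x" if "x \<in> fst X" for x
    using that bij_betw_apply[OF h(1)] bij_betw_inv_into_left[OF h(1)] by (simp_all add: k_def)
  define u where "u f y = (if y \<in> fst Y then f (k y) else 0 :: int)" for f y
  define v where "v g x = (if x \<in> fst X then g (h x) else 0 :: int)" for g x
  have u: "u f \<in> fin_supp (fst Y)" if "f \<in> fin_supp (fst X)" for f
  proof (rule fin_suppI)
    have "{y. u f y \<noteq> 0} \<subseteq> h ` {x. f x \<noteq> 0}"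
      using k(2) by (auto simp: u_def image_iff split: if_splits) metis
    then show "finite {y. u f y \<noteq> 0}" by (rule finite_subset) (use that in \<open>auto simp: fin_supp_def\<close>)
  qed (auto simp: u_def split: if_splits)
  have v: "v g \<in> fin_supp (fst X)" if "g \<in> fin_supp (fst Y)" for g
  proof (rule fin_suppI)
    have "{x. v g x \<noteq> 0} \<subseteq> k ` {y. g y \<noteq> 0}"
      using hk(2) by (auto simp: v_def image_iff split: if_splits) metis
    then show "finite {x. v g x \<noteq> 0}" by (rule finite_subset) (use that in \<open>auto simp: fin_supp_def\<close>)
  qed (auto simp: v_def split: if_splits)
  show ?thesis
  proof (rule same_order_typeI[OF lin_ord_Z_pow[OF assms(2)] lin_ord_Z_pow[OF assms(3)]])
    show "bij_betw u (fst (Z_pow X)) (fst (Z_pow Y))"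
    proof (rule bij_betw_byWitness[where f' = v])
      show "\<forall>f\<in>fst (Z_pow X). v (u f) = f"
        using hk by (auto simp: u_def v_def fun_eq_iff fin_supp_outside)
      show "\<forall>f\<in>fst (Z_pow Y). u (v f) = f"
        using k by (auto simp: u_def v_def fun_eq_iff fin_supp_outside)
    qed (use u v in auto)
    show "(u f, u g) \<in> snd (Z_pow Y)" if "(f, g) \<in> snd (Z_pow X)" for f g
    proof -
      from that assms(2) obtain x where x: "f \<in> fin_supp (fst X)" "g \<in> fin_supp (fst X)"
        "x \<in> fst X" "f x < g x" "\<And>y. (x, y) \<in> snd X \<Longrightarrow> f y = g y" by (rule Z_pow_lessE) blast
      show ?thesis
      proof (rule Z_pow_lessI[OF assms(3) u[OF x(1)] u[OF x(2)] hk(1)[OF x(3)]])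
        show "u f y = u g y" if "(h x, y) \<in> snd Y" for y
        proof -
          have "y \<in> fst Y" using that lin_ord_mem[OF assms(3)] by blast
          then show ?thesis using that k h(2)[OF x(3), of "k y"] x(5) by (simp add: u_def)
        qed
      qed (use x hk in \<open>simp add: u_def\<close>)
    qed
  qed
qed

text \<open>Coordinates outside an initial segment outweigh those inside it. Cutting a function in
  two therefore turns comparison at the largest difference into the lexicographic order, with the
  upper part as the more significant factor.\<close>

lemma Z_pow_split:
  assumes X: "lin_ord X" and I: "initial_seg X I"
  shows "same_order_type (Z_pow X) (lin_prod (Z_pow (restr X I)) (Z_pow (restr X (- I))))"
proof -
  define cut where "cut J f x = (if x \<in> J then f x else 0 :: int)" for J f and x :: 'a
  have IX: "fst X \<inter> I = I" using I by (auto simp: initial_seg_def)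
  have cut: "cut J f \<in> fin_supp (fst X \<inter> J)" if "f \<in> fin_supp (fst X)" for J f
  proof (rule fin_suppI)
    have "{x. cut J f x \<noteq> 0} \<subseteq> {x. f x \<noteq> 0}" by (auto simp: cut_def)
    then show "finite {x. cut J f x \<noteq> 0}" by (rule finite_subset) (use that in \<open>auto simp: fin_supp_def\<close>)
  qed (use that in \<open>auto simp: cut_def fin_supp_def split: if_splits\<close>)
  show ?thesis
  proof (rule same_order_typeI[where h = "\<lambda>f. (cut I f, cut (- I) f)"])
    show "bij_betw (\<lambda>f. (cut I f, cut (- I) f)) (fst (Z_pow X))
      (fst (lin_prod (Z_pow (restr X I)) (Z_pow (restr X (- I)))))"
    proof (rule bij_betw_byWitness[where f' = "\<lambda>(f, g) x. f x + g x"])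
      show "\<forall>f\<in>fst (Z_pow X). (\<lambda>(f, g) x. f x + g x) (cut I f, cut (- I) f) = f"
        by (auto simp: cut_def)
      show "\<forall>f\<in>fst (lin_prod (Z_pow (restr X I)) (Z_pow (restr X (- I)))).
        (cut I ((\<lambda>(f, g) x. f x + g x) f), cut (- I) ((\<lambda>(f, g) x. f x + g x) f)) = f"
        by (auto simp: cut_def lin_prod_def fun_eq_iff fin_supp_outside)
    qed (use cut in \<open>auto simp: lin_prod_def intro!: fin_supp_add intro: fin_supp_mono\<close>)
    show "((cut I f, cut (- I) f), (cut I g, cut (- I) g))
        \<in> snd (lin_prod (Z_pow (restr X I)) (Z_pow (restr X (- I))))"
      if "(f, g) \<in> snd (Z_pow X)" for f g
    proof -
      from that X obtain x where x: "f \<in> fin_supp (fst X)" "g \<in> fin_supp (fst X)"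
        "x \<in> fst X" "f x < g x" "\<And>y. (x, y) \<in> snd X \<Longrightarrow> f y = g y" by (rule Z_pow_lessE) blast
      show ?thesis
      proof (cases "x \<in> I")
        case True
        \<comment> \<open>If the largest difference lies in \<open>I\<close>, every coordinate
          outside \<open>I\<close> is above it, so the upper parts coincide and the lower parts
          decide.\<close>
        have "f y = g y" if "y \<notin> I" for y
        proof (cases "y \<in> fst X")
          case True
          then have "(x, y) \<in> snd X"
            using \<open>x \<in> I\<close> \<open>y \<notin> I\<close> I lin_ord_total[OF X x(3) True] by (auto simp: initial_seg_def)
          then show ?thesis by (rule x(5))
        qed (use x fin_supp_outside in metis)
        then have "cut (- I) f = cut (- I) g" by (auto simp: cut_def)
        moreover have "(cut I f, cut I g) \<in> snd (Z_pow (restr X I))"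
          by (rule Z_pow_lessI[OF lin_ord_restr[OF X], where x = x])
            (use x True cut in \<open>auto simp: cut_def\<close>)
        ultimately show ?thesis using cut x by (auto simp: lin_prod_def)
      next
        case False
        have "(cut (- I) f, cut (- I) g) \<in> snd (Z_pow (restr X (- I)))"
          by (rule Z_pow_lessI[OF lin_ord_restr[OF X], where x = x])
            (use x False cut in \<open>auto simp: cut_def\<close>)
        then show ?thesis using cut x by (auto simp: lin_prod_def)
      qed
    qed
  qed (intro lin_ord_prod lin_ord_Z_pow lin_ord_restr X)+
qed

section \<open>Countable dense orders\<close>

definition dense_lin :: "'a lin \<Rightarrow> bool" where
  "dense_lin Y \<longleftrightarrow> lin_ord Y \<and> countable (fst Y) \<and> fst Y \<noteq> {} \<and>
    (\<forall>a\<in>fst Y. \<exists>b. (b, a) \<in> snd Y) \<and> (\<forall>a\<in>fst Y. \<exists>b. (a, b) \<in> snd Y) \<and>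
    (\<forall>a b. (a, b) \<in> snd Y \<longrightarrow> (\<exists>c. (a, c) \<in> snd Y \<and> (c, b) \<in> snd Y))"

lemma dense_lin_between:
  assumes Y: "dense_lin Y" and fin: "finite L" "finite U" "L \<subseteq> fst Y" "U \<subseteq> fst Y"
    and less: "\<And>l u. l \<in> L \<Longrightarrow> u \<in> U \<Longrightarrow> (l, u) \<in> snd Y"
  shows "\<exists>b\<in>fst Y. (\<forall>l\<in>L. (l, b) \<in> snd Y) \<and> (\<forall>u\<in>U. (b, u) \<in> snd Y)"
proof -
  have lin: "lin_ord Y" and ne: "fst Y \<noteq> {}"
    and least: "\<And>a. a \<in> fst Y \<Longrightarrow> \<exists>b. (b, a) \<in> snd Y"
    and greatest: "\<And>a. a \<in> fst Y \<Longrightarrow> \<exists>b. (a, b) \<in> snd Y"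
    and dense: "\<And>a b. (a, b) \<in> snd Y \<Longrightarrow> \<exists>c. (a, c) \<in> snd Y \<and> (c, b) \<in> snd Y"
    using Y by (simp_all add: dense_lin_def)
  have below: "\<forall>l\<in>L. (l, b) \<in> snd Y" if "m \<in> L" "\<forall>l\<in>L. l = m \<or> (l, m) \<in> snd Y" "(m, b) \<in> snd Y" for m b
    using that lin_ord_trans[OF lin, of _ m b] by auto
  have above: "\<forall>u\<in>U. (b, u) \<in> snd Y" if "m \<in> U" "\<forall>u\<in>U. u = m \<or> (m, u) \<in> snd Y" "(b, m) \<in> snd Y" for m b
    using that lin_ord_trans[OF lin, of b m] by auto
  show ?thesis
  proof (cases "L = {}"; cases "U = {}")
    assume "L = {}" "U = {}" then show ?thesis using ne by auto
  next
    assume LU: "L = {}" "U \<noteq> {}"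
    obtain m where m: "m \<in> U" "\<forall>u\<in>U. u = m \<or> (m, u) \<in> snd Y" using ex_min[OF lin fin(2) LU(2) fin(4)] by auto
    moreover obtain b where "(b, m) \<in> snd Y" using least m(1) fin(4) by blast
    ultimately show ?thesis using above LU lin_ord_mem[OF lin] by blast
  next
    assume LU: "L \<noteq> {}" "U = {}"
    obtain m where m: "m \<in> L" "\<forall>l\<in>L. l = m \<or> (l, m) \<in> snd Y" using ex_max[OF lin fin(1) LU(1) fin(3)] by auto
    moreover obtain b where "(m, b) \<in> snd Y" using greatest m(1) fin(3) by blast
    ultimately show ?thesis using below LU lin_ord_mem[OF lin] by blast
  next
    assume LU: "L \<noteq> {}" "U \<noteq> {}"
    obtain m where m: "m \<in> L" "\<forall>l\<in>L. l = m \<or> (l, m) \<in> snd Y" using ex_max[OF lin fin(1) LU(1) fin(3)] by auto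
    obtain n where n: "n \<in> U" "\<forall>u\<in>U. u = n \<or> (n, u) \<in> snd Y" using ex_min[OF lin fin(2) LU(2) fin(4)] by auto
    obtain b where b: "(m, b) \<in> snd Y" "(b, n) \<in> snd Y" using dense[OF less[OF m(1) n(1)]] by auto
    show ?thesis using below[OF m b(1)] above[OF n b(2)] lin_ord_mem[OF lin b(1)] by auto
  qed
qed

section \<open>Back and forth between countable orders\<close>

definition partial_iso :: "'a lin \<Rightarrow> 'b lin \<Rightarrow> ('a \<times> 'b) set \<Rightarrow> bool" where
  "partial_iso X Y P \<longleftrightarrow> finite P \<and> P \<subseteq> fst X \<times> fst Y \<and>
    (\<forall>x y x' y'. (x, y) \<in> P \<and> (x', y') \<in> P \<longrightarrow>
      (x = x' \<longleftrightarrow> y = y') \<and> ((x, x') \<in> snd X \<longleftrightarrow> (y, y') \<in> snd Y))"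

lemma partial_iso_converse: "partial_iso X Y P \<Longrightarrow> partial_iso Y X (P\<inverse>)"
  unfolding partial_iso_def by auto

text \<open>The point \<open>a\<close> divides the finite domain into a lower and an upper part.
  Their images \<open>L\<close> and \<open>U\<close> are separated in \<open>Y\<close>, and any
  point between them can serve as the image of \<open>a\<close>.\<close>

lemma partial_iso_forth:
  assumes P: "partial_iso X Y P" and X: "lin_ord X" and Y: "dense_lin Y" and a: "a \<in> fst X"
  shows "\<exists>b. partial_iso X Y (insert (a, b) P)"
proof (cases "a \<in> Domain P")
  case True
  then obtain b where "(a, b) \<in> P" by auto
  then have "insert (a, b) P = P" by auto
  then show ?thesis using P by metis
next
  case False
  have Yl: "lin_ord Y" using Y by (simp add: dense_lin_def)
  have fin: "finite P" and sub: "P \<subseteq> fst X \<times> fst Y"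
    and iso: "\<And>x y x' y'. (x, y) \<in> P \<Longrightarrow> (x', y') \<in> P \<Longrightarrow>
      (x = x' \<longleftrightarrow> y = y') \<and> ((x, x') \<in> snd X \<longleftrightarrow> (y, y') \<in> snd Y)"
    using P unfolding partial_iso_def by blast+
  define L where "L = snd ` {z \<in> P. (fst z, a) \<in> snd X}"
  define U where "U = snd ` {z \<in> P. (a, fst z) \<in> snd X}"
  have "\<exists>b\<in>fst Y. (\<forall>l\<in>L. (l, b) \<in> snd Y) \<and> (\<forall>u\<in>U. (b, u) \<in> snd Y)"
  proof (rule dense_lin_between[OF Y])
    show "(l, u) \<in> snd Y" if lu: "l \<in> L" "u \<in> U" for l u
    proof -
      obtain x where x: "(x, l) \<in> P" "(x, a) \<in> snd X" using lu by (auto simp: L_def)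
      obtain y where y: "(y, u) \<in> P" "(a, y) \<in> snd X" using lu by (auto simp: U_def)
      show ?thesis using iso[OF x(1) y(1)] lin_ord_trans[OF X x(2) y(2)] by simp
    qed
  qed (use fin sub in \<open>auto simp: L_def U_def\<close>)
  then obtain b where b: "b \<in> fst Y" and L: "\<And>l. l \<in> L \<Longrightarrow> (l, b) \<in> snd Y"
    and U: "\<And>u. u \<in> U \<Longrightarrow> (b, u) \<in> snd Y" by auto
  have new: "x \<noteq> a \<and> y \<noteq> b \<and> ((x, a) \<in> snd X \<longleftrightarrow> (y, b) \<in> snd Y) \<and> ((a, x) \<in> snd X \<longleftrightarrow> (b, y) \<in> snd Y)"
    if xy: "(x, y) \<in> P" for x y
  proof -
    have xa: "x \<noteq> a" using False xy by auto
    have "x \<in> fst X" using sub xy by auto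
    then consider "(x, a) \<in> snd X" | "(a, x) \<in> snd X" using lin_ord_total[OF X _ a xa] by blast
    then show ?thesis
    proof cases
      case 1
      then have "y \<in> L" using xy by (force simp: L_def)
      from L[OF this] 1 show ?thesis
        using xa lin_ord_asym[OF X 1] lin_ord_asym[OF Yl, of y b] lin_ord_irrefl[OF Yl] by metis
    next
      case 2
      then have "y \<in> U" using xy by (force simp: U_def)
      from U[OF this] 2 show ?thesis
        using xa lin_ord_asym[OF X 2] lin_ord_asym[OF Yl, of b y] lin_ord_irrefl[OF Yl] by metis
    qed
  qed
  have "partial_iso X Y (insert (a, b) P)"
    unfolding partial_iso_def
  proof (intro conjI allI impI)
    fix x y x' y' assume "(x, y) \<in> insert (a, b) P \<and> (x', y') \<in> insert (a, b) P"
    then consider "x = a \<and> y = b \<and> x' = a \<and> y' = b" | "x = a \<and> y = b \<and> (x', y') \<in> P"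
      | "(x, y) \<in> P \<and> x' = a \<and> y' = b" | "(x, y) \<in> P \<and> (x', y') \<in> P" by auto
    note cases = this
    show "(x = x') = (y = y')" using cases by (cases; metis new iso)
    show "((x, x') \<in> snd X) = ((y, y') \<in> snd Y)"
      using cases by (cases; metis new iso lin_ord_irrefl[OF X] lin_ord_irrefl[OF Yl])
  qed (use fin sub a b in auto)
  then show ?thesis ..
qed

text \<open>Back and forth along enumerations of both carriers: stage \<open>n\<close> puts
  \<open>a n\<close> into the domain and \<open>b n\<close> into the range, the latter by extending
  the converse relation. The union of the stages is the graph of the isomorphism.\<close>

theorem Cantor_isomorphism:
  assumes X: "dense_lin X" and Y: "dense_lin Y"
  shows "same_order_type X Y"
proof -
  have lin: "lin_ord X" "lin_ord Y" using X Y by (simp_all add: dense_lin_def)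
  define a where "a = from_nat_into (fst X)"
  define b where "b = from_nat_into (fst Y)"
  have a: "range a = fst X" and b: "range b = fst Y"
    using X Y unfolding a_def b_def by (simp_all add: dense_lin_def range_from_nat_into)
  have "\<exists>P. \<forall>n. partial_iso X Y (P n) \<and>
    (P n \<subseteq> P (Suc n) \<and> a n \<in> Domain (P (Suc n)) \<and> b n \<in> Range (P (Suc n)))"
  proof (rule dependent_nat_choice)
    show "\<exists>P. partial_iso X Y P" by (rule exI[of _ "{}"]) (simp add: partial_iso_def)
    fix P n assume P: "partial_iso X Y P"
    obtain d where P': "partial_iso X Y (insert (a n, d) P)"
      using partial_iso_forth[OF P lin(1) Y, of "a n"] a by auto
    obtain c where "partial_iso Y X (insert (b n, c) ((insert (a n, d) P)\<inverse>))"
      using partial_iso_forth[OF partial_iso_converse[OF P'] lin(2) X, of "b n"] b by auto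
    then have "partial_iso X Y ((insert (b n, c) ((insert (a n, d) P)\<inverse>))\<inverse>)"
      by (rule partial_iso_converse)
    then show "\<exists>P'. partial_iso X Y P' \<and> (P \<subseteq> P' \<and> a n \<in> Domain P' \<and> b n \<in> Range P')"
      by (intro exI[of _ "(insert (b n, c) ((insert (a n, d) P)\<inverse>))\<inverse>"] conjI) auto
  qed
  then obtain P where P: "\<And>n. partial_iso X Y (P n)" and mono: "\<And>n. P n \<subseteq> P (Suc n)"
    and dom: "\<And>n. a n \<in> Domain (P (Suc n))" and ran: "\<And>n. b n \<in> Range (P (Suc n))" by auto
  define U where "U = (\<Union>n. P n)"
  have mono': "P m \<subseteq> P n" if "m \<le> n" for m n
    using that mono by (rule lift_Suc_mono_le[rotated])
  have iso: "(x = x' \<longleftrightarrow> y = y') \<and> ((x, x') \<in> snd X \<longleftrightarrow> (y, y') \<in> snd Y)"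
    if U: "(x, y) \<in> U" "(x', y') \<in> U" for x y x' y'
  proof -
    obtain m n where "(x, y) \<in> P m" "(x', y') \<in> P n" using U by (auto simp: U_def)
    then have "(x, y) \<in> P (max m n)" "(x', y') \<in> P (max m n)"
      using mono'[of m "max m n"] mono'[of n "max m n"] by auto
    then show ?thesis using P[of "max m n"] unfolding partial_iso_def by blast
  qed
  have sub: "U \<subseteq> fst X \<times> fst Y" using P unfolding U_def partial_iso_def by blast
  have "\<forall>x\<in>fst X. \<exists>y. (x, y) \<in> U"
    using dom unfolding a[symmetric] U_def by blast
  then obtain h where h: "\<And>x. x \<in> fst X \<Longrightarrow> (x, h x) \<in> U" by metis
  show ?thesis unfolding same_order_type_def
  proof (intro exI[of _ h] conjI ballI)
    show "bij_betw h (fst X) (fst Y)" unfolding bij_betw_def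
    proof
      show "inj_on h (fst X)" using h iso by (meson inj_onI)
      show "h ` fst X = fst Y"
      proof
        show "h ` fst X \<subseteq> fst Y" using h sub by auto
        show "fst Y \<subseteq> h ` fst X"
        proof
          fix y assume "y \<in> fst Y"
          then obtain n where "y = b n" using b by auto
          then obtain x where x: "(x, y) \<in> U" using ran[of n] unfolding U_def by blast
          then have "x \<in> fst X" using sub by auto
          then have "y = h x" using iso[OF x h, of x] by simp
          then show "y \<in> h ` fst X" using \<open>x \<in> fst X\<close> by simp
        qed
      qed
    qed
    show "(x, y) \<in> snd X \<longleftrightarrow> (h x, h y) \<in> snd Y" if "x \<in> fst X" "y \<in> fst X" for x y
      using iso[OF h[OF that(1)] h[OF that(2)]] by simp
  qed
qed

text \<open>Copies of \<open>X\<close> are strung along \<open>Y\<close>. Since \<open>X\<close> has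
  no end points, one can move up or down inside the copy of a given point, so gaps and end points of
  \<open>Y\<close> do no harm.\<close>

lemma dense_lin_prod:
  assumes X: "dense_lin X" and Y: "lin_ord Y" "countable (fst Y)" "fst Y \<noteq> {}"
  shows "dense_lin (lin_prod X Y)"
proof -
  have lin: "lin_ord X" and X': "countable (fst X)" "fst X \<noteq> {}"
    and least: "\<And>a. a \<in> fst X \<Longrightarrow> \<exists>b. (b, a) \<in> snd X"
    and greatest: "\<And>a. a \<in> fst X \<Longrightarrow> \<exists>b. (a, b) \<in> snd X"
    and dense: "\<And>a b. (a, b) \<in> snd X \<Longrightarrow> \<exists>c. (a, c) \<in> snd X \<and> (c, b) \<in> snd X"
    using X by (simp_all add: dense_lin_def)
  have mem: "((x, y), (x', y')) \<in> snd (lin_prod X Y) \<longleftrightarrow> x \<in> fst X \<and> x' \<in> fst X \<and> y \<in> fst Y \<and> y' \<in> fst Y \<and>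
      ((y, y') \<in> snd Y \<or> y = y' \<and> (x, x') \<in> snd X)" for x y x' y'
    by (auto simp: lin_prod_def)
  show ?thesis unfolding dense_lin_def
  proof (intro conjI ballI allI impI)
    show "lin_ord (lin_prod X Y)" by (rule lin_ord_prod[OF lin Y(1)])
    show "countable (fst (lin_prod X Y))" "fst (lin_prod X Y) \<noteq> {}"
      using X' Y by (auto simp: lin_prod_def)
    show "\<exists>q. (q, p) \<in> snd (lin_prod X Y)" "\<exists>q. (p, q) \<in> snd (lin_prod X Y)"
      if "p \<in> fst (lin_prod X Y)" for p
    proof -
      obtain x y where p: "p = (x, y)" "x \<in> fst X" "y \<in> fst Y" using \<open>p \<in> _\<close> by (auto simp: lin_prod_def)
      obtain z w where "(z, x) \<in> snd X" "(x, w) \<in> snd X" using least[OF p(2)] greatest[OF p(2)] by auto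
      then have "((z, y), p) \<in> snd (lin_prod X Y)" "(p, (w, y)) \<in> snd (lin_prod X Y)"
        using p lin_ord_mem[OF lin] by (auto simp: mem)
      then show "\<exists>q. (q, p) \<in> snd (lin_prod X Y)" "\<exists>q. (p, q) \<in> snd (lin_prod X Y)" by blast+
    qed
    show "\<exists>r. (p, r) \<in> snd (lin_prod X Y) \<and> (r, q) \<in> snd (lin_prod X Y)"
      if pq: "(p, q) \<in> snd (lin_prod X Y)" for p q
    proof -
      obtain x y x' y' where p: "p = (x, y)" "q = (x', y')" by (metis surj_pair)
      have p': "x \<in> fst X" "x' \<in> fst X" "y \<in> fst Y" "y' \<in> fst Y"
        "(y, y') \<in> snd Y \<or> y = y' \<and> (x, x') \<in> snd X" using pq by (auto simp: mem p)
      show ?thesis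
      proof (cases "(y, y') \<in> snd Y")
        case True
        obtain w where w: "(x, w) \<in> snd X" using greatest[OF p'(1)] by auto
        then have "w \<in> fst X" using lin_ord_mem[OF lin] by auto
        with w True p' show ?thesis by (intro exI[of _ "(w, y)"]) (simp add: mem p)
      next
        case False
        then obtain w where w: "(x, w) \<in> snd X" "(w, x') \<in> snd X" using dense p'(5) by auto
        then have "w \<in> fst X" using lin_ord_mem[OF lin] by auto
        with w False p' show ?thesis by (intro exI[of _ "(w, y)"]) (simp add: mem p)
      qed
    qed
  qed
qed

lemma dense_rat_lin:
  assumes "A \<noteq> {}" "\<And>a. a \<in> A \<Longrightarrow> \<exists>b\<in>A. b < a" "\<And>a. a \<in> A \<Longrightarrow> \<exists>b\<in>A. a < b"
    "\<And>a b. a \<in> A \<Longrightarrow> b \<in> A \<Longrightarrow> a < b \<Longrightarrow> \<exists>c\<in>A. a < c \<and> c < b"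
  shows "dense_lin (rat_lin A)"
  unfolding dense_lin_def
proof (intro conjI ballI allI impI)
  show "\<exists>b. (b, a) \<in> snd (rat_lin A)" "\<exists>b. (a, b) \<in> snd (rat_lin A)" if "a \<in> fst (rat_lin A)" for a
    using assms(2,3)[of a] that by auto
  show "\<exists>c. (a, c) \<in> snd (rat_lin A) \<and> (c, b) \<in> snd (rat_lin A)" if "(a, b) \<in> snd (rat_lin A)" for a b
    using assms(4)[of a b] that by auto
qed (simp_all add: lin_ord_rat_lin assms(1))

lemma dense_rat_lin_ray: "dense_lin (rat_lin UNIV)" "dense_lin (rat_lin {c<..})" "dense_lin (rat_lin {..<c})"
proof -
  show "dense_lin (rat_lin UNIV)"
    by (rule dense_rat_lin) (auto intro: lt_ex gt_ex dense)
  show "dense_lin (rat_lin {c<..})"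
  proof (rule dense_rat_lin)
    show "\<exists>b\<in>{c<..}. b < a" if "a \<in> {c<..}" for a
      using that dense[of c a] by auto
    show "\<exists>b\<in>{c<..}. a < b" if "a \<in> {c<..}" for a
      using that gt_ex[of a] by (meson greaterThan_iff less_trans)
    show "\<exists>d\<in>{c<..}. a < d \<and> d < b" if "a \<in> {c<..}" "a < b" for a b
      using that dense[of a b] by (meson greaterThan_iff less_trans)
    show "{c<..} \<noteq> {}" using gt_ex[of c] by auto
  qed
  show "dense_lin (rat_lin {..<c})"
  proof (rule dense_rat_lin)
    show "\<exists>b\<in>{..<c}. a < b" if "a \<in> {..<c}" for a
      using that dense[of a c] by auto
    show "\<exists>b\<in>{..<c}. b < a" if "a \<in> {..<c}" for a
      using that lt_ex[of a] by (meson lessThan_iff less_trans)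
    show "\<exists>d\<in>{..<c}. a < d \<and> d < b" if "b \<in> {..<c}" "a < b" for a b
      using that dense[of a b] by (meson lessThan_iff less_trans)
    show "{..<c} \<noteq> {}" using lt_ex[of c] by auto
  qed
qed

text \<open>The product of \<open>\<rat>\<close> with \<open>X\<close> is countable and dense, hence
  isomorphic to \<open>D\<close>; inside it, the points with first coordinate \<open>0\<close> form
  a copy of \<open>X\<close>.\<close>

lemma countable_embeds_in_dense:
  assumes X: "lin_ord X" "countable (fst X)" and D: "dense_lin (rat_lin D)"
  shows "\<exists>A\<subseteq>D. same_order_type X (rat_lin A)"
proof (cases "fst X = {}")
  case True
  then have "same_order_type X (rat_lin {})"
    by (auto simp: same_order_type_def bij_betw_def)
  then show ?thesis by blast
next
  case False
  have "same_order_type (lin_prod (rat_lin UNIV) X) (rat_lin D)"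
    by (intro Cantor_isomorphism dense_lin_prod dense_rat_lin_ray X False D)
  then obtain h where "bij_betw h (fst (lin_prod (rat_lin UNIV) X)) (fst (rat_lin D))"
    and h2: "\<And>a b. a \<in> fst (lin_prod (rat_lin UNIV) X) \<Longrightarrow> b \<in> fst (lin_prod (rat_lin UNIV) X) \<Longrightarrow>
      (a, b) \<in> snd (lin_prod (rat_lin UNIV) X) \<longleftrightarrow> (h a, h b) \<in> snd (rat_lin D)"
    unfolding same_order_type_def by metis
  then have h: "bij_betw h (UNIV \<times> fst X) D" by (simp add: lin_prod_def)
  define k where "k x = h (0, x)" for x
  have kD: "k x \<in> D" if "x \<in> fst X" for x
    using bij_betw_apply[OF h, of "(0, x)"] that by (simp add: k_def)
  have "inj_on k (fst X)"
    using bij_betw_imp_inj_on[OF h] by (intro inj_onI) (simp add: k_def inj_on_eq_iff)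
  moreover have "(x, y) \<in> snd X \<longleftrightarrow> k x < k y" if "x \<in> fst X" "y \<in> fst X" for x y
    using h2[of "(0, x)" "(0, y)"] kD that by (auto simp: k_def lin_prod_def)
  ultimately have "same_order_type X (rat_lin (k ` fst X))"
  proof -
    assume k: "inj_on k (fst X)"
      and less: "\<And>x y. x \<in> fst X \<Longrightarrow> y \<in> fst X \<Longrightarrow> (x, y) \<in> snd X \<longleftrightarrow> k x < k y"
    have "bij_betw k (fst X) (fst (rat_lin (k ` fst X)))" using k by (simp add: bij_betw_def)
    moreover have "\<forall>x\<in>fst X. \<forall>y\<in>fst X. (x, y) \<in> snd X \<longleftrightarrow> (k x, k y) \<in> snd (rat_lin (k ` fst X))"
      using less by simp
    ultimately show ?thesis unfolding same_order_type_def by blast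
  qed
  moreover have "k ` fst X \<subseteq> D" using kD by auto
  ultimately show ?thesis by blast
qed

lemma countable_fin_supp: "countable A \<Longrightarrow> countable (fin_supp A)"
proof -
  assume A: "countable A"
  have "fin_supp A \<subseteq> (\<lambda>l x. case map_of l x of None \<Rightarrow> 0 | Some v \<Rightarrow> v) ` lists (A \<times> UNIV)"
  proof
    fix f :: "'a \<Rightarrow> int" assume f: "f \<in> fin_supp A"
    then have "finite {x. f x \<noteq> 0}" by (simp add: fin_supp_def)
    then obtain xs where xs: "set xs = {x. f x \<noteq> 0}" using finite_list by metis
    have "map_of (map (\<lambda>x. (x, f x)) xs) x = (if x \<in> set xs then Some (f x) else None)" for x
      by (induction xs) auto
    then have "f x = (case map_of (map (\<lambda>x. (x, f x)) xs) x of None \<Rightarrow> 0 | Some v \<Rightarrow> v)" for x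
      using xs by simp
    then have "f = (\<lambda>l x. case map_of l x of None \<Rightarrow> 0 | Some v \<Rightarrow> v) (map (\<lambda>x. (x, f x)) xs)"
      by (rule ext)
    moreover have "map (\<lambda>x. (x, f x)) xs \<in> lists (A \<times> UNIV)" using f xs by (auto simp: fin_supp_def)
    ultimately show "f \<in> (\<lambda>l x. case map_of l x of None \<Rightarrow> 0 | Some v \<Rightarrow> v) ` lists (A \<times> UNIV)"
      by (rule image_eqI)
  qed
  then show ?thesis
    by (rule countable_subset) (intro countable_image countable_lists countable_SIGMA A countableI_type)
qed

text \<open>Given \<open>f < g\<close> with largest difference at \<open>x\<close>, there is a
  coordinate \<open>z\<close> below \<open>x\<close>. Raising \<open>f\<close> by one at
  \<open>z\<close> exceeds \<open>f\<close> and still loses to \<open>g\<close> at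
  \<open>x\<close>.\<close>

lemma dense_Z_pow:
  assumes X: "lin_ord X" "countable (fst X)" "fst X \<noteq> {}"
    and least: "\<And>a. a \<in> fst X \<Longrightarrow> \<exists>b. (b, a) \<in> snd X"
  shows "dense_lin (Z_pow X)"
  unfolding dense_lin_def
proof (intro conjI ballI allI impI)
  show "lin_ord (Z_pow X)" "countable (fst (Z_pow X))" "fst (Z_pow X) \<noteq> {}"
    using lin_ord_Z_pow[OF X(1)] countable_fin_supp[OF X(2)] fin_supp_zero[of "fst X"] by auto
  obtain x where x: "x \<in> fst X" using X by auto
  show "\<exists>g. (g, f) \<in> snd (Z_pow X)" "\<exists>g. (f, g) \<in> snd (Z_pow X)" if f: "f \<in> fst (Z_pow X)" for f
  proof -
    have ne: "y \<noteq> x" if "(x, y) \<in> snd X" for y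
      using that lin_ord_irrefl[OF X(1)] by auto
    have "(f(x := f x - 1), f) \<in> snd (Z_pow X)"
      by (rule Z_pow_lessI[OF X(1) fin_supp_upd _ x]) (use f x ne in auto)
    moreover have "(f, f(x := f x + 1)) \<in> snd (Z_pow X)"
      by (rule Z_pow_lessI[OF X(1) _ fin_supp_upd x]) (use f x ne in auto)
    ultimately show "\<exists>g. (g, f) \<in> snd (Z_pow X)" "\<exists>g. (f, g) \<in> snd (Z_pow X)" by blast+
  qed
  show "\<exists>u. (f, u) \<in> snd (Z_pow X) \<and> (u, g) \<in> snd (Z_pow X)" if "(f, g) \<in> snd (Z_pow X)" for f g
  proof -
    from that X(1) obtain x where x: "f \<in> fin_supp (fst X)" "g \<in> fin_supp (fst X)"
      "x \<in> fst X" "f x < g x" "\<And>y. (x, y) \<in> snd X \<Longrightarrow> f y = g y" by (rule Z_pow_lessE) blast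
    obtain z where z: "(z, x) \<in> snd X" using least[OF x(3)] by auto
    have z': "z \<in> fst X" "z \<noteq> x" "(x, z) \<notin> snd X"
      using lin_ord_mem[OF X(1) z] lin_ord_irrefl[OF X(1)] lin_ord_asym[OF X(1) z] z by auto
    let ?u = "f(z := f z + 1)"
    have u: "?u \<in> fin_supp (fst X)" by (rule fin_supp_upd[OF x(1) z'(1)])
    have "(f, ?u) \<in> snd (Z_pow X)"
      using lin_ord_irrefl[OF X(1)] by (intro Z_pow_lessI[OF X(1) x(1) u z'(1)]) auto
    moreover have "(?u, g) \<in> snd (Z_pow X)"
      using z' x(4,5) by (intro Z_pow_lessI[OF X(1) u x(2,3)]) auto
    ultimately show ?thesis by blast
  qed
qed


section \<open>Rigidity of the exponent\<close>

text \<open>A largest difference above \<open>x\<close> between \<open>u\<close> and one end point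
  would have to occur with the opposite sign against the other, as both end points agree there. At
  \<open>x\<close> itself only the finitely many values from \<open>f x\<close> to
  \<open>g x\<close> remain, which is the finiteness behind the condensation.\<close>

lemma Z_pow_sandwich:
  assumes X: "lin_ord X" and fu: "f = u \<or> (f, u) \<in> snd (Z_pow X)" and ug: "u = g \<or> (u, g) \<in> snd (Z_pow X)"
    and fg: "\<And>y. (x, y) \<in> snd X \<Longrightarrow> f y = g y" and x: "x \<in> fst X"
  shows "(\<forall>y. (x, y) \<in> snd X \<longrightarrow> u y = f y) \<and> f x \<le> u x \<and> u x \<le> g x"
proof (cases "f = u \<or> u = g")
  case True
  show ?thesis
  proof (cases "f = u")
    case True
    show ?thesis
    proof (cases "u = g")
      case False
      with ug have "(u, g) \<in> snd (Z_pow X)" by simp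
      then obtain z where z: "z \<in> fst X" "u z < g z" "\<And>y. (z, y) \<in> snd X \<Longrightarrow> u y = g y"
        using X by (rule Z_pow_lessE) blast
      have "x = z \<or> (z, x) \<in> snd X" using fg[of z] z True lin_ord_total[OF X x z(1)] by auto
      then show ?thesis using z True by auto
    qed (use True in auto)
  next
    case False
    with True fu have u: "u = g" and "(f, u) \<in> snd (Z_pow X)" by auto
    then obtain z where z: "z \<in> fst X" "f z < u z" "\<And>y. (z, y) \<in> snd X \<Longrightarrow> f y = u y"
      using X by (auto elim: Z_pow_lessE)
    have "x = z \<or> (z, x) \<in> snd X" using fg[of z] z u lin_ord_total[OF X x z(1)] by auto
    then show ?thesis using z u fg by auto
  qed
next
  case False
  then have "(f, u) \<in> snd (Z_pow X)" "(u, g) \<in> snd (Z_pow X)" using fu ug by auto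
  then obtain z w where z: "z \<in> fst X" "f z < u z" "\<And>y. (z, y) \<in> snd X \<Longrightarrow> f y = u y"
    and w: "w \<in> fst X" "u w < g w" "\<And>y. (w, y) \<in> snd X \<Longrightarrow> u y = g y"
    using X by (auto elim!: Z_pow_lessE)
  have zx: "(x, z) \<notin> snd X"
  proof
    assume xz: "(x, z) \<in> snd X"
    then have "(z, w) \<in> snd X"
      using fg[OF xz] z(2) w(2) w(3)[of z] lin_ord_total[OF X z(1) w(1)] by force
    moreover from this have "(x, w) \<in> snd X" using lin_ord_trans[OF X xz] by simp
    ultimately show False using fg[of w] z(3)[of w] w(2) by simp
  qed
  have wx: "(x, w) \<notin> snd X"
  proof
    assume xw: "(x, w) \<in> snd X"
    then have "(w, z) \<in> snd X"
      using fg[OF xw] z(2) w(2) z(3)[of w] lin_ord_total[OF X z(1) w(1)] by force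
    then show False using lin_ord_trans[OF X xw, of z] zx by simp
  qed
  have z': "z = x \<or> (z, x) \<in> snd X" and w': "w = x \<or> (w, x) \<in> snd X"
    using zx wx lin_ord_total[OF X x z(1)] lin_ord_total[OF X x w(1)] by auto
  have "u y = f y" if "(x, y) \<in> snd X" for y
    using z' z(3)[of y] lin_ord_trans[OF X _ that, of z] that by auto
  moreover have "f x \<le> u x" using z' z(2) z(3)[of x] by auto
  moreover have "u x \<le> g x" using w' w(2) w(3)[of x] by auto
  ultimately show ?thesis by auto
qed

text \<open>For an initial segment \<open>I\<close>, forgetting the coordinates in \<open>I\<close>:
  the quotient of \<open>\<int>\<^sup>X M\<close> by this relation is the power over
  \<open>X - I\<close> times \<open>M\<close>.\<close>

definition eqv :: "'a lin \<Rightarrow> 'a set \<Rightarrow> ('a \<Rightarrow> int) \<times> 'b \<Rightarrow> ('a \<Rightarrow> int) \<times> 'b \<Rightarrow> bool" where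
  "eqv X I p q \<longleftrightarrow> snd p = snd q \<and> (\<forall>y\<in>fst X - I. fst p y = fst q y)"

definition below :: "'a lin \<Rightarrow> 'a \<Rightarrow> 'a set" where
  "below X x = {y. (y, x) \<in> snd X}"

text \<open>The closed interval with end points \<open>p\<close> and \<open>q\<close>, in whichever
  order they come, so that \<open>covered\<close> is symmetric.\<close>

definition btw :: "'c lin \<Rightarrow> 'c \<Rightarrow> 'c \<Rightarrow> 'c \<Rightarrow> bool" where
  "btw L p q r \<longleftrightarrow> r = p \<or> r = q \<or> (p, r) \<in> snd L \<and> (r, q) \<in> snd L \<or> (q, r) \<in> snd L \<and> (r, p) \<in> snd L"

text \<open>The interval between \<open>p\<close> and \<open>q\<close> meets only finitely many
  classes of \<open>E\<close>; with equality as \<open>E\<close> this is the usual finite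
  condensation.\<close>

definition covered :: "'c lin \<Rightarrow> ('c \<Rightarrow> 'c \<Rightarrow> bool) \<Rightarrow> 'c \<Rightarrow> 'c \<Rightarrow> bool" where
  "covered L E p q \<longleftrightarrow> (\<exists>F. finite F \<and> F \<subseteq> fst L \<and> (\<forall>r\<in>fst L. btw L p q r \<longrightarrow> (\<exists>s\<in>F. E r s)))"

lemma btw_sym: "btw L p q r \<longleftrightarrow> btw L q p r"
  by (auto simp: btw_def)

lemma covered_sym: "covered L E p q \<longleftrightarrow> covered L E q p"
  by (simp add: covered_def btw_sym[of L p q])

lemma eqv_sym: "eqv X I p q \<longleftrightarrow> eqv X I q p"
  by (auto simp: eqv_def)

lemma snd_lin_prod:
  "((f, m), (g, n)) \<in> snd (lin_prod X Y) \<longleftrightarrow> f \<in> fst X \<and> g \<in> fst X \<and> m \<in> fst Y \<and> n \<in> fst Y \<and>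
    ((m, n) \<in> snd Y \<or> m = n \<and> (f, g) \<in> snd X)"
  by (auto simp: lin_prod_def)

lemma fst_lin_prod [simp]: "fst (lin_prod X Y) = fst X \<times> fst Y"
  by (simp add: lin_prod_def)

text \<open>The relation \<^term>\<open>eqv X I\<close> is thus obtained by iterating the finite condensation
  along \<open>I\<close>, which makes it invariant under order isomorphisms.\<close>

lemma eqv_imp_covered:
  assumes X: "lin_ord X" and M: "lin_ord M" and I: "initial_seg X I"
    and p: "p \<in> fst (lin_prod (Z_pow X) M)" and q: "q \<in> fst (lin_prod (Z_pow X) M)"
    and less: "(p, q) \<in> snd (lin_prod (Z_pow X) M)" and eqv: "eqv X I p q"
  shows "\<exists>x\<in>I. covered (lin_prod (Z_pow X) M) (eqv X (below X x)) p q"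
proof -
  let ?L = "lin_prod (Z_pow X) M"
  obtain f m g where pq: "p = (f, m)" "q = (g, m)" using eqv by (cases p; cases q) (auto simp: eqv_def)
  have "(f, g) \<in> snd (Z_pow X)" using less lin_ord_irrefl[OF M] by (simp add: pq snd_lin_prod)
  then obtain x where x: "f \<in> fin_supp (fst X)" "g \<in> fin_supp (fst X)"
    "x \<in> fst X" "f x < g x" "\<And>y. (x, y) \<in> snd X \<Longrightarrow> f y = g y" using X by (rule Z_pow_lessE) blast
  have xI: "x \<in> I" using eqv x(3,4) by (force simp: eqv_def pq)
  have m: "m \<in> fst M" using p by (simp add: pq)
  \<comment> \<open>Modulo the coordinates below \<open>x\<close>, an element of the interval is
    determined by its value at \<open>x\<close>, so these functions represent all classes.\<close>
  define F where "F = (\<lambda>i. (f(x := i), m)) ` {f x..g x}"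
  have "\<exists>s\<in>F. eqv X (below X x) r s" if r: "r \<in> fst ?L" "btw ?L p q r" for r
  proof -
    obtain u k where rk: "r = (u, k)" by (cases r)
    \<comment> \<open>As \<open>p\<close> is below \<open>q\<close>, the reversed alternative of
      \<open>btw\<close> is impossible, and asymmetry in \<open>M\<close> fixes the second
      component.\<close>
    have "k = m \<and> (f = u \<or> (f, u) \<in> snd (Z_pow X)) \<and> (u = g \<or> (u, g) \<in> snd (Z_pow X))"
      using r(2) lin_ord_irrefl[OF M] lin_ord_asym[OF M, of m k] lin_ord_asym[OF lin_ord_prod[OF lin_ord_Z_pow[OF X] M] less]
        lin_ord_trans[OF lin_ord_prod[OF lin_ord_Z_pow[OF X] M], of q r p]
        \<open>(f, g) \<in> snd (Z_pow X)\<close>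
      unfolding btw_def pq rk by (auto simp: snd_lin_prod)
    then have k: "k = m" and u: "(\<forall>y. (x, y) \<in> snd X \<longrightarrow> u y = f y) \<and> f x \<le> u x \<and> u x \<le> g x"
      using Z_pow_sandwich[OF X, of f u g x] x(3,5) by auto
    have "(f(x := u x), m) \<in> F" using u by (auto simp: F_def)
    moreover have "eqv X (below X x) r (f(x := u x), m)"
      using u k lin_ord_total[OF X _ x(3)] by (auto simp: eqv_def rk below_def)
    ultimately show ?thesis by blast
  qed
  moreover have "finite F" "F \<subseteq> fst ?L" using x m by (auto simp: F_def intro: fin_supp_upd)
  ultimately have "covered ?L (eqv X (below X x)) p q" unfolding covered_def by blast
  then show ?thesis using xI by blast
qed

text \<open>If \<open>p\<close> and \<open>q\<close> differ outside \<open>I\<close>, then raising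
  \<open>f\<close> at \<open>x\<close> in \<open>I\<close> by any natural number stays between them.
  These infinitely many elements are pairwise inequivalent, as \<open>x\<close> is not among the
  coordinates below \<open>x\<close>.\<close>

lemma covered_imp_eqv:
  assumes X: "lin_ord X" and M: "lin_ord M" and I: "initial_seg X I"
    and p: "p \<in> fst (lin_prod (Z_pow X) M)" and q: "q \<in> fst (lin_prod (Z_pow X) M)"
    and less: "(p, q) \<in> snd (lin_prod (Z_pow X) M)" and xI: "x \<in> I"
    and cov: "covered (lin_prod (Z_pow X) M) (eqv X (below X x)) p q"
  shows "eqv X I p q"
proof (rule ccontr)
  assume neqv: "\<not> eqv X I p q"
  let ?L = "lin_prod (Z_pow X) M"
  obtain f m g n where pq: "p = (f, m)" "q = (g, n)" by (cases p; cases q)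
  have mem: "f \<in> fin_supp (fst X)" "g \<in> fin_supp (fst X)" "m \<in> fst M" "n \<in> fst M"
    using p q by (auto simp: pq)
  have x: "x \<in> fst X" using xI I by (auto simp: initial_seg_def)
  define r where "r i = (f(x := f x + int i), m)" for i
  have rL: "r i \<in> fst ?L" for i using mem x by (auto simp: r_def intro: fin_supp_upd)
  have ne: "y \<noteq> x" if "(x, y) \<in> snd X" for y using that lin_ord_irrefl[OF X] by auto
  have "(r i, q) \<in> snd ?L" for i
  proof (cases "(m, n) \<in> snd M")
    case True then show ?thesis using rL[of i] mem by (auto simp: r_def pq snd_lin_prod)
  next
    case False
    then have mn: "m = n" and "(f, g) \<in> snd (Z_pow X)" using less by (auto simp: pq snd_lin_prod)
    then obtain z where z: "z \<in> fst X" "f z < g z" "\<And>y. (z, y) \<in> snd X \<Longrightarrow> f y = g y"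
      using X by (auto elim: Z_pow_lessE)
    obtain y where y: "y \<in> fst X" "y \<notin> I" "f y \<noteq> g y" using neqv mn by (auto simp: eqv_def pq)
    have "z \<notin> I"
    proof
      assume "z \<in> I"
      then have "(y, z) \<notin> snd X" "y \<noteq> z" using I y(2) by (auto simp: initial_seg_def)
      then show False using z(3)[of y] y(3) lin_ord_total[OF X y(1) z(1)] by auto
    qed
    then have xz: "(x, z) \<in> snd X"
      using lin_ord_total[OF X x z(1)] I xI by (auto simp: initial_seg_def)
    have "(f(x := f x + int i), g) \<in> snd (Z_pow X)"
    proof (rule Z_pow_lessI[OF X fin_supp_upd[OF mem(1) x] mem(2) z(1)])
      show "(f(x := f x + int i)) y = g y" if "(z, y) \<in> snd X" for y
        using z(3)[OF that] ne[OF lin_ord_trans[OF X xz that]] by simp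
    qed (use z(2) ne[OF xz] in simp)
    then show ?thesis using rL[of i] mem mn by (auto simp: r_def pq snd_lin_prod)
  qed
  moreover have "r i = p \<or> (p, r i) \<in> snd ?L" for i
  proof (cases "i = 0")
    case True then show ?thesis by (simp add: r_def pq)
  next
    case False
    have "(f, f(x := f x + int i)) \<in> snd (Z_pow X)"
      by (rule Z_pow_lessI[OF X mem(1) fin_supp_upd[OF mem(1) x] x]) (use False ne in auto)
    then show ?thesis using rL[of i] mem by (auto simp: r_def pq snd_lin_prod)
  qed
  ultimately have btw: "btw ?L p q (r i)" for i by (auto simp: btw_def)
  obtain F where F: "finite F" "\<And>r. r \<in> fst ?L \<Longrightarrow> btw ?L p q r \<Longrightarrow> \<exists>s\<in>F. eqv X (below X x) r s"
    using cov unfolding covered_def by blast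
  obtain s where s: "\<And>i. s i \<in> F" "\<And>i. eqv X (below X x) (r i) (s i)" using F(2)[OF rL btw] by metis
  have "inj s"
  proof (rule injI)
    fix i j assume "s i = s j"
    then have "fst (r i) x = fst (r j) x"
      using s(2)[of i] s(2)[of j] x lin_ord_irrefl[OF X] by (auto simp: eqv_def below_def)
    then show "i = j" by (simp add: r_def)
  qed
  moreover have "finite (range s)" using F(1) s(1) by (meson finite_subset image_subsetI)
  ultimately show False using finite_imageD by blast
qed

text \<open>The right-hand side refers only to the order of the product and to the relations of
  smaller segments. This makes a recursion that every isomorphism has to respect; for empty
  \<open>I\<close> it leaves equality.\<close>

lemma eqv_iff_covered:
  assumes X: "lin_ord X" and M: "lin_ord M" and I: "initial_seg X I"
    and p: "p \<in> fst (lin_prod (Z_pow X) M)" and q: "q \<in> fst (lin_prod (Z_pow X) M)"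
  shows "eqv X I p q \<longleftrightarrow> p = q \<or> (\<exists>x\<in>I. covered (lin_prod (Z_pow X) M) (eqv X (below X x)) p q)"
proof -
  note L = lin_ord_prod[OF lin_ord_Z_pow[OF X] M]
  consider "p = q" | "(p, q) \<in> snd (lin_prod (Z_pow X) M)" | "(q, p) \<in> snd (lin_prod (Z_pow X) M)"
    using lin_ord_total[OF L p q] by blast
  then show ?thesis
  proof cases
    case 1 then show ?thesis by (simp add: eqv_def)
  next
    case 2
    then have "p \<noteq> q" using lin_ord_irrefl[OF L, of p] by metis
    then show ?thesis
      using eqv_imp_covered[OF X M I p q 2] covered_imp_eqv[OF X M I p q 2] by blast
  next
    case 3
    then have "p \<noteq> q" using lin_ord_irrefl[OF L, of p] by metis
    then show ?thesis
      using eqv_imp_covered[OF X M I q p 3] covered_imp_eqv[OF X M I q p 3]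
      unfolding eqv_sym[of X I p q] covered_sym[of _ _ p q] by blast
  qed
qed

lemma covered_transport:
  assumes h: "bij_betw h (fst L) (fst L')"
    "\<And>a b. a \<in> fst L \<Longrightarrow> b \<in> fst L \<Longrightarrow> (a, b) \<in> snd L \<longleftrightarrow> (h a, h b) \<in> snd L'"
    and E: "\<And>r s. r \<in> fst L \<Longrightarrow> s \<in> fst L \<Longrightarrow> E r s \<longleftrightarrow> E' (h r) (h s)"
    and p: "p \<in> fst L" and q: "q \<in> fst L"
  shows "covered L E p q \<longleftrightarrow> covered L' E' (h p) (h q)"
proof -
  have inj: "h a = h b \<longleftrightarrow> a = b" if "a \<in> fst L" "b \<in> fst L" for a b
    using that h(1) by (metis bij_betw_imp_inj_on inj_on_eq_iff)
  have img: "h ` fst L = fst L'" using h(1) by (rule bij_betw_imp_surj_on)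
  have btw: "btw L p q r \<longleftrightarrow> btw L' (h p) (h q) (h r)" if "r \<in> fst L" for r
    unfolding btw_def using inj h(2) p q that by simp
  show ?thesis
  proof
    assume "covered L E p q"
    then obtain F where F: "finite F" "F \<subseteq> fst L" "\<And>r. r \<in> fst L \<Longrightarrow> btw L p q r \<Longrightarrow> \<exists>s\<in>F. E r s"
      unfolding covered_def by blast
    show "covered L' E' (h p) (h q)" unfolding covered_def
    proof (intro exI[of _ "h ` F"] conjI ballI impI)
      show "\<exists>s\<in>h ` F. E' r s" if r: "r \<in> fst L'" "btw L' (h p) (h q) r" for r
      proof -
        obtain t where t: "t \<in> fst L" "r = h t" using r(1) img by auto
        then obtain s where "s \<in> F" "E t s" using F(3)[OF t(1)] r(2) btw by auto
        then show ?thesis using E[OF t(1)] t(2) F(2) by blast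
      qed
    qed (use F img in auto)
  next
    assume "covered L' E' (h p) (h q)"
    then obtain F where F: "finite F" "F \<subseteq> h ` fst L"
      "\<And>r. r \<in> fst L' \<Longrightarrow> btw L' (h p) (h q) r \<Longrightarrow> \<exists>s\<in>F. E' r s"
      unfolding covered_def img by blast
    obtain F' where F': "finite F'" "F' \<subseteq> fst L" "F = h ` F'"
      using finite_subset_image[OF F(1,2)] by blast
    show "covered L E p q" unfolding covered_def
    proof (intro exI[of _ F'] conjI ballI impI)
      show "\<exists>s\<in>F'. E r s" if r: "r \<in> fst L" "btw L p q r" for r
      proof -
        have "h r \<in> fst L'" using r(1) img by auto
        then obtain s where "s \<in> F" "E' (h r) s" using F(3)[of "h r"] btw[OF r(1)] r(2) by blast
        then show ?thesis using E[OF r(1)] F'(2,3) by blast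
      qed
    qed (use F' in auto)
  qed
qed

lemma eqv_step:
  assumes X: "lin_ord X" and X': "lin_ord X'" and M: "lin_ord M" and M': "lin_ord M'"
    and h: "bij_betw h (fst (lin_prod (Z_pow X) M)) (fst (lin_prod (Z_pow X') M'))"
    "\<And>a b. a \<in> fst (lin_prod (Z_pow X) M) \<Longrightarrow> b \<in> fst (lin_prod (Z_pow X) M) \<Longrightarrow>
      (a, b) \<in> snd (lin_prod (Z_pow X) M) \<longleftrightarrow> (h a, h b) \<in> snd (lin_prod (Z_pow X') M')"
    and I: "initial_seg X I" and kI: "initial_seg X' (k ` I)"
    and IH: "\<And>x p q. x \<in> I \<Longrightarrow> p \<in> fst (lin_prod (Z_pow X) M) \<Longrightarrow> q \<in> fst (lin_prod (Z_pow X) M) \<Longrightarrow>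
      eqv X (below X x) p q \<longleftrightarrow> eqv X' (below X' (k x)) (h p) (h q)"
    and p: "p \<in> fst (lin_prod (Z_pow X) M)" and q: "q \<in> fst (lin_prod (Z_pow X) M)"
  shows "eqv X I p q \<longleftrightarrow> eqv X' (k ` I) (h p) (h q)"
proof -
  let ?L = "lin_prod (Z_pow X) M" and ?L' = "lin_prod (Z_pow X') M'"
  have hp: "h p \<in> fst ?L'" "h q \<in> fst ?L'" using bij_betw_apply[OF h(1)] p q by blast+
  have "h p = h q \<longleftrightarrow> p = q" using bij_betw_imp_inj_on[OF h(1)] p q by (rule inj_on_eq_iff)
  moreover have "covered ?L (eqv X (below X x)) p q \<longleftrightarrow> covered ?L' (eqv X' (below X' (k x))) (h p) (h q)"
    if "x \<in> I" for x
    by (rule covered_transport[OF h(1) _ _ p q]) (use h(2) IH[OF that] in blast)+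
  ultimately show ?thesis
    using eqv_iff_covered[OF X M I p q] eqv_iff_covered[OF X' M' kI hp] by auto
qed

text \<open>Induction along the well-order \<open>X\<close> treats the segments below its elements,
  and one last step treats \<open>X\<close> itself. The map \<open>k\<close> carries the segment
  below \<open>x\<close> onto the one below \<open>k x\<close> because \<open>I'\<close> is an
  initial segment.\<close>

lemma eqv_transport:
  assumes X: "lin_ord X" "wf (snd X)" and X': "lin_ord X'" and M: "lin_ord M" and M': "lin_ord M'"
    and h: "bij_betw h (fst (lin_prod (Z_pow X) M)) (fst (lin_prod (Z_pow X') M'))"
    "\<And>a b. a \<in> fst (lin_prod (Z_pow X) M) \<Longrightarrow> b \<in> fst (lin_prod (Z_pow X) M) \<Longrightarrow>
      (a, b) \<in> snd (lin_prod (Z_pow X) M) \<longleftrightarrow> (h a, h b) \<in> snd (lin_prod (Z_pow X') M')"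
    and I': "initial_seg X' I'" and k: "bij_betw k (fst X) I'"
    "\<And>a b. a \<in> fst X \<Longrightarrow> b \<in> fst X \<Longrightarrow> (a, b) \<in> snd X \<longleftrightarrow> (k a, k b) \<in> snd X'"
    and p: "p \<in> fst (lin_prod (Z_pow X) M)" and q: "q \<in> fst (lin_prod (Z_pow X) M)"
  shows "eqv X (fst X) p q \<longleftrightarrow> eqv X' I' (h p) (h q)"
proof -
  let ?L = "lin_prod (Z_pow X) M" and ?L' = "lin_prod (Z_pow X') M'"
  have img: "k ` fst X = I'" using k(1) by (rule bij_betw_imp_surj_on)
  have init: "initial_seg X (below X x)" for x
    using lin_ord_mem[OF X(1)] lin_ord_trans[OF X(1)] unfolding initial_seg_def below_def by blast
  have init': "initial_seg X' (below X' x)" for x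
    using lin_ord_mem[OF X'] lin_ord_trans[OF X'] unfolding initial_seg_def below_def by blast
  have kbelow: "k ` below X x = below X' (k x)" if x: "x \<in> fst X" for x
  proof
    show "k ` below X x \<subseteq> below X' (k x)"
      using k(2)[OF _ x] lin_ord_mem[OF X(1)] unfolding below_def by blast
    show "below X' (k x) \<subseteq> k ` below X x"
    proof
      fix y assume y: "y \<in> below X' (k x)"
      then have "y \<in> I'" using I' img x unfolding initial_seg_def below_def by blast
      then obtain z where z: "z \<in> fst X" "y = k z" using img by auto
      then have "(z, x) \<in> snd X" using k(2)[OF z(1) x] y by (simp add: below_def)
      then show "y \<in> k ` below X x" using z(2) by (simp add: below_def)
    qed
  qed
  have main: "x \<in> fst X \<longrightarrow> (\<forall>p\<in>fst ?L. \<forall>q\<in>fst ?L. eqv X (below X x) p q \<longleftrightarrow> eqv X' (below X' (k x)) (h p) (h q))"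
    for x using X(2)
  proof (induction x rule: wf_induct_rule)
    case (less x)
    show ?case
    proof (intro impI ballI)
      fix p q assume x: "x \<in> fst X" and pq: "p \<in> fst ?L" "q \<in> fst ?L"
      have "eqv X (below X x) p q \<longleftrightarrow> eqv X' (k ` below X x) (h p) (h q)"
      proof (rule eqv_step[OF X(1) X' M M' h(1) _ init _ _ pq])
        show "initial_seg X' (k ` below X x)" using kbelow[OF x] init' by simp
        show "(a, b) \<in> snd ?L \<longleftrightarrow> (h a, h b) \<in> snd ?L'" if "a \<in> fst ?L" "b \<in> fst ?L" for a b
          using h(2) that .
        show "eqv X (below X z) p q \<longleftrightarrow> eqv X' (below X' (k z)) (h p) (h q)"
          if "z \<in> below X x" "p \<in> fst ?L" "q \<in> fst ?L" for z p q
        proof -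
          have "(z, x) \<in> snd X" using that(1) by (simp add: below_def)
          then show ?thesis using less[of z] lin_ord_mem[OF X(1)] that by blast
        qed
      qed
      then show "eqv X (below X x) p q \<longleftrightarrow> eqv X' (below X' (k x)) (h p) (h q)"
        using kbelow[OF x] by simp
    qed
  qed
  have "initial_seg X (fst X)" using lin_ord_mem[OF X(1)] unfolding initial_seg_def by blast
  with img I' main have "eqv X (fst X) p q \<longleftrightarrow> eqv X' (k ` fst X) (h p) (h q)"
    using h(2) by (intro eqv_step[OF X(1) X' M M' h(1) _ _ _ _ p q]) auto
  then show ?thesis using img by simp
qed

text \<open>Dividing both sides by the condensation along \<open>X\<close> leaves \<open>M\<close>
  on one side and the power over \<open>X' - I'\<close> times \<open>M'\<close> on the other. If
  \<open>X' - I'\<close> were nonempty, its least element would create adjacent classes, which the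
  density in the last assumption excludes.\<close>

lemma rigidity:
  assumes X: "lin_ord X" "wf (snd X)" and X': "lin_ord X'" "wf (snd X')"
    and M: "lin_ord M" "fst M \<noteq> {}" and M': "lin_ord M'"
    and iso: "same_order_type (lin_prod (Z_pow X) M) (lin_prod (Z_pow X') M')"
    and I': "initial_seg X' I'" and XI': "same_order_type X (restr X' I')"
    and gap: "\<And>a b. (a, b) \<in> snd M \<Longrightarrow> \<exists>c. (a, c) \<in> snd M \<and> (c, b) \<in> snd M"
  shows "I' = fst X' \<and> ((\<exists>a\<in>fst M. \<exists>b\<in>fst M. a \<noteq> b) \<longleftrightarrow> (\<exists>a\<in>fst M'. \<exists>b\<in>fst M'. a \<noteq> b))"
proof -
  let ?L = "lin_prod (Z_pow X) M" and ?L' = "lin_prod (Z_pow X') M'"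
  obtain h where h: "bij_betw h (fst ?L) (fst ?L')"
    "\<And>a b. a \<in> fst ?L \<Longrightarrow> b \<in> fst ?L \<Longrightarrow> (a, b) \<in> snd ?L \<longleftrightarrow> (h a, h b) \<in> snd ?L'"
    using iso unfolding same_order_type_def by metis
  have I'sub: "fst X' \<inter> I' = I'" using I' by (auto simp: initial_seg_def)
  obtain k where "bij_betw k (fst X) (fst (restr X' I'))"
    and k2: "\<And>a b. a \<in> fst X \<Longrightarrow> b \<in> fst X \<Longrightarrow> (a, b) \<in> snd X \<longleftrightarrow> (k a, k b) \<in> snd (restr X' I')"
    using XI' unfolding same_order_type_def by metis
  then have k: "bij_betw k (fst X) I'" by (simp add: I'sub)
  have eqv: "eqv X (fst X) p q \<longleftrightarrow> eqv X' I' (h p) (h q)" if "p \<in> fst ?L" "q \<in> fst ?L" for p q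
  proof (rule eqv_transport[OF X X'(1) M(1) M' h(1) _ I' k _ that])
    show "(a, b) \<in> snd X \<longleftrightarrow> (k a, k b) \<in> snd X'" if "a \<in> fst X" "b \<in> fst X" for a b
      using k2[OF that] bij_betw_apply[OF k] that by simp
  qed (fact h(2))
  have eqv': "eqv X' I' (h p) (h q) \<longleftrightarrow> snd p = snd q" if "p \<in> fst ?L" "q \<in> fst ?L" for p q
    using eqv[OF that] by (simp add: eqv_def)
  have img: "h ` fst ?L = fst ?L'" using h(1) by (rule bij_betw_imp_surj_on)
  note L = lin_ord_prod[OF lin_ord_Z_pow[OF X(1)] M(1)]
  have eq: "I' = fst X'"
  proof (rule ccontr)
    assume "I' \<noteq> fst X'"
    then obtain b0 where "b0 \<in> fst X' - I'" using I' by (auto simp: initial_seg_def)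
    \<comment> \<open>The zero function and the indicator of this least \<open>b\<close> are the
      candidates for representatives of adjacent classes.\<close>
    then obtain b where b: "b \<in> fst X'" "b \<notin> I'" and least: "\<And>y. (y, b) \<in> snd X' \<Longrightarrow> y \<notin> fst X' - I'"
      using wfE_min[OF X'(2), of b0 "fst X' - I'"] by blast
    obtain m where "m \<in> fst M" using M(2) by auto
    then have "(\<lambda>x. 0, m) \<in> fst ?L" by (simp add: fin_supp_zero)
    then obtain m' where m': "m' \<in> fst M'" using img by force
    define p' where "p' = ((\<lambda>x. 0) :: 'b \<Rightarrow> int, m')"
    define q' where "q' = ((\<lambda>x. 0)(b := 1) :: 'b \<Rightarrow> int, m')"
    have mem: "p' \<in> fst ?L'" "q' \<in> fst ?L'"
      using m' b by (auto simp: p'_def q'_def fin_supp_zero intro: fin_supp_upd)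
    have ne: "y \<noteq> b" if "(b, y) \<in> snd X'" for y using that lin_ord_irrefl[OF X'(1)] by auto
    have "((\<lambda>x. 0), (\<lambda>x. 0)(b := 1)) \<in> snd (Z_pow X')"
      by (rule Z_pow_lessI[OF X'(1) fin_supp_zero fin_supp_upd[OF fin_supp_zero b(1)] b(1)])
        (use ne in auto)
    then have less': "(p', q') \<in> snd ?L'" using mem by (simp add: p'_def q'_def snd_lin_prod)
    have "p' \<in> h ` fst ?L" "q' \<in> h ` fst ?L" unfolding img by (fact mem)+
    then obtain p q where pq: "p \<in> fst ?L" "h p = p'" "q \<in> fst ?L" "h q = q'" by blast
    have less: "(p, q) \<in> snd ?L" using h(2)[OF pq(1,3)] pq less' by simp
    have "\<not> eqv X' I' p' q'" using b by (auto simp: eqv_def p'_def q'_def)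
    then have "snd p \<noteq> snd q" using eqv'[OF pq(1,3)] pq by simp
    then have "(snd p, snd q) \<in> snd M" using less by (cases p; cases q) (auto simp: snd_lin_prod)
    \<comment> \<open>By density some class lies strictly between; its image \<open>u\<close> must
      have value \<open>0\<close> or \<open>1\<close> at \<open>b\<close>, hence fall into one of
      the two classes after all.\<close>
    then obtain c where c: "(snd p, c) \<in> snd M" "(c, snd q) \<in> snd M" using gap by blast
    define r where "r = (fst p, c)"
    have r: "r \<in> fst ?L" "(p, r) \<in> snd ?L" "(r, q) \<in> snd ?L"
      using c pq lin_ord_mem[OF M(1)] by (cases p; cases q; auto simp: r_def snd_lin_prod; fail)+
    have neq: "snd r \<noteq> snd p" "snd r \<noteq> snd q" using c lin_ord_irrefl[OF M(1)] by (auto simp: r_def)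
    obtain u n where hr: "h r = (u, n)" by (cases "h r")
    have "(p', h r) \<in> snd ?L'" "(h r, q') \<in> snd ?L'"
      using h(2)[OF pq(1) r(1)] h(2)[OF r(1) pq(3)] r pq by auto
    then have n: "n = m'" and u: "(\<lambda>x. 0, u) \<in> snd (Z_pow X')" "(u, (\<lambda>x. 0)(b := 1)) \<in> snd (Z_pow X')"
      using lin_ord_irrefl[OF M'] lin_ord_asym[OF M', of m' n]
      by (auto simp: hr p'_def q'_def snd_lin_prod)
    have "(\<forall>y. (b, y) \<in> snd X' \<longrightarrow> u y = 0) \<and> 0 \<le> u b \<and> u b \<le> ((\<lambda>x. 0)(b := 1)) b"
      by (rule Z_pow_sandwich[OF X'(1), of "\<lambda>x. 0" u "(\<lambda>x. 0)(b := 1)" b]) (use u b ne in auto)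
    then have u': "\<And>y. (b, y) \<in> snd X' \<Longrightarrow> u y = 0" "u b = 0 \<or> u b = 1" by auto
    have above: "y = b \<or> (b, y) \<in> snd X'" if "y \<in> fst X' - I'" for y
      using that least[of y] lin_ord_total[OF X'(1) b(1), of y] by auto
    have "eqv X' I' (h r) p' \<or> eqv X' I' (h r) q'"
    proof (cases "u b = 0")
      case True
      then have "u y = 0" if "y \<in> fst X' - I'" for y using above[OF that] u' by auto
      then show ?thesis by (simp add: eqv_def hr p'_def n)
    next
      case False
      then have "u y = ((\<lambda>x. 0)(b := 1)) y" if "y \<in> fst X' - I'" for y
        using above[OF that] u' lin_ord_irrefl[OF X'(1)] by auto
      then show ?thesis by (simp add: eqv_def hr q'_def n)
    qed
    then show False using eqv'[OF r(1) pq(1)] eqv'[OF r(1) pq(3)] neq pq by simp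
  qed
  \<comment> \<open>With the exponents exhausted, the classes on both sides are given by the second
    component, so one quotient is a single point exactly if the other is.\<close>
  have all: "(\<forall>p\<in>fst ?L. \<forall>q\<in>fst ?L. snd p = snd q) \<longleftrightarrow> (\<forall>p\<in>fst ?L'. \<forall>q\<in>fst ?L'. snd p = snd q)"
  proof -
    have "snd (h p) = snd (h q) \<longleftrightarrow> snd p = snd q" if "p \<in> fst ?L" "q \<in> fst ?L" for p q
      using eqv'[OF that] by (simp add: eqv_def eq)
    then show ?thesis unfolding img[symmetric] by auto
  qed
  have triv: "(\<forall>p\<in>fst (lin_prod (Z_pow Y) N). \<forall>q\<in>fst (lin_prod (Z_pow Y) N). snd p = snd q) \<longleftrightarrow>
    (\<forall>a\<in>fst N. \<forall>b\<in>fst N. a = b)" for Y :: "'e lin" and N :: "'f lin"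
    using fin_supp_zero[of "fst Y"] by fastforce
  show ?thesis using eq all unfolding triv by blast
qed

text \<open>Comparability of well-orders, carried over from the reflexive relations of the library.
  The image of an embedding is an initial segment, and the embedding is an isomorphism onto
  it.\<close>

lemma wf_comparable:
  assumes X: "lin_ord X" "wf (snd X)" and Y: "lin_ord Y" "wf (snd Y)"
  shows "(\<exists>I. initial_seg Y I \<and> same_order_type X (restr Y I)) \<or>
    (\<exists>I. initial_seg X I \<and> same_order_type Y (restr X I))"
proof -
  have emb: "\<exists>I. initial_seg Y I \<and> same_order_type X (restr Y I)"
    if X: "lin_ord X" "wf (snd X)" and Y: "lin_ord Y" "wf (snd Y)"
      and f: "embed (snd X \<union> Id_on (fst X)) (snd Y \<union> Id_on (fst Y)) f"
      and wo: "Well_order (snd X \<union> Id_on (fst X))" "Well_order (snd Y \<union> Id_on (fst Y))"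
      and Field: "Field (snd X \<union> Id_on (fst X)) = fst X" "Field (snd Y \<union> Id_on (fst Y)) = fst Y"
    for X :: "'e lin" and Y :: "'f lin" and f
  proof (intro exI conjI)
    have "wo_rel.ofilter (snd Y \<union> Id_on (fst Y)) (f ` fst X)"
      using embed_Field_ofilter[OF wo f] Field by simp
    then have filt: "f ` fst X \<subseteq> fst Y" "\<And>a b. b \<in> f ` fst X \<Longrightarrow> (a, b) \<in> snd Y \<Longrightarrow> a \<in> f ` fst X"
      using wo(2) Field(2) by (auto simp: wo_rel.ofilter_def wo_rel_def under_def)
    then show "initial_seg Y (f ` fst X)" unfolding initial_seg_def by blast
    have inj: "inj_on f (fst X)" using embed_inj_on[OF wo(1) f] Field by simp
    have "compat (snd X \<union> Id_on (fst X)) (snd Y \<union> Id_on (fst Y)) f"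
      using embed_compat[OF f] .
    then have mono: "(f a, f b) \<in> snd Y" if "(a, b) \<in> snd X" for a b
    proof -
      have ab: "a \<in> fst X" "b \<in> fst X" "a \<noteq> b" using that lin_ord_mem[OF X(1)] lin_ord_irrefl[OF X(1)] by blast+
      then have "f a \<noteq> f b" using inj by (simp add: inj_on_eq_iff)
      moreover have "(f a, f b) \<in> snd Y \<union> Id_on (fst Y)"
        using \<open>compat _ _ f\<close> that by (auto simp: compat_def)
      ultimately show ?thesis by auto
    qed
    show "same_order_type X (restr Y (f ` fst X))"
    proof (rule same_order_typeI[OF X(1) lin_ord_restr[OF Y(1)], of f])
      show "bij_betw f (fst X) (fst (restr Y (f ` fst X)))"
        using inj filt(1) by (simp add: bij_betw_def Int_absorb1)
    qed (use mono lin_ord_mem[OF X(1)] in auto)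
  qed
  have Field: "Field (snd X \<union> Id_on (fst X)) = fst X" if "lin_ord X" for X :: "'e lin"
    using lin_ord_mem[OF that] by (auto simp: Field_def)
  have wo: "Well_order (snd X \<union> Id_on (fst X))" if X: "lin_ord X" "wf (snd X)" for X :: "'e lin"
    unfolding well_order_on_def Field[OF X(1)]
  proof
    show "linear_order_on (fst X) (snd X \<union> Id_on (fst X))"
      unfolding linear_order_on_def partial_order_on_def preorder_on_def
    proof (intro conjI)
      show "trans (snd X \<union> Id_on (fst X))" using lin_ord_trans[OF X(1)] unfolding trans_def by blast
      show "antisym (snd X \<union> Id_on (fst X))" using lin_ord_asym[OF X(1)] unfolding antisym_def by blast
      show "total_on (fst X) (snd X \<union> Id_on (fst X))" using lin_ord_total[OF X(1)] unfolding total_on_def by blast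
    qed (use lin_ord_mem[OF X(1)] in \<open>auto simp: refl_on_def\<close>)
    show "wf (snd X \<union> Id_on (fst X) - Id)" by (rule wf_subset[OF X(2)]) auto
  qed
  from wellorders_totally_ordered[OF wo[OF X] wo[OF Y]] show ?thesis
    using emb[OF X Y _ wo[OF X] wo[OF Y] Field[OF X(1)] Field[OF Y(1)]]
      emb[OF Y X _ wo[OF Y] wo[OF X] Field[OF Y(1)] Field[OF X(1)]] by blast
qed

section \<open>Uniqueness of the exponent and of the bit\<close>

lemma lin_ord_q_pow: "lin_ord (q_pow \<epsilon>)"
  by (simp add: q_pow_def lin_ord_rat_lin)

lemma q_pow_gap: "(a, b) \<in> snd (q_pow \<epsilon>) \<Longrightarrow> \<exists>c. (a, c) \<in> snd (q_pow \<epsilon>) \<and> (c, b) \<in> snd (q_pow \<epsilon>)"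
  using dense[of a b] by (auto simp: q_pow_def split: if_splits)

lemma q_pow_nonempty: "fst (q_pow \<epsilon>) \<noteq> {}"
  by (simp add: q_pow_def)

lemma q_pow_nontrivial: "(\<exists>a\<in>fst (q_pow \<epsilon>). \<exists>b\<in>fst (q_pow \<epsilon>). a \<noteq> b) \<longleftrightarrow> \<epsilon> \<noteq> 0"
proof -
  have "\<exists>a b :: rat. a \<noteq> b" using zero_neq_one by blast
  then show ?thesis by (simp add: q_pow_def)
qed

lemma restr_fst: "lin_ord X \<Longrightarrow> restr X (fst X) = X"
  using lin_ord_mem[of X] by (cases X) (auto simp: restr_def)

text \<open>One exponent is isomorphic to an initial segment of the other, and
  \<open>rigidity\<close>, applied in that direction, makes the segment everything. Both factors
  \<open>q_pow\<close> meet its density assumption, the singleton vacuously.\<close>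

theorem type_unique:
  assumes X: "lin_ord X" "wf (snd X)" and X': "lin_ord X'" "wf (snd X')"
    and \<epsilon>: "\<epsilon> \<in> {0, 1}" "\<epsilon>' \<in> {0, 1}"
    and iso: "same_order_type (lin_prod (Z_pow X) (q_pow \<epsilon>)) (lin_prod (Z_pow X') (q_pow \<epsilon>'))"
  shows "same_order_type X X' \<and> \<epsilon> = \<epsilon>'"
proof -
  note rig = rigidity[OF X X' lin_ord_q_pow q_pow_nonempty lin_ord_q_pow iso _ _ q_pow_gap]
  note rig' = rigidity[OF X' X lin_ord_q_pow q_pow_nonempty lin_ord_q_pow same_order_type_sym[OF iso] _ _ q_pow_gap]
  from wf_comparable[OF X X'] show ?thesis
  proof (elim disjE exE conjE)
    fix I assume I: "initial_seg X' I" "same_order_type X (restr X' I)"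
    with rig[OF I] \<epsilon> show ?thesis unfolding q_pow_nontrivial by (auto simp: restr_fst[OF X'(1)])
  next
    fix I assume I: "initial_seg X I" "same_order_type X' (restr X I)"
    with rig'[OF I] have I': "same_order_type X' X" and "\<epsilon> \<noteq> 0 \<longleftrightarrow> \<epsilon>' \<noteq> 0"
      unfolding q_pow_nontrivial by (auto simp: restr_fst[OF X(1)])
    then show ?thesis using \<epsilon> same_order_type_sym[OF I'] by auto
  qed
qed

text \<open>\<open>M\<close> may be arbitrary because \<open>rigidity\<close> asks for density only
  on the side of \<open>q_pow\<close>: if \<open>X\<close> is the shorter exponent, it already
  exhausts \<open>F\<close>. Thus a factor \<open>\<int>\<^sup>F\<close> split off from a type
  certifies a lower bound for its exponent.\<close>

lemma exponent_initial_seg: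
  assumes F: "lin_ord F" "wf (snd F)" and X: "lin_ord X" "wf (snd X)" and M: "lin_ord M"
    and iso: "same_order_type (lin_prod (Z_pow X) (q_pow \<epsilon>)) (lin_prod (Z_pow F) M)"
  shows "\<exists>I. initial_seg X I \<and> same_order_type F (restr X I)"
proof (cases "\<exists>I. initial_seg F I \<and> same_order_type X (restr F I)")
  case True
  then obtain I where I: "initial_seg F I" "same_order_type X (restr F I)" by auto
  have "I = fst F"
    using rigidity[OF X F lin_ord_q_pow q_pow_nonempty M iso I q_pow_gap] by simp
  then have "same_order_type X F" using I restr_fst[OF F(1)] by simp
  then have "same_order_type F (restr X (fst X))"
    using same_order_type_sym restr_fst[OF X(1)] by metis
  moreover have "initial_seg X (fst X)" using lin_ord_mem[OF X(1)] unfolding initial_seg_def by blast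
  ultimately show ?thesis by blast
next
  case False
  then show ?thesis using wf_comparable[OF F X] by blast
qed

section \<open>Boundedness\<close>

text \<open>For well-founded relations, \<open>rank_le R T a b\<close> says that the rank of \<open>a\<close> in \<open>R\<close> is at most
  the rank of \<open>b\<close> in \<open>T\<close>.\<close>

inductive rank_le :: "'a rel \<Rightarrow> 'b rel \<Rightarrow> 'a \<Rightarrow> 'b \<Rightarrow> bool" for R T where
  rank_leI: "(\<And>a'. (a', a) \<in> R \<Longrightarrow> \<exists>b'. (b', b) \<in> T \<and> rank_le R T a' b') \<Longrightarrow> rank_le R T a b"

lemma rank_leD: "rank_le R T a b \<Longrightarrow> (a', a) \<in> R \<Longrightarrow> \<exists>b'. (b', b) \<in> T \<and> rank_le R T a' b'"
  by (erule rank_le.cases) blast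

lemma rank_le_trans: "rank_le R S a b \<Longrightarrow> rank_le S T b c \<Longrightarrow> rank_le R T a c"
proof (induction arbitrary: c rule: rank_le.induct)
  case (rank_leI a b)
  show ?case
  proof (rule rank_le.rank_leI)
    fix a' assume "(a', a) \<in> R"
    then obtain b' where b': "(b', b) \<in> S" "\<And>c. rank_le S T b' c \<Longrightarrow> rank_le R T a' c"
      using rank_leI.IH by blast
    then show "\<exists>c'. (c', c) \<in> T \<and> rank_le R T a' c'"
      using rank_leD[OF rank_leI.prems b'(1)] by blast
  qed
qed

lemma rank_le_map:
  assumes "wf R" "\<And>a b. (a, b) \<in> R \<Longrightarrow> (k a, k b) \<in> T" shows "rank_le R T a (k a)"
  using assms(1)
proof (induction a rule: wf_induct_rule)
  case (less a)
  then show ?case using assms(2) by (blast intro: rank_leI)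
qed

text \<open>The dichotomy of ranks in its strict form, without assigning ordinals: some predecessor
  of \<open>a\<close> fails against every predecessor of \<open>b\<close>, and by induction it
  dominates each of them strictly.\<close>

lemma rank_le_total:
  assumes "wf R" "\<not> rank_le R T a b" shows "\<exists>a'. (a', a) \<in> R \<and> rank_le T R b a'"
  using assms
proof (induction a arbitrary: b rule: wf_induct_rule)
  case (less a)
  have "\<exists>a'. (a', a) \<in> R \<and> (\<forall>b'. (b', b) \<in> T \<longrightarrow> \<not> rank_le R T a' b')"
  proof (rule ccontr)
    assume "\<not> ?thesis"
    then have "rank_le R T a b" by (intro rank_leI) blast
    with less.prems show False by simp
  qed
  then obtain a' where a': "(a', a) \<in> R" "\<And>b'. (b', b) \<in> T \<Longrightarrow> \<not> rank_le R T a' b'" by blast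
  have "rank_le T R b a'"
    by (rule rank_leI) (rule less.IH[OF a'(1) a'(2)])
  with a' show ?case by blast
qed

lemma rank_le_irrefl: "wf R \<Longrightarrow> (b, a) \<in> R \<Longrightarrow> \<not> rank_le R R a b"
proof (induction a arbitrary: b rule: wf_induct_rule)
  case (less a)
  show ?case
  proof
    assume "rank_le R R a b"
    from rank_leD[OF this less.prems] obtain b' where "(b', b) \<in> R" "rank_le R R b b'" by blast
    then show False using less.IH[OF less.prems] by simp
  qed
qed

text \<open>The elements are sorted by rank and, within one rank, by their codes. Ranks are
  well-founded and so are codes, and \<open>T\<close> strictly raises the rank.\<close>

lemma wf_linear_extension:
  fixes T :: "'a :: countable rel"
  assumes T: "wf T"
  shows "\<exists>W. lin_ord (UNIV, W) \<and> wf W \<and> T \<subseteq> W"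
proof -
  let ?le = "rank_le T T"
  define less where "less = {(a, b). \<not> ?le b a}"
  define W where "W = {(a, b). \<not> ?le b a \<or> ?le a b \<and> to_nat a < to_nat b}"
  have refl: "?le a a" for a using rank_le_map[OF T, of "\<lambda>x. x"] by simp
  have pred: "?le a b" if "(a, b) \<in> T" for a b
    using T that
  proof (induction b arbitrary: a rule: wf_induct_rule)
    case (less b)
    show ?case
    proof (rule rank_leI)
      fix a' assume "(a', a) \<in> T"
      then show "\<exists>b'. (b', b) \<in> T \<and> ?le a' b'" using less by blast
    qed
  qed
  have total: "?le a b \<or> ?le b a" for a b
  proof (rule disjCI)
    assume "\<not> ?le b a"
    from rank_le_total[OF T this] obtain b' where b': "(b', b) \<in> T" "?le a b'" by blast
    show "?le a b" by (rule rank_le_trans[OF b'(2) pred[OF b'(1)]])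
  qed
  \<comment> \<open>Stated for every \<open>a\<close> of rank at most that of \<open>b\<close>, so
    that the induction can run along \<open>T\<close>, of which \<open>less\<close> is not a
    part.\<close>
  have acc: "?le a b \<Longrightarrow> a \<in> Wellfounded.acc less" for a b
    using T
  proof (induction b arbitrary: a rule: wf_induct_rule)
    case (less b)
    show ?case
    proof (rule accI)
      fix c assume "(c, a) \<in> less"
      then obtain a' where a': "(a', a) \<in> T" "?le c a'"
        using rank_le_total[OF T, of T a c] by (auto simp: less_def)
      obtain b' where b': "(b', b) \<in> T" "?le a' b'" using rank_leD[OF less.prems a'(1)] by blast
      show "c \<in> Wellfounded.acc less" by (rule less.IH[OF b'(1) rank_le_trans[OF a'(2) b'(2)]])
    qed
  qed
  have wf_less: "wf less" using acc refl by (intro acc_wfI) blast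
  have "wf W"
  proof (rule wfI_min)
    fix q and Q :: "'a set" assume "q \<in> Q"
    then obtain m where m: "m \<in> Q" and min: "\<And>y. (y, m) \<in> less \<Longrightarrow> y \<notin> Q"
      by (rule wfE_min[OF wf_less]) blast
    have m': "?le m y" if "y \<in> Q" for y using min[of y] that by (auto simp: less_def)
    obtain z where z: "z \<in> Q \<and> ?le z m" "\<And>y. y \<in> Q \<and> ?le y m \<Longrightarrow> to_nat z \<le> to_nat y"
      using ex_has_least_nat[of "\<lambda>z. z \<in> Q \<and> ?le z m" m to_nat] m refl by blast
    have "y \<notin> Q" if "(y, z) \<in> W" for y
    proof
      assume y: "y \<in> Q"
      have zy: "?le z y" using rank_le_trans[OF conjunct2[OF z(1)] m'[OF y]] .
      then have "?le y z" "to_nat y < to_nat z" using that by (auto simp: W_def)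
      moreover have "?le y m" using rank_le_trans[OF \<open>?le y z\<close> conjunct2[OF z(1)]] .
      ultimately show False using z(2)[of y] y by simp
    qed
    then show "\<exists>z\<in>Q. \<forall>y. (y, z) \<in> W \<longrightarrow> y \<notin> Q" using z by blast
  qed
  moreover have "lin_ord (UNIV, W)"
  proof (rule lin_ordI)
    show "(a, c) \<in> snd (UNIV, W)" if "(a, b) \<in> snd (UNIV, W)" "(b, c) \<in> snd (UNIV, W)" for a b c
    proof -
      have ab: "?le a b" "?le b a \<Longrightarrow> to_nat a < to_nat b" and bc: "?le b c" "?le c b \<Longrightarrow> to_nat b < to_nat c"
        using that total[of a b] total[of b c] by (auto simp: W_def)
      have "?le a c" using ab(1) bc(1) by (rule rank_le_trans)
      moreover have "to_nat a < to_nat c" if "?le c a"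
        using ab(2)[OF rank_le_trans[OF bc(1) that]] bc(2)[OF rank_le_trans[OF that ab(1)]] by simp
      ultimately show ?thesis by (auto simp: W_def)
    qed
    show "(a, b) \<in> snd (UNIV, W) \<or> (b, a) \<in> snd (UNIV, W)" if "a \<noteq> b" for a b
      using total[of a b] that inj_to_nat[where 'a = 'a] by (auto simp: W_def dest!: injD nat_neq_iff[THEN iffD1]
          simp: nat_neq_iff[symmetric])
  qed (auto simp: W_def refl)
  moreover have "T \<subseteq> W" using rank_le_irrefl[OF T] by (auto simp: W_def)
  ultimately show ?thesis by blast
qed

text \<open>The nodes of the tree are a finite prefix of a point of \<open>S\<close> together with a finite descending
  sequence, latest entry first. An infinite branch would give a point of the closed set \<open>S\<close> whose
  relation is ill-founded.\<close>

theorem boundedness: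
  fixes S :: "baire set" and F :: "baire \<Rightarrow> 'a :: countable rel"
  assumes closed: "\<And>s. (\<And>n. \<exists>t\<in>S. agree n s t) \<Longrightarrow> s \<in> S"
    and cont: "\<And>s a b. s \<in> S \<Longrightarrow> \<exists>n. \<forall>t\<in>S. agree n s t \<longrightarrow> (a, b) \<in> F t \<longrightarrow> (a, b) \<in> F s"
    and wf: "\<And>s. s \<in> S \<Longrightarrow> wf (F s)"
  shows "\<exists>W :: (nat list \<times> 'a list) option rel. lin_ord (UNIV, W) \<and> wf W \<and>
    (\<forall>s\<in>S. \<not> (\<exists>k. \<forall>a b. (a, b) \<in> W \<longrightarrow> (k a, k b) \<in> F s))"
proof -
  define consistent where "consistent u c \<longleftrightarrow>
    (\<exists>s\<in>S. (\<forall>i<length u. s i = u ! i) \<and> (\<forall>i. Suc i < length c \<longrightarrow> (c ! i, c ! Suc i) \<in> F s))"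
    for u and c :: "'a list"
  define T where "T = {((u', c'), (u, c)) | u' c' u c. (\<exists>m x. u' = u @ [m] \<and> c' = x # c) \<and> consistent u' c'}"
  have "wf T"
  proof (rule ccontr)
    assume "\<not> wf T"
    then obtain f where f: "\<And>i. (f (Suc i), f i) \<in> T"
      unfolding wf_iff_no_infinite_down_chain by blast
    define u where "u i = fst (f i)" for i
    define c where "c i = snd (f i)" for i
    have "\<exists>m x. u (Suc i) = u i @ [m] \<and> c (Suc i) = x # c i" for i
      using f[of i] by (auto simp: T_def u_def c_def)
    then obtain m x where m: "\<And>i. u (Suc i) = u i @ [m i]" and x: "\<And>i. c (Suc i) = x i # c i" by metis
    have cons: "consistent (u (Suc i)) (c (Suc i))" for i
      using f[of i] by (auto simp: T_def u_def c_def)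
    have len: "i \<le> length (u i)" for i by (induction i) (auto simp: m)
    have prefix: "i \<le> j \<Longrightarrow> n < length (u i) \<Longrightarrow> u j ! n = u i ! n \<and> n < length (u j)" for i j n
      by (induction rule: dec_induct) (auto simp: m nth_append)
    \<comment> \<open>The prefixes along the branch converge to \<open>s\<close>. The branch may
      start at any node, so the length of \<open>u i\<close> is only known to be at least
      \<open>i\<close>.\<close>
    define s where "s n = u (Suc n) ! n" for n
    have s: "u i ! n = s n" if "n < length (u i)" for i n
    proof -
      have "n < length (u (Suc n))" using len[of "Suc n"] by simp
      then show ?thesis using prefix[of i "max i (Suc n)" n] prefix[of "Suc n" "max i (Suc n)" n] that
        by (simp add: s_def)
    qed
    have "\<exists>t. t \<in> S \<and> agree n s t \<and> (\<forall>i. Suc i < n \<longrightarrow> (x (Suc i), x i) \<in> F t)" for n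
    proof -
      obtain t where t: "t \<in> S" "\<And>i. i < length (u (Suc n)) \<Longrightarrow> t i = u (Suc n) ! i"
        "\<And>i. Suc i < length (c (Suc n)) \<Longrightarrow> (c (Suc n) ! i, c (Suc n) ! Suc i) \<in> F t"
        using cons[of n] unfolding consistent_def by blast
      have "agree n s t" using len[of "Suc n"] by (auto simp: agree_def t(2) s)
      moreover have clen: "i \<le> length (c i)" for i by (induction i) (auto simp: x)
      \<comment> \<open>The lists grow at the front, which reverses the index; whatever
        \<open>c 0\<close> contains stays behind position \<open>n\<close>.\<close>
      have cn: "i \<le> n \<Longrightarrow> c (Suc n) ! i = x (n - i)" for i n
      proof (induction i arbitrary: n)
        case (Suc i)
        then obtain k where "n = Suc k" by (cases n) auto
        with Suc show ?case by (simp add: x)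
      qed (simp add: x)
      have "(x (Suc i), x i) \<in> F t" if "Suc i < n" for i
        using t(3)[of "n - Suc i"] clen[of "Suc n"] cn[of "n - Suc i" n] cn[of "n - i" n] that
        by (simp add: Suc_diff_Suc)
      ultimately show ?thesis using t(1) by blast
    qed
    then obtain t where t: "\<And>n. t n \<in> S" "\<And>n. agree n s (t n)"
      "\<And>n i. Suc i < n \<Longrightarrow> (x (Suc i), x i) \<in> F (t n)" by metis
    have "s \<in> S" using closed t by blast
    have "(x (Suc i), x i) \<in> F s" for i
    proof -
      obtain n where n: "\<And>t. t \<in> S \<Longrightarrow> agree n s t \<Longrightarrow> (x (Suc i), x i) \<in> F t \<Longrightarrow> (x (Suc i), x i) \<in> F s"
        using cont[OF \<open>s \<in> S\<close>] by blast
      let ?k = "max n (Suc (Suc i))"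
      have "agree n s (t ?k)" using agree_mono[OF t(2)[of ?k], of n] by simp
      then show ?thesis using n[OF t(1) _ t(3)] by simp
    qed
    then show False using wf[OF \<open>s \<in> S\<close>] unfolding wf_iff_no_infinite_down_chain by blast
  qed
  obtain W where W: "lin_ord (UNIV, W)" "wf W" "T \<subseteq> W" using wf_linear_extension[OF \<open>wf T\<close>] by blast
  \<comment> \<open>A top element is added, which has larger rank than every node of the tree, so
    that no single node can dominate it.\<close>
  define W' where "W' = {(Some a, Some b) | a b. (a, b) \<in> W} \<union> range (\<lambda>a. (Some a, None))"
  have W': "(Some a, Some b) \<in> W' \<longleftrightarrow> (a, b) \<in> W" "(Some a, None) \<in> W'" "(None, z) \<notin> W'" for a b z
    unfolding W'_def by blast+
  have "lin_ord (UNIV, W')"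
  proof (rule lin_ordI)
    show "(a, d) \<in> snd (UNIV, W')" if "(a, b) \<in> snd (UNIV, W')" "(b, d) \<in> snd (UNIV, W')" for a b d
      using that lin_ord_trans[OF W(1), of "the a" "the b" "the d"]
      by (cases a; cases b; cases d) (auto simp: W')
    show "(a, b) \<in> snd (UNIV, W') \<or> (b, a) \<in> snd (UNIV, W')" if "a \<noteq> b" for a b
      using that lin_ord_total[OF W(1), of "the a" "the b"] by (cases a; cases b) (auto simp: W')
    show "(a, a) \<notin> snd (UNIV, W')" for a
      using lin_ord_irrefl[OF W(1)] by (cases a) (auto simp: W')
  qed simp
  moreover have "wf W'"
  proof -
    have some: "Some a \<in> Wellfounded.acc W'" for a
      using W(2)
    proof (induction a rule: wf_induct_rule)
      case (less a)
      show ?case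
      proof (rule accI)
        fix z assume "(z, Some a) \<in> W'"
        then show "z \<in> Wellfounded.acc W'" using less W' by (cases z) auto
      qed
    qed
    have "None \<in> Wellfounded.acc W'"
    proof (rule accI)
      fix z assume "(z, None) \<in> W'"
      then show "z \<in> Wellfounded.acc W'" using some W' by (cases z) auto
    qed
    then show ?thesis using some by (intro acc_wfI) (metis option.exhaust)
  qed
  moreover have "\<not> (\<exists>k. \<forall>a b. (a, b) \<in> W' \<longrightarrow> (k a, k b) \<in> F s)" if s: "s \<in> S" for s
  proof
    assume "\<exists>k. \<forall>a b. (a, b) \<in> W' \<longrightarrow> (k a, k b) \<in> F s"
    then obtain k where k: "\<And>a b. (a, b) \<in> W' \<Longrightarrow> (k a, k b) \<in> F s" by blast
    \<comment> \<open>For \<open>s\<close> in \<open>S\<close>, a descending sequence of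
      \<open>F s\<close> together with an equally long prefix of \<open>s\<close> is a consistent
      node. Hence below this node the tree imitates \<open>F s\<close>, and the rank of
      \<open>x\<close> is at most that of the node.\<close>
    have branch: "(\<forall>i. Suc i < length (x # c) \<longrightarrow> ((x # c) ! i, (x # c) ! Suc i) \<in> F s) \<Longrightarrow>
      rank_le (F s) T x (map s [0..<length (x # c)], x # c)" for x c
      using wf[OF s]
    proof (induction x arbitrary: c rule: wf_induct_rule)
      case (less x)
      show ?case
      proof (rule rank_leI)
        fix y assume y: "(y, x) \<in> F s"
        let ?n = "(map s [0..<length (y # x # c)], y # x # c)"
        have desc: "\<forall>i. Suc i < length (y # x # c) \<longrightarrow> ((y # x # c) ! i, (y # x # c) ! Suc i) \<in> F s"
        proof (intro allI impI)
          fix i assume i: "Suc i < length (y # x # c)"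
          show "((y # x # c) ! i, (y # x # c) ! Suc i) \<in> F s"
          proof (cases i)
            case 0 then show ?thesis using y by simp
          next
            case (Suc j)
            then show ?thesis using less.prems i by simp
          qed
        qed
        then have "consistent (map s [0..<length (y # x # c)]) (y # x # c)"
          unfolding consistent_def by (intro bexI[OF _ s]) (simp del: upt_Suc)
        then have "(?n, (map s [0..<length (x # c)], x # c)) \<in> T"
          unfolding T_def by auto
        then show "\<exists>b'. (b', (map s [0..<length (x # c)], x # c)) \<in> T \<and> rank_le (F s) T y b'"
          using less.IH[OF y desc] by blast
      qed
    qed
    define b where "b = (map s [0..<length [k None]], [k None])"
    \<comment> \<open>An embedding would close a circle: the rank of \<open>None\<close> is at most
      that of the node \<open>b\<close>, which is at most that of \<open>Some b\<close>, which lies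
      below \<open>None\<close>.\<close>
    have "rank_le W' (F s) None (k None)" by (rule rank_le_map[OF \<open>wf W'\<close>]) (rule k)
    moreover have "rank_le (F s) T (k None) b" unfolding b_def by (rule branch) simp
    ultimately have "rank_le W' T None b" by (rule rank_le_trans)
    from rank_leD[OF this W'(2)] obtain b' where b': "(b', b) \<in> T" "rank_le W' T (Some b) b'" by blast
    have "rank_le T W' b (Some b)"
      by (rule rank_le_map[OF \<open>wf T\<close>]) (use W(3) W'(1) in blast)
    from rank_le_trans[OF this b'(2)] show False using rank_le_irrefl[OF \<open>wf T\<close> b'(1)] by simp
  qed
  ultimately show ?thesis by blast
qed

section \<open>Locally constant maps\<close>

text \<open>Continuity into a discrete space; for a predicate it says that the set it defines is
  clopen.\<close>

definition locally_const :: "(baire \<Rightarrow> 'b) \<Rightarrow> bool" where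
  "locally_const P \<longleftrightarrow> (\<forall>s. \<exists>N. \<forall>t. agree N s t \<longrightarrow> P t = P s)"

lemma locally_const_const: "locally_const (\<lambda>s. c)"
  by (simp add: locally_const_def)

lemma locally_const_nth: "locally_const (\<lambda>s. s n)"
  unfolding locally_const_def agree_def by (intro allI exI[of _ "Suc n"]) simp

lemma locally_const_comp2:
  assumes "locally_const P" "locally_const Q" shows "locally_const (\<lambda>s. f (P s) (Q s))"
  unfolding locally_const_def
proof
  fix s
  obtain M where M: "\<And>t. agree M s t \<Longrightarrow> P t = P s"
    using assms(1) unfolding locally_const_def by blast
  obtain N where N: "\<And>t. agree N s t \<Longrightarrow> Q t = Q s"
    using assms(2) unfolding locally_const_def by blast
  have "f (P t) (Q t) = f (P s) (Q s)" if "agree (max M N) s t" for t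
    using that M[of t] N[of t] by simp
  then have "\<forall>t. agree (max M N) s t \<longrightarrow> f (P t) (Q t) = f (P s) (Q s)" by blast
  then show "\<exists>N. \<forall>t. agree N s t \<longrightarrow> f (P t) (Q t) = f (P s) (Q s)" ..
qed

lemma locally_const_comp: "locally_const P \<Longrightarrow> locally_const (\<lambda>s. f (P s))"
  using locally_const_comp2[of P P "\<lambda>a b. f a"] .

text \<open>Near \<open>s\<close> the argument \<open>Q\<close> does not change, so only the one
  function with that argument has to be watched.\<close>

lemma locally_const_eval:
  assumes "\<And>n. locally_const (\<lambda>s. P s n)" "locally_const Q" shows "locally_const (\<lambda>s. P s (Q s))"
  unfolding locally_const_def
proof
  fix s
  obtain M where M: "\<And>t. agree M s t \<Longrightarrow> P t (Q s) = P s (Q s)"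
    using assms(1)[of "Q s"] unfolding locally_const_def by blast
  obtain N where N: "\<And>t. agree N s t \<Longrightarrow> Q t = Q s"
    using assms(2) unfolding locally_const_def by blast
  have "P t (Q t) = P s (Q s)" if "agree (max M N) s t" for t
    using that M[of t] N[of t] by simp
  then have "\<forall>t. agree (max M N) s t \<longrightarrow> P t (Q t) = P s (Q s)" by blast
  then show "\<exists>N. \<forall>t. agree N s t \<longrightarrow> P t (Q t) = P s (Q s)" ..
qed

lemma locally_const_ball:
  assumes "finite I" "\<And>i. i \<in> I \<Longrightarrow> locally_const (P i)"
  shows "locally_const (\<lambda>s. \<forall>i\<in>I. P i s)"
  unfolding locally_const_def
proof
  fix s
  have "\<exists>N. \<forall>t. agree N s t \<longrightarrow> (\<forall>i\<in>I. P i t = P i s)"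
    using assms by (intro common_bound) (auto simp: locally_const_def)
  then obtain N where N: "\<And>t. agree N s t \<Longrightarrow> \<forall>i\<in>I. P i t = P i s" by blast
  have "(\<forall>i\<in>I. P i t) = (\<forall>i\<in>I. P i s)" if "agree N s t" for t
    by (rule ball_cong[OF refl]) (use N[OF that] in blast)
  then have "\<forall>t. agree N s t \<longrightarrow> (\<forall>i\<in>I. P i t) = (\<forall>i\<in>I. P i s)" by blast
  then show "\<exists>N. \<forall>t. agree N s t \<longrightarrow> (\<forall>i\<in>I. P i t) = (\<forall>i\<in>I. P i s)" ..
qed

lemma locally_const_agree:
  assumes "\<And>n. locally_const (\<lambda>s. G s n)"
  shows "\<exists>M. \<forall>t. agree M s t \<longrightarrow> agree N (G s) (G t)"
proof -
  have "\<exists>M. \<forall>t. agree M s t \<longrightarrow> (\<forall>i\<in>{..<N}. G t i = G s i)"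
    using assms by (intro common_bound) (auto simp: locally_const_def)
  then obtain M where M: "\<And>t. agree M s t \<Longrightarrow> \<forall>i\<in>{..<N}. G t i = G s i" by blast
  have "agree N (G s) (G t)" if "agree M s t" for t
    using M[OF that] unfolding agree_def[of N] by simp
  then show ?thesis by blast
qed

lemma locally_const_compose:
  assumes "locally_const P" "\<And>n. locally_const (\<lambda>s. G s n)"
  shows "locally_const (\<lambda>s. P (G s))"
  unfolding locally_const_def
proof
  fix s
  obtain N where N: "\<And>t. agree N (G s) t \<Longrightarrow> P t = P (G s)"
    using assms(1) unfolding locally_const_def by blast
  obtain M where M: "\<And>t. agree M s t \<Longrightarrow> agree N (G s) (G t)"
    using locally_const_agree[of G, OF assms(2)] by blast
  have "\<forall>t. agree M s t \<longrightarrow> P (G t) = P (G s)" by (intro allI impI N M)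
  then show "\<exists>M. \<forall>t. agree M s t \<longrightarrow> P (G t) = P (G s)" ..
qed

text \<open>By the use principle the program gives the old output on all nearby oracles, and
  determinism identifies it with the new one. The program has to halt for every
  \<open>s\<close>.\<close>

lemma locally_const_computable:
  assumes e: "\<And>s n. computes (G s) e [n] (r s n)" and G: "\<And>n. locally_const (\<lambda>s. G s n)"
  shows "locally_const (\<lambda>s. r s n)"
  unfolding locally_const_def
proof
  fix s
  obtain N where N: "\<And>q. agree N (G s) q \<Longrightarrow> computes q e [n] (r s n)"
    using computes_use[OF e] by blast
  obtain M where M: "\<And>t. agree M s t \<Longrightarrow> agree N (G s) (G t)"
    using locally_const_agree[of G, OF G] by blast
  have "\<forall>t. agree M s t \<longrightarrow> r t n = r s n"
    by (intro allI impI computes_deterministic[OF e N] M)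
  then show "\<exists>M. \<forall>t. agree M s t \<longrightarrow> r t n = r s n" ..
qed

lemma locally_const_closed:
  assumes "\<And>i. locally_const (P i)" "\<And>n. \<exists>t. (\<forall>i. P i t) \<and> agree n s t"
  shows "P i s"
  using assms unfolding locally_const_def by metis

lemma locally_const_pair:
  assumes "\<And>n. locally_const (\<lambda>s. F s n)" "\<And>n. locally_const (\<lambda>s. G s n)"
  shows "locally_const (\<lambda>s. baire_pair (F s) (G s) n)"
  unfolding baire_pair_def using assms by (cases "even n") simp_all

text \<open>A single point of Baire space carries countably many others, so that an input and all
  its witnesses can be packed into one \<open>s\<close>.\<close>

definition part :: "nat \<Rightarrow> baire \<Rightarrow> baire" where
  "part i s = (\<lambda>n. s (prod_encode (i, n)))"

lemma locally_const_part: "locally_const (\<lambda>s. part i s n)"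
  unfolding part_def by (rule locally_const_nth)

lemma ex_part: "\<exists>s. \<forall>i. part i s = f i"
  by (rule exI[of _ "\<lambda>k. f (pfst k) (psnd k)"]) (simp add: part_def)

section \<open>Copies of ordinals\<close>

lemma ordinal_copies_iff: "X \<in> ordinal_copies \<longleftrightarrow> lin_ord X \<and> wf (snd X)"
  by (cases X) (auto simp: ordinal_copies_def lin_ord_def)

text \<open>The first conjunct keeps only the numbers that are codes of rationals, on which
  \<open>from_nat\<close> is injective.\<close>

definition in_copy :: "rat set \<Rightarrow> nat \<Rightarrow> bool" where
  "in_copy A n \<longleftrightarrow> to_nat (from_nat n :: rat) = n \<and> from_nat n \<in> A"

definition copy :: "rat set \<Rightarrow> nat lin" where
  "copy A = ({n. in_copy A n},
     {(m, n). in_copy A m \<and> in_copy A n \<and> from_nat m < (from_nat n :: rat)})"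

definition copy_name :: "rat set \<Rightarrow> baire" where
  "copy_name A = baire_pair (\<lambda>n. if in_copy A n then 1 else 0)
     (\<lambda>k. if (pfst k, psnd k) \<in> snd (copy A) then 1 else 0)"

lemma in_copy_to_nat [simp]: "in_copy A (to_nat r) \<longleftrightarrow> r \<in> A"
  by (simp add: in_copy_def)

lemma copy_type: "same_order_type (rat_lin A) (copy A)"
  unfolding same_order_type_def
proof (intro exI conjI)
  show "bij_betw to_nat (fst (rat_lin A)) (fst (copy A))"
    by (rule bij_betw_byWitness[where f' = from_nat]) (auto simp: copy_def in_copy_def)
qed (simp add: copy_def)

lemma lin_ord_copy: "lin_ord (copy A)"
  by (rule lin_ord_same_order_type[OF copy_type lin_ord_rat_lin]) (auto simp: copy_def)

lemma copy_ordinal: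
  assumes "wf (snd (rat_lin A))" shows "copy A \<in> ordinal_copies"
proof -
  have "snd (copy A) \<subseteq> fst (copy A) \<times> fst (copy A)" by (auto simp: copy_def)
  then have "wf (snd (copy A))"
    by (rule wf_same_order_type[OF same_order_type_sym[OF copy_type] assms])
  then show ?thesis by (simp add: ordinal_copies_iff lin_ord_copy)
qed

lemma ordinal_rep_copy_name:
  assumes "wf (snd (rat_lin A))" shows "ordinal_rep (copy_name A) = Some (copy A)"
proof -
  have "decode_set (baire_fst (copy_name A)) = fst (copy A)"
    by (auto simp: decode_set_def copy_name_def copy_def)
  moreover have "decode_rel (baire_snd (copy_name A)) = snd (copy A)"
    by (auto simp: decode_rel_def copy_name_def split: if_splits)
  ultimately show ?thesis using copy_ordinal[OF assms] by (simp add: ordinal_rep_def)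
qed

lemma ordinal_subset_rat:
  assumes "X \<in> ordinal_copies" "dense_lin (rat_lin D)"
  shows "\<exists>A\<subseteq>D. same_order_type X (rat_lin A) \<and> wf (snd (rat_lin A))"
proof -
  have X: "lin_ord X" "wf (snd X)" using assms(1) by (simp_all add: ordinal_copies_iff)
  obtain A where A: "A \<subseteq> D" "same_order_type X (rat_lin A)"
    using countable_embeds_in_dense[OF X(1) countableI_type assms(2)] by blast
  have "wf (snd (rat_lin A))"
    by (rule wf_same_order_type[OF same_order_type_sym[OF A(2)] X(2)]) auto
  with A show ?thesis by blast
qed

definition rat_set :: "baire \<Rightarrow> rat set" where
  "rat_set s = {r. s (to_nat r) \<noteq> 0}"

lemma ex_rat_set: "\<exists>s. rat_set s = A"
  by (rule exI[of _ "\<lambda>n. if from_nat n \<in> A then 1 else 0"]) (simp add: rat_set_def)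

lemma locally_const_rat_set: "locally_const (\<lambda>s. r \<in> rat_set s)"
  unfolding rat_set_def mem_Collect_eq by (rule locally_const_comp) (rule locally_const_nth)

lemma locally_const_in_copy:
  assumes "\<And>r. locally_const (\<lambda>s. r \<in> A s)" shows "locally_const (\<lambda>s. in_copy (A s) n)"
  unfolding in_copy_def using assms by (rule locally_const_comp)

lemma locally_const_copy_name:
  assumes "\<And>r. locally_const (\<lambda>s. r \<in> A s)" shows "locally_const (\<lambda>s. copy_name (A s) n)"
  unfolding copy_name_def
proof (rule locally_const_pair)
  have "locally_const (\<lambda>s. in_copy (A s) (pfst n) \<and> in_copy (A s) (psnd n) \<and>
      from_nat (pfst n) < (from_nat (psnd n) :: rat))" for n
    by (rule locally_const_comp2[of _ "\<lambda>s. in_copy (A s) (psnd n)"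
          "\<lambda>a b. a \<and> b \<and> from_nat (pfst n) < (from_nat (psnd n) :: rat)"])
      (rule locally_const_in_copy[OF assms])+
  then show "locally_const (\<lambda>s. if (pfst n, psnd n) \<in> snd (copy (A s)) then 1 else 0 :: nat)" for n
    unfolding copy_def snd_conv mem_Collect_eq split by (rule locally_const_comp)
  show "locally_const (\<lambda>s. if in_copy (A s) n then 1 else 0 :: nat)" for n
    using locally_const_in_copy[OF assms] by (rule locally_const_comp)
qed

text \<open>Entry \<open>i\<close> of the name asks only about codes at most \<open>i div 2\<close>,
  since the components of a pair do not exceed its code.\<close>

lemma agree_copy_name:
  assumes "\<And>r. to_nat r < N \<Longrightarrow> r \<in> A \<longleftrightarrow> r \<in> B"
  shows "agree N (copy_name A) (copy_name B)"
  unfolding agree_def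
proof (intro allI impI)
  fix i assume i: "i < N"
  have eq: "in_copy A n \<longleftrightarrow> in_copy B n" if "n < N" for n
    using assms[of "from_nat n"] that by (auto simp: in_copy_def)
  have "pfst k \<le> k" "psnd k \<le> k" for k
    using le_prod_encode_1[of "pfst k" "psnd k"] le_prod_encode_2[of "psnd k" "pfst k"] by simp_all
  moreover have "i div 2 < N" using i by simp
  ultimately have "in_copy A (i div 2) = in_copy B (i div 2)"
    "in_copy A (pfst (i div 2)) = in_copy B (pfst (i div 2))"
    "in_copy A (psnd (i div 2)) = in_copy B (psnd (i div 2))"
    by (meson eq le_less_trans)+
  then show "copy_name A i = copy_name B i"
    by (simp add: copy_name_def baire_pair_def copy_def)
qed

section \<open>Names of ordered groups\<close>

text \<open>The decoded record need not equal \<open>G\<close>: its operation is undefined outside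
  the universe and its unit is found by description. Carrier, order and products of elements agree,
  which suffices for the group laws and the order type.\<close>

lemma ord_grp_rep_name:
  assumes G: "ordered_group G"
    and set: "decode_set (baire_fst p) = carrier G"
    and mult: "\<And>a b. a \<in> carrier G \<Longrightarrow> b \<in> carrier G \<Longrightarrow>
      baire_fst (baire_snd p) (prod_encode (a, b)) = mult G a b"
    and rel: "decode_rel (baire_snd (baire_snd p)) = le_rel G"
  shows "ord_grp_rep p = Some (decode_grp p)" "order_of (decode_grp p) = order_of G"
proof -
  interpret ordered_group G by fact
  let ?H = "decode_grp p"
  have c: "carrier ?H = carrier G" by (simp add: decode_grp_def set Let_def)
  have l: "le_rel ?H = le_rel G" by (simp add: decode_grp_def Let_def rel)
  have m: "mult ?H a b = mult G a b" if "a \<in> carrier G" "b \<in> carrier G" for a b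
    using that mult by (simp add: decode_grp_def set Let_def)
  have "one ?H = (THE e. e \<in> carrier G \<and> (\<forall>a\<in>carrier G. mult ?H e a = a \<and> mult ?H a e = a))"
    by (simp add: decode_grp_def set Let_def)
  also have "\<dots> = one G"
    by (rule the_equality) (auto simp: m intro: one_unique)
  finally have o: "one ?H = one G" .
  have "group ?H"
    by (rule groupI) (auto simp: c m o m_assoc intro: l_inv_ex)
  moreover have cl: "a \<in> carrier G \<and> b \<in> carrier G" if "(a, b) \<in> le_rel G" for a b
    using that linear_order by (auto simp: order_on_defs)
  have "ordered_group_axioms ?H"
    using linear_order mult_right_mono mult_left_mono cl
    by (auto simp: ordered_group_axioms_def c l) (metis cl m)+
  ultimately show "ord_grp_rep p = Some ?H" by (simp add: ordered_group_def ord_grp_rep_def)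
  show "order_of ?H = order_of G" by (simp add: order_of_def c l)
qed

lemma linear_order_on_lin_ord:
  assumes X: "lin_ord X" and R: "R = snd X \<union> Id_on (fst X)" and A: "A = fst X"
  shows "linear_order_on A R" "R - Id = snd X"
proof -
  show "linear_order_on A R"
    unfolding linear_order_on_def partial_order_on_def preorder_on_def A R
  proof (intro conjI)
    show "trans (snd X \<union> Id_on (fst X))" using lin_ord_trans[OF X] unfolding trans_def by blast
    show "antisym (snd X \<union> Id_on (fst X))" using lin_ord_asym[OF X] unfolding antisym_def by blast
    show "total_on (fst X) (snd X \<union> Id_on (fst X))" using lin_ord_total[OF X] unfolding total_on_def by blast
  qed (use lin_ord_mem[OF X] in \<open>auto simp: refl_on_def\<close>)
  show "R - Id = snd X" using lin_ord_irrefl[OF X] unfolding R by blast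
qed

text \<open>The groups \<open>\<int>\<^sup>A\<close> for sets of rationals \<open>A\<close> are subgroups of a single group, so that a name
  depends continuously on \<open>A\<close>.\<close>

definition enc :: "(rat \<Rightarrow> int) \<Rightarrow> nat" where
  "enc = to_nat_on (fin_supp UNIV)"

definition dec :: "nat \<Rightarrow> rat \<Rightarrow> int" where
  "dec = from_nat_into (fin_supp UNIV)"

lemma dec_enc: "f \<in> fin_supp A \<Longrightarrow> dec (enc f) = f"
  unfolding dec_def enc_def
  by (rule from_nat_into_to_nat_on) (auto intro: countable_fin_supp fin_supp_mono)

lemma dec_fin_supp: "dec n \<in> fin_supp UNIV"
  unfolding dec_def by (rule from_nat_into) (use fin_supp_zero in blast)

definition codes :: "rat set \<Rightarrow> nat \<Rightarrow> bool" where
  "codes A n \<longleftrightarrow> dec n \<in> fin_supp A \<and> enc (dec n) = n"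

lemma codes_enc: "f \<in> fin_supp A \<Longrightarrow> codes A (enc f)"
  by (simp add: codes_def dec_enc)

definition Z_rel :: "(rat \<Rightarrow> int) rel" where
  "Z_rel = snd (Z_pow (rat_lin UNIV))"

text \<open>Functions supported in \<open>A\<close> can only differ in \<open>A\<close>, so the
  order of the large group restricts to that of the power over \<open>A\<close>.\<close>

lemma Z_rel_iff:
  assumes "f \<in> fin_supp A" "g \<in> fin_supp A"
  shows "(f, g) \<in> Z_rel \<longleftrightarrow> (f, g) \<in> snd (Z_pow (rat_lin A))"
proof -
  have "f \<in> fin_supp UNIV" "g \<in> fin_supp UNIV" using assms by (auto intro: fin_supp_mono)
  moreover have eq: "f x = g x" if "x \<notin> A" for x
    using that assms fin_supp_outside[of f A x] fin_supp_outside[of g A x] by simp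
  have "(\<exists>x\<in>UNIV. f x < g x \<and> (\<forall>y. x < y \<longrightarrow> f y = g y)) \<longleftrightarrow>
    (\<exists>x\<in>A. f x < g x \<and> (\<forall>y. x \<in> A \<and> y \<in> A \<and> x < y \<longrightarrow> f y = g y))"
  proof
    assume "\<exists>x\<in>UNIV. f x < g x \<and> (\<forall>y. x < y \<longrightarrow> f y = g y)"
    then obtain x where x: "f x < g x" "\<forall>y. x < y \<longrightarrow> f y = g y" by blast
    then have "x \<in> A" using eq[of x] by force
    with x show "\<exists>x\<in>A. f x < g x \<and> (\<forall>y. x \<in> A \<and> y \<in> A \<and> x < y \<longrightarrow> f y = g y)" by blast
  qed (use eq in blast)
  ultimately show ?thesis
    using assms by (simp add: Z_rel_def Z_pow_less[OF lin_ord_rat_lin])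
qed

text \<open>The operation is the same for all \<open>A\<close>, and the other entries ask only
  whether finitely many rationals, those in the support of one or two functions, belong to
  \<open>A\<close>.\<close>

definition Z_name :: "rat set \<Rightarrow> baire" where
  "Z_name A = baire_pair (\<lambda>n. if codes A n then 1 else 0)
     (baire_pair (\<lambda>k. enc (\<lambda>x. dec (pfst k) x + dec (psnd k) x))
       (\<lambda>k. if codes A (pfst k) \<and> codes A (psnd k) \<and>
          (pfst k = psnd k \<or> (dec (pfst k), dec (psnd k)) \<in> Z_rel) then 1 else 0))"

definition Z_grp :: "rat set \<Rightarrow> nat ord_grp" where
  "Z_grp A = \<lparr>carrier = {n. codes A n}, mult = (\<lambda>a b. enc (\<lambda>x. dec a x + dec b x)),
     one = enc (\<lambda>x. 0),
     le_rel = {(a, b). codes A a \<and> codes A b \<and> (a = b \<or> (dec a, dec b) \<in> Z_rel)}\<rparr>"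

lemma dec_mult:
  "codes A a \<Longrightarrow> codes A b \<Longrightarrow> dec (enc (\<lambda>x. dec a x + dec b x)) = (\<lambda>x. dec a x + dec b x)"
  by (rule dec_enc[OF fin_supp_add]) (auto simp: codes_def)

lemma codes_mult: "codes A a \<Longrightarrow> codes A b \<Longrightarrow> codes A (enc (\<lambda>x. dec a x + dec b x))"
  by (rule codes_enc[OF fin_supp_add]) (auto simp: codes_def)

lemma Z_rel_add: 
  assumes "(f, g) \<in> Z_rel" "h \<in> fin_supp UNIV"
  shows "((\<lambda>x. f x + h x), (\<lambda>x. g x + h x)) \<in> Z_rel" "((\<lambda>x. h x + f x), (\<lambda>x. h x + g x)) \<in> Z_rel"
  using assms by (auto simp: Z_rel_def Z_pow_less[OF lin_ord_rat_lin] intro: fin_supp_add)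

lemma order_type_codes:
  fixes A :: "rat set"
  defines "X \<equiv> ({n. codes A n}, {(a, b). codes A a \<and> codes A b \<and> (dec a, dec b) \<in> Z_rel})"
  shows "same_order_type X (Z_pow (rat_lin A))" "lin_ord X"
proof -
  have mem: "dec a \<in> fin_supp A" if "codes A a" for a using that by (simp add: codes_def)
  show type: "same_order_type X (Z_pow (rat_lin A))"
    unfolding same_order_type_def
  proof (intro exI conjI)
    show "bij_betw dec (fst X) (fst (Z_pow (rat_lin A)))"
      by (rule bij_betw_byWitness[where f' = enc])
        (auto simp: X_def codes_def dec_enc)
  qed (simp add: X_def Z_rel_iff[OF mem mem])
  show "lin_ord X"
    by (rule lin_ord_same_order_type[OF same_order_type_sym[OF type] lin_ord_Z_pow[OF lin_ord_rat_lin]])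
      (auto simp: X_def)
qed

lemma ordered_group_Z_grp: "ordered_group (Z_grp A)"
proof -
  note simps = Z_grp_def dec_mult codes_mult
  have enc_dec: "enc (dec a) = a" if "codes A a" for a using that by (simp add: codes_def)
  have mem: "dec a \<in> fin_supp A" "dec a \<in> fin_supp UNIV" if "codes A a" for a
    using that dec_fin_supp by (simp_all add: codes_def)
  have "group (Z_grp A)"
  proof (rule groupI)
    show "x \<otimes>\<^bsub>Z_grp A\<^esub> y \<otimes>\<^bsub>Z_grp A\<^esub> z = x \<otimes>\<^bsub>Z_grp A\<^esub> (y \<otimes>\<^bsub>Z_grp A\<^esub> z)"
      if "x \<in> carrier (Z_grp A)" "y \<in> carrier (Z_grp A)" "z \<in> carrier (Z_grp A)" for x y z
      using that by (simp add: Z_grp_def dec_mult[of A] add.assoc)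
    show "\<exists>y\<in>carrier (Z_grp A). y \<otimes>\<^bsub>Z_grp A\<^esub> x = \<one>\<^bsub>Z_grp A\<^esub>" if "x \<in> carrier (Z_grp A)" for x
    proof -
      have u: "(\<lambda>y. - dec x y) \<in> fin_supp A" using that mem by (simp add: Z_grp_def fin_supp_uminus)
      show ?thesis by (rule bexI[of _ "enc (\<lambda>y. - dec x y)"])
          (simp_all add: Z_grp_def codes_enc[OF u] dec_enc[OF u])
    qed
  qed (auto simp: Z_grp_def codes_mult codes_enc fin_supp_zero dec_enc[OF fin_supp_zero[of A]] enc_dec)
  moreover have "ordered_group_axioms (Z_grp A)"
  proof
    show "linear_order_on (carrier (Z_grp A)) (le_rel (Z_grp A))"
      by (rule linear_order_on_lin_ord(1)[OF order_type_codes(2)[of A]]) (auto simp: Z_grp_def)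
    show "(a \<otimes>\<^bsub>Z_grp A\<^esub> g, b \<otimes>\<^bsub>Z_grp A\<^esub> g) \<in> le_rel (Z_grp A)"
      "(g \<otimes>\<^bsub>Z_grp A\<^esub> a, g \<otimes>\<^bsub>Z_grp A\<^esub> b) \<in> le_rel (Z_grp A)"
      if "(a, b) \<in> le_rel (Z_grp A)" "g \<in> carrier (Z_grp A)" for a b g
      using that Z_rel_add[OF _ dec_fin_supp[of g], of "dec a" "dec b"]
      by (auto simp: Z_grp_def codes_mult dec_mult[of A])
  qed
  ultimately show ?thesis by (simp add: ordered_group_def)
qed

lemma Z_name:
  shows "ord_grp_rep (Z_name A) = Some (decode_grp (Z_name A))"
    and "same_order_type (order_of (decode_grp (Z_name A))) (Z_pow (rat_lin A))"
proof -
  have "decode_set (baire_fst (Z_name A)) = carrier (Z_grp A)"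
    by (auto simp: decode_set_def Z_name_def Z_grp_def)
  moreover have "decode_rel (baire_snd (baire_snd (Z_name A))) = le_rel (Z_grp A)"
    by (auto simp: decode_rel_def Z_name_def Z_grp_def split: if_splits)
  moreover have "baire_fst (baire_snd (Z_name A)) (prod_encode (a, b)) = mult (Z_grp A) a b" for a b
    by (simp add: Z_name_def Z_grp_def)
  ultimately have name: "ord_grp_rep (Z_name A) = Some (decode_grp (Z_name A))"
    "order_of (decode_grp (Z_name A)) = order_of (Z_grp A)"
    using ord_grp_rep_name[OF ordered_group_Z_grp, of "Z_name A" A] by simp_all
  show "ord_grp_rep (Z_name A) = Some (decode_grp (Z_name A))" by (fact name(1))
  have "le_rel (Z_grp A) - Id = snd ({n. codes A n}, {(a, b). codes A a \<and> codes A b \<and> (dec a, dec b) \<in> Z_rel})"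
    by (rule linear_order_on_lin_ord(2)[OF order_type_codes(2) _ refl]) (auto simp: Z_grp_def)
  then have "order_of (Z_grp A) = ({n. codes A n}, {(a, b). codes A a \<and> codes A b \<and> (dec a, dec b) \<in> Z_rel})"
    by (simp add: order_of_def Z_grp_def)
  then show "same_order_type (order_of (decode_grp (Z_name A))) (Z_pow (rat_lin A))"
    using order_type_codes(1) name(2) by simp
qed

lemma locally_const_codes:
  assumes "\<And>r. locally_const (\<lambda>s. r \<in> A s)" shows "locally_const (\<lambda>s. codes (A s) n)"
proof -
  have fin: "finite {x. dec n x \<noteq> 0}" using dec_fin_supp[of n] by (simp add: fin_supp_def)
  have "locally_const (\<lambda>s. \<forall>x\<in>{x. dec n x \<noteq> 0}. x \<in> A s)"
    by (rule locally_const_ball[OF fin assms])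
  then have "locally_const (\<lambda>s. (\<forall>x\<in>{x. dec n x \<noteq> 0}. x \<in> A s) \<and> enc (dec n) = n)"
    by (rule locally_const_comp)
  moreover have "codes B n \<longleftrightarrow> (\<forall>x\<in>{x. dec n x \<noteq> 0}. x \<in> B) \<and> enc (dec n) = n" for B
    using fin by (auto simp: codes_def fin_supp_def)
  ultimately show ?thesis by simp
qed

lemma locally_const_Z_name:
  assumes "\<And>r. locally_const (\<lambda>s. r \<in> A s)" shows "locally_const (\<lambda>s. Z_name (A s) n)"
  unfolding Z_name_def
proof (intro locally_const_pair locally_const_const)
  show "locally_const (\<lambda>s. if codes (A s) n then 1 else 0 :: nat)" for n
    using locally_const_codes[OF assms] by (rule locally_const_comp)
  show "locally_const (\<lambda>s. if codes (A s) (pfst k) \<and> codes (A s) (psnd k) \<and>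
          (pfst k = psnd k \<or> (dec (pfst k), dec (psnd k)) \<in> Z_rel) then 1 else 0 :: nat)" for k
    by (rule locally_const_comp2[of _ _ "\<lambda>a b. if a \<and> b \<and> (pfst k = psnd k \<or> (dec (pfst k), dec (psnd k)) \<in> Z_rel) then 1 else 0"])
      (rule locally_const_codes[OF assms])+
qed

section \<open>Types of the groups\<close>

lemma Z_pow_type_wf:
  "same_order_type (Z_pow X) (lin_prod (Z_pow X) (q_pow 0))"
  unfolding q_pow_def using same_order_type_sym[OF lin_prod_singleton] by simp

text \<open>Splitting at \<open>I\<close> leaves as upper factor the power over
  \<open>A - I\<close>. This set has no least element, so the factor is countable and dense and
  becomes \<open>\<rat>\<close> by Cantor's theorem.\<close>

lemma Z_pow_type_ill:
  assumes I: "initial_seg (rat_lin A) I" and ne: "A - I \<noteq> {}"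
    and least: "\<And>a. a \<in> A - I \<Longrightarrow> \<exists>b\<in>A - I. b < a"
  shows "same_order_type (Z_pow (rat_lin A)) (lin_prod (Z_pow (rat_lin I)) (q_pow 1))"
proof -
  have IA: "A \<inter> I = I" using I by (auto simp: initial_seg_def)
  have r: "restr (rat_lin A) I = rat_lin I" "restr (rat_lin A) (- I) = rat_lin (A - I)"
    using IA by (auto simp: restr_def rat_lin_def)
  have "dense_lin (Z_pow (rat_lin (A - I)))"
    by (rule dense_Z_pow[OF lin_ord_rat_lin]) (use ne least in auto)
  then have "same_order_type (Z_pow (rat_lin (A - I))) (q_pow 1)"
    using Cantor_isomorphism dense_rat_lin_ray(1) by (simp add: q_pow_def)
  then have "same_order_type (lin_prod (Z_pow (rat_lin I)) (Z_pow (rat_lin (A - I))))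
      (lin_prod (Z_pow (rat_lin I)) (q_pow 1))"
    by (rule lin_prod_cong[OF same_order_type_refl])
  with Z_pow_split[OF lin_ord_rat_lin I] show ?thesis
    unfolding r by (rule same_order_type_trans)
qed

text \<open>\<open>I\<close> is the well-founded part of \<open>A\<close>. A least element of the
  complement would have only accessible predecessors and so be accessible itself.\<close>

lemma ill_founded_split:
  assumes "\<not> wf (snd (rat_lin A))"
  shows "\<exists>I. initial_seg (rat_lin A) I \<and> wf (snd (rat_lin I)) \<and> A - I \<noteq> {} \<and>
    (\<forall>a\<in>A - I. \<exists>b\<in>A - I. b < a)"
proof -
  define I where "I = A \<inter> Wellfounded.acc (snd (rat_lin A))"
  have "initial_seg (rat_lin A) I"
    unfolding initial_seg_def I_def by (auto intro: acc_downward)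
  moreover have "wf (snd (rat_lin I))"
  proof (rule acc_wfI, rule allI)
    have sub: "snd (rat_lin I) \<subseteq> snd (rat_lin A)" by (auto simp: I_def)
    have I: "x \<in> Wellfounded.acc (snd (rat_lin I))" if "x \<in> I" for x
      using that acc_subset[OF sub] by (auto simp: I_def)
    show "x \<in> Wellfounded.acc (snd (rat_lin I))" for x
      using I by (rule accI) auto
  qed
  moreover have "A - I \<noteq> {}"
  proof
    assume "A - I = {}"
    then have A: "x \<in> Wellfounded.acc (snd (rat_lin A))" if "x \<in> A" for x using that by (auto simp: I_def)
    have "x \<in> Wellfounded.acc (snd (rat_lin A))" for x
      using A by (rule accI) auto
    then show False using assms acc_wfI by blast
  qed
  moreover have "\<exists>b\<in>A - I. b < a" if a: "a \<in> A - I" for a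
  proof (rule ccontr)
    assume none: "\<not> (\<exists>b\<in>A - I. b < a)"
    have "a \<in> Wellfounded.acc (snd (rat_lin A))"
    proof (rule accI)
      fix y assume "(y, a) \<in> snd (rat_lin A)"
      then have "y \<in> I" using none by auto
      then show "y \<in> Wellfounded.acc (snd (rat_lin A))" by (simp add: I_def)
    qed
    then show False using a by (simp add: I_def)
  qed
  ultimately show ?thesis by blast
qed

lemma Z_pow_type:
  "\<exists>I \<epsilon>. I \<subseteq> A \<and> wf (snd (rat_lin I)) \<and> \<epsilon> \<in> {0, 1} \<and> (\<epsilon> = 0 \<longleftrightarrow> wf (snd (rat_lin A))) \<and>
    same_order_type (Z_pow (rat_lin A)) (lin_prod (Z_pow (rat_lin I)) (q_pow \<epsilon>))"
proof (cases "wf (snd (rat_lin A))")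
  case True
  then show ?thesis
    using Z_pow_type_wf[of "rat_lin A"] by (intro exI[of _ A] exI[of _ 0]) simp
next
  case False
  obtain I where I: "initial_seg (rat_lin A) I" "wf (snd (rat_lin I))" "A - I \<noteq> {}"
    "\<forall>a\<in>A - I. \<exists>b\<in>A - I. b < a" using ill_founded_split[OF False] by (elim exE conjE) (rule that)
  have "same_order_type (Z_pow (rat_lin A)) (lin_prod (Z_pow (rat_lin I)) (q_pow 1))"
    by (rule Z_pow_type_ill) (use I in auto)
  moreover have "I \<subseteq> A" using I(1) by (simp add: initial_seg_def)
  ultimately show ?thesis using I(2) False by (intro exI[of _ I] exI[of _ 1]) simp
qed

text \<open>For ill-founded \<open>A\<close> the type has bit \<open>1\<close> by
  \<open>Z_pow_type\<close>, and the bit is unique.\<close>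

lemma wf_exponent:
  assumes "same_order_type (Z_pow (rat_lin A)) (lin_prod (Z_pow X) (q_pow 0))" "lin_ord X" "wf (snd X)"
  shows "wf (snd (rat_lin A))"
proof -
  obtain I \<epsilon> where I: "wf (snd (rat_lin I))" "\<epsilon> \<in> {0, 1}" "\<epsilon> = 0 \<longleftrightarrow> wf (snd (rat_lin A))"
    "same_order_type (Z_pow (rat_lin A)) (lin_prod (Z_pow (rat_lin I)) (q_pow \<epsilon>))"
    using Z_pow_type[of A] by (elim exE conjE) (rule that)
  have "same_order_type (lin_prod (Z_pow X) (q_pow 0)) (lin_prod (Z_pow (rat_lin I)) (q_pow \<epsilon>))"
    using same_order_type_trans[OF same_order_type_sym[OF assms(1)] I(4)] .
  then have "0 = \<epsilon>"
    using type_unique[OF assms(2,3) lin_ord_rat_lin I(1) _ I(2)] by simp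
  then show ?thesis using I(3) by simp
qed

section \<open>A computable dense ordered group\<close>

text \<open>The group \<open>\<int>[\<surd>2]\<close>: the number \<open>(a - b) + (c - d) \<surd>2\<close> is coded by the quadruple \<open>a, b, c, d\<close>
  of natural numbers, where \<open>a\<close> or \<open>b\<close> is zero and \<open>c\<close> or \<open>d\<close> is zero.\<close>

definition quad :: "nat \<Rightarrow> nat \<Rightarrow> nat \<Rightarrow> nat \<Rightarrow> nat" where
  "quad a b c d = prod_encode (prod_encode (a, b), prod_encode (c, d))"

definition qa where "qa h = pfst (pfst h)"
definition qb where "qb h = psnd (pfst h)"
definition qc where "qc h = pfst (psnd h)"
definition qd where "qd h = psnd (psnd h)"

lemma quad_sel [simp]: "qa (quad a b c d) = a" "qb (quad a b c d) = b" "qc (quad a b c d) = c" "qd (quad a b c d) = d"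
  by (simp_all add: quad_def qa_def qb_def qc_def qd_def)

lemma quad_eq: "quad (qa h) (qb h) (qc h) (qd h) = h"
  by (simp add: quad_def qa_def qb_def qc_def qd_def)

text \<open>The two sign conditions in one arithmetic equation: a sum of products of natural numbers
  vanishes only if both products do.\<close>

definition surd :: "nat set" where
  "surd = {h. qa h * qb h + qc h * qd h = 0}"

definition surd_val :: "nat \<Rightarrow> real" where
  "surd_val h = (real (qa h) - real (qb h)) + (real (qc h) - real (qd h)) * sqrt 2"

text \<open>Of the two opposite truncated differences at least one is zero, so each pair of entries
  is again in normal form.\<close>

definition surd_add :: "nat \<Rightarrow> nat \<Rightarrow> nat" where
  "surd_add h k = quad ((qa h + qa k) - (qb h + qb k)) ((qb h + qb k) - (qa h + qa k))
     ((qc h + qc k) - (qd h + qd k)) ((qd h + qd k) - (qc h + qc k))"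

text \<open>Positive exactly if \<open>h < k\<close>: by the sign conditions, \<open>v - u + (w - z) \<surd>2 > 0\<close> is equivalent to
  \<open>u\<^sup>2 + 2 z\<^sup>2 < v\<^sup>2 + 2 w\<^sup>2\<close>.\<close>

definition surd_less :: "nat \<Rightarrow> nat \<Rightarrow> nat" where
  "surd_less h k =
    (let u = (qa h + qb k) - (qa k + qb h); v = (qa k + qb h) - (qa h + qb k);
         w = (qc k + qd h) - (qc h + qd k); z = (qc h + qd k) - (qc k + qd h)
     in (v * v + 2 * (w * w)) - (u * u + 2 * (z * z)))"

lemma less_iff_square: "0 \<le> x \<Longrightarrow> 0 \<le> y \<Longrightarrow> x < y \<longleftrightarrow> x * x < y * (y :: real)"
  using power_mono_iff[of y x 2] by (auto simp: power2_eq_square not_le[symmetric])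

lemma sqrt2_compare:
  fixes u v w z :: nat
  assumes "u = 0 \<or> v = 0" "w = 0 \<or> z = 0"
  shows "0 < real v - real u + (real w - real z) * sqrt 2 \<longleftrightarrow> u * u + 2 * (z * z) < v * v + 2 * (w * w)"
proof -
  have s: "sqrt 2 * sqrt 2 = 2" by simp
  have sq: "(real n * sqrt 2) * (real n * sqrt 2) = 2 * (real n * real n)" for n
    using s by (simp add: mult.commute mult.left_commute)
  have cast: "real (m * m) < 2 * real (n * n) \<longleftrightarrow> m * m < 2 * (n * n)"
    "2 * real (n * n) < real (m * m) \<longleftrightarrow> 2 * (n * n) < m * m" for m n
    by (metis of_nat_less_iff of_nat_mult of_nat_numeral)+
  \<comment> \<open>The rational and the irrational term have equal signs in the outer two cases,
    where the claim is evident, and compete in the middle two, where squaring decides.\<close>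
  consider "u = 0" "z = 0" | "u = 0" "w = 0" "z > 0" | "v = 0" "z = 0" "u > 0" | "v = 0" "w = 0" "u > 0" "z > 0"
    using assms by auto
  then show ?thesis
  proof cases
    case 1
    have "0 < real v + real w * sqrt 2 \<longleftrightarrow> v > 0 \<or> w > 0"
      by (cases "v = 0"; cases "w = 0") (auto intro: add_pos_pos)
    then show ?thesis using 1 by auto
  next
    case 2
    have "real z * sqrt 2 < real v \<longleftrightarrow> 2 * (z * z) < v * v"
      using less_iff_square[of "real z * sqrt 2" "real v"] cast(2)[of z v] by (simp add: sq)
    then show ?thesis using 2 by simp
  next
    case 3
    have "real u < real w * sqrt 2 \<longleftrightarrow> u * u < 2 * (w * w)"
      using less_iff_square[of "real u" "real w * sqrt 2"] cast(1)[of u w] by (simp add: sq)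
    then show ?thesis using 3 by simp
  next
    case 4
    have "0 < real u + real z * sqrt 2" using 4 by (intro add_pos_pos) auto
    then have "\<not> 0 < - real u + (0 - real z) * sqrt 2" by (simp add: algebra_simps)
    then show ?thesis using 4 by simp
  qed
qed

lemma surd_less_iff: "surd_less h k > 0 \<longleftrightarrow> surd_val h < surd_val k"
proof -
  define u where "u = (qa h + qb k) - (qa k + qb h)"
  define v where "v = (qa k + qb h) - (qa h + qb k)"
  define w where "w = (qc k + qd h) - (qc h + qd k)"
  define z where "z = (qc h + qd k) - (qc k + qd h)"
  have "real v - real u = (real (qa k) - real (qb k)) - (real (qa h) - real (qb h))"
    unfolding u_def v_def by (cases "qa h + qb k \<le> qa k + qb h") (auto simp: of_nat_diff)
  moreover have "real w - real z = (real (qc k) - real (qd k)) - (real (qc h) - real (qd h))"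
    unfolding w_def z_def by (cases "qc h + qd k \<le> qc k + qd h") (auto simp: of_nat_diff)
  ultimately have "real v - real u + (real w - real z) * sqrt 2 = surd_val k - surd_val h"
    unfolding surd_val_def by (simp only:) (simp add: algebra_simps)
  moreover have "u = 0 \<or> v = 0" "w = 0 \<or> z = 0" by (auto simp: u_def v_def w_def z_def)
  ultimately have "surd_val h < surd_val k \<longleftrightarrow> u * u + 2 * (z * z) < v * v + 2 * (w * w)"
    using sqrt2_compare[of u v w z] by simp
  then show ?thesis by (simp add: surd_less_def Let_def u_def v_def w_def z_def)
qed

text \<open>Infinite descent: \<open>a\<close> is even, say \<open>2 * r\<close>, and then
  \<open>b\<close> and \<open>r\<close> satisfy the same equation with \<open>b\<close> smaller than
  \<open>a\<close>.\<close>

lemma square_eq_double: "(a :: nat) * a = 2 * (b * b) \<Longrightarrow> b = 0"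
proof (induction a arbitrary: b rule: less_induct)
  case (less a)
  have "even (a * a)" using less.prems by simp
  then obtain r where r: "a = 2 * r" by auto
  then have "b * b = 2 * (r * r)" using less.prems by simp
  show ?case
  proof (rule ccontr)
    assume "b \<noteq> 0"
    have "b < a"
    proof (rule ccontr)
      assume "\<not> b < a"
      then have "a * a \<le> b * b" by (simp add: mult_le_mono)
      then show False using less.prems \<open>b \<noteq> 0\<close> by simp
    qed
    then have "r = 0" using less.IH \<open>b * b = _\<close> by blast
    then show False using \<open>b * b = _\<close> \<open>b \<noteq> 0\<close> by simp
  qed
qed

lemma sqrt2_independent:
  fixes p q :: int assumes "real_of_int p + real_of_int q * sqrt 2 = 0" shows "p = 0 \<and> q = 0"
proof -
  have "real_of_int p = - (real_of_int q * sqrt 2)" using assms by simp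
  then have "real_of_int p * real_of_int p = 2 * (real_of_int q * real_of_int q)"
    by (simp add: mult.commute mult.left_commute)
  then have "p * p = 2 * (q * q)" by (metis of_int_eq_iff of_int_mult of_int_numeral)
  then have "nat \<bar>p\<bar> * nat \<bar>p\<bar> = 2 * (nat \<bar>q\<bar> * nat \<bar>q\<bar>)"
    by (metis abs_mult abs_mult_self_eq nat_mult_distrib abs_ge_zero nat_numeral zero_le_numeral)
  then have "nat \<bar>q\<bar> = 0" by (rule square_eq_double)
  then show ?thesis using assms by simp
qed

lemma nat_diff_unique:
  fixes a b c d :: nat
  assumes "a = 0 \<or> b = 0" "c = 0 \<or> d = 0" "int a - int b = int c - int d" shows "a = c \<and> b = d"
  using assms by presburger

lemma surd_val_inj:
  assumes h: "h \<in> surd" and k: "k \<in> surd" and eq: "surd_val h = surd_val k" shows "h = k"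
proof -
  have "real_of_int (int (qa h) - int (qb h) - (int (qa k) - int (qb k))) +
    real_of_int (int (qc h) - int (qd h) - (int (qc k) - int (qd k))) * sqrt 2 = 0"
    using eq by (simp add: surd_val_def algebra_simps)
  from sqrt2_independent[OF this]
  have ab: "int (qa h) - int (qb h) = int (qa k) - int (qb k)"
    and cd: "int (qc h) - int (qd h) = int (qc k) - int (qd k)" by auto
  have h': "qa h = 0 \<or> qb h = 0" "qc h = 0 \<or> qd h = 0" using h by (simp_all add: surd_def)
  have k': "qa k = 0 \<or> qb k = 0" "qc k = 0 \<or> qd k = 0" using k by (simp_all add: surd_def)
  have "quad (qa h) (qb h) (qc h) (qd h) = quad (qa k) (qb k) (qc k) (qd k)"
    by (simp only: nat_diff_unique[OF h'(1) k'(1) ab] nat_diff_unique[OF h'(2) k'(2) cd])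
  then show ?thesis unfolding quad_eq .
qed

lemma surd_surj: "\<exists>h\<in>surd. surd_val h = real_of_int p + real_of_int q * sqrt 2"
proof (rule bexI)
  have "real (nat p) - real (nat (- p)) = real_of_int p" for p by (cases "p \<ge> 0") auto
  then show "surd_val (quad (nat p) (nat (- p)) (nat q) (nat (- q))) = real_of_int p + real_of_int q * sqrt 2"
    by (simp add: surd_val_def)
  show "quad (nat p) (nat (- p)) (nat q) (nat (- q)) \<in> surd" by (auto simp: surd_def)
qed

lemma surd_val_int: "\<exists>p q. surd_val h = real_of_int p + real_of_int q * sqrt 2"
  by (rule exI[of _ "int (qa h) - int (qb h)"], rule exI[of _ "int (qc h) - int (qd h)"])
    (simp add: surd_val_def)

lemma surd_add: "surd_add h k \<in> surd" "surd_val (surd_add h k) = surd_val h + surd_val k"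
proof -
  show "surd_add h k \<in> surd" by (auto simp: surd_def surd_add_def)
  have diff: "real (m - n) - real (n - m) = real m - real n" for m n
    by (cases "m \<le> n") (auto simp: of_nat_diff)
  show "surd_val (surd_add h k) = surd_val h + surd_val k"
    unfolding surd_val_def surd_add_def quad_sel diff by (simp add: algebra_simps)
qed

definition surd_lin :: "nat lin" where
  "surd_lin = (surd, {(h, k). h \<in> surd \<and> k \<in> surd \<and> surd_val h < surd_val k})"

lemma lin_ord_surd: "lin_ord surd_lin"
proof (rule lin_ordI)
  show "(h, k) \<in> snd surd_lin \<or> (k, h) \<in> snd surd_lin" if "h \<in> fst surd_lin" "k \<in> fst surd_lin" "h \<noteq> k" for h k
    using that surd_val_inj[of h k]
    by (cases rule: linorder_cases[of "surd_val h" "surd_val k"]) (auto simp: surd_lin_def)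
qed (simp_all add: surd_lin_def)

lemma dense_surd: "dense_lin surd_lin"
  unfolding dense_lin_def
proof (intro conjI ballI allI impI)
  show "fst surd_lin \<noteq> {}" using surd_surj[of 0 0] by (auto simp: surd_lin_def)
  have shift: "\<exists>k\<in>surd. surd_val k = surd_val h + real_of_int n" for h n
  proof -
    obtain p q where "surd_val h = real_of_int p + real_of_int q * sqrt 2" using surd_val_int by blast
    then show ?thesis using surd_surj[of "p + n" q] by (simp add: algebra_simps)
  qed
  show "\<exists>k. (k, h) \<in> snd surd_lin" "\<exists>k. (h, k) \<in> snd surd_lin" if "h \<in> fst surd_lin" for h
    using shift[of h "-1"] shift[of h 1] that by (auto simp: surd_lin_def)
  show "\<exists>l. (h, l) \<in> snd surd_lin \<and> (l, k) \<in> snd surd_lin" if "(h, k) \<in> snd surd_lin" for h k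
  proof -
    obtain p q where h: "surd_val h = real_of_int p + real_of_int q * sqrt 2" using surd_val_int by blast
    obtain p' q' where k: "surd_val k = real_of_int p' + real_of_int q' * sqrt 2" using surd_val_int by blast
    \<comment> \<open>\<open>\<int>[\<surd>2]\<close> is a ring containing this number strictly
      between \<open>0\<close> and \<open>1\<close>. Adding the \<open>t\<close>-fold of the
      difference to the smaller of two elements therefore gives an element between them.\<close>
    define t where "t = sqrt 2 - 1"
    have "1 < sqrt 2" by (rule real_less_rsqrt) simp
    moreover have "sqrt 2 < 2" by (rule sqrt2_less_2)
    ultimately have t: "0 < t" "t < 1" by (simp_all add: t_def)
    let ?P = "p' - p" and ?Q = "q' - q"
    have "(a + b * sqrt 2) * t = (2 * b - a) + (a - b) * sqrt 2" for a b
    proof -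
      have "b * sqrt 2 * sqrt 2 = b * 2" by (simp add: mult.assoc)
      then show ?thesis unfolding t_def by (simp add: algebra_simps)
    qed
    moreover have "surd_val k - surd_val h = real_of_int ?P + real_of_int ?Q * sqrt 2"
      unfolding h k by (simp add: left_diff_distrib)
    ultimately have "(surd_val k - surd_val h) * t = real_of_int (2 * ?Q - ?P) + real_of_int (?P - ?Q) * sqrt 2"
      by (simp only: of_int_diff of_int_mult of_int_numeral)
    then have eq: "surd_val h + (surd_val k - surd_val h) * t =
        real_of_int (p + (2 * ?Q - ?P)) + real_of_int (q + (?P - ?Q)) * sqrt 2"
      by (simp only: h of_int_add distrib_right add.assoc add.left_commute)
    have "\<exists>l\<in>surd. surd_val l = surd_val h + (surd_val k - surd_val h) * t"
      unfolding eq by (rule surd_surj)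
    then obtain l where l: "l \<in> surd" "surd_val l = surd_val h + (surd_val k - surd_val h) * t"
      by blast
    have less: "0 < surd_val k - surd_val h" using that by (simp add: surd_lin_def)
    have "0 < (surd_val k - surd_val h) * t" "(surd_val k - surd_val h) * t < surd_val k - surd_val h"
      using mult_pos_pos[OF less t(1)] mult_strict_left_mono[OF t(2) less] by simp_all
    then have less_l: "surd_val h < surd_val l" "surd_val l < surd_val k" using l(2) by linarith+
    have "h \<in> surd" "k \<in> surd" using that by (simp_all add: surd_lin_def)
    then have "(h, l) \<in> snd surd_lin" "(l, k) \<in> snd surd_lin"
      using less_l l(1) by (simp_all add: surd_lin_def)
    then show ?thesis by (intro exI[of _ l] conjI)
  qed
  show "lin_ord surd_lin" by (rule lin_ord_surd)
  show "countable (fst surd_lin)" by (rule countableI_type)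
qed

section \<open>The product with the dense group\<close>

definition dense_prod_grp :: "nat ord_grp \<Rightarrow> nat ord_grp" where
  "dense_prod_grp G =
    \<lparr>carrier = {n. pfst n \<in> carrier G \<and> psnd n \<in> surd},
     mult = (\<lambda>m n. prod_encode (mult G (pfst m) (pfst n), surd_add (psnd m) (psnd n))),
     one = prod_encode (one G, quad 0 0 0 0),
     le_rel = {(m, n). pfst m \<in> carrier G \<and> psnd m \<in> surd \<and> pfst n \<in> carrier G \<and> psnd n \<in> surd \<and>
       (surd_val (psnd m) < surd_val (psnd n) \<or> psnd m = psnd n \<and> (pfst m, pfst n) \<in> le_rel G)}\<rparr>"

lemma lin_ord_order_of: "ordered_group G \<Longrightarrow> lin_ord (order_of G)"
  unfolding ordered_group_def ordered_group_axioms_def order_of_def lin_ord_def strict_linear_order_on_def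
    linear_order_on_def partial_order_on_def preorder_on_def trans_def irrefl_def total_on_def antisym_def
  by (auto; blast)

lemma dense_prod_grp_type:
  assumes "ordered_group G"
  shows "same_order_type (lin_prod (order_of G) surd_lin) (order_of (dense_prod_grp G))"
  unfolding same_order_type_def
proof (intro exI conjI)
  show "bij_betw prod_encode (fst (lin_prod (order_of G) surd_lin)) (fst (order_of (dense_prod_grp G)))"
    by (rule bij_betw_byWitness[where f' = "\<lambda>n. (pfst n, psnd n)"])
      (auto simp: order_of_def dense_prod_grp_def surd_lin_def)
qed (auto simp: order_of_def dense_prod_grp_def surd_lin_def snd_lin_prod)

lemma ordered_group_dense_prod:
  assumes G: "ordered_group G" shows "ordered_group (dense_prod_grp G)"
proof -
  interpret ordered_group G by fact
  have zero: "quad 0 0 0 0 \<in> surd" "surd_val (quad 0 0 0 0) = 0" by (simp_all add: surd_def surd_val_def)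
  have eqI: "h = k" if "h \<in> surd" "k \<in> surd" "surd_val h = surd_val k" for h k
    using surd_val_inj that .
  have zero_add: "surd_add (quad 0 0 0 0) h = h" if "h \<in> surd" for h
    by (rule eqI) (simp_all add: surd_add zero that)
  have assoc: "surd_add (surd_add h k) l = surd_add h (surd_add k l)" for h k l
    by (rule eqI) (simp_all add: surd_add)
  have "group (dense_prod_grp G)"
  proof (rule groupI)
    fix x assume x: "x \<in> carrier (dense_prod_grp G)"
    obtain p q where "surd_val (psnd x) = real_of_int p + real_of_int q * sqrt 2" using surd_val_int by blast
    then obtain k where k: "k \<in> surd" "surd_val k = - surd_val (psnd x)"
      using surd_surj[of "- p" "- q"] by auto
    have "surd_add k (psnd x) = quad 0 0 0 0"
      by (rule eqI) (simp_all add: surd_add zero k)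
    then show "\<exists>y\<in>carrier (dense_prod_grp G). y \<otimes>\<^bsub>dense_prod_grp G\<^esub> x = \<one>\<^bsub>dense_prod_grp G\<^esub>"
      using x k by (intro bexI[of _ "prod_encode (m_inv G (pfst x), k)"]) (simp_all add: dense_prod_grp_def)
  qed (auto simp: dense_prod_grp_def surd_add zero zero_add assoc m_assoc)
  moreover have "ordered_group_axioms (dense_prod_grp G)"
  proof
    have "lin_ord (order_of (dense_prod_grp G))"
      by (rule lin_ord_same_order_type[OF dense_prod_grp_type[OF G] lin_ord_prod[OF lin_ord_order_of[OF G] lin_ord_surd]])
        (auto simp: order_of_def dense_prod_grp_def)
    moreover have "(a, a) \<in> le_rel G" if "a \<in> carrier G" for a
      using linear_order that by (auto simp: order_on_defs refl_on_def)
    then have "le_rel (dense_prod_grp G) = snd (order_of (dense_prod_grp G)) \<union> Id_on (fst (order_of (dense_prod_grp G)))"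
      by (auto simp: order_of_def dense_prod_grp_def)
    ultimately show "linear_order_on (carrier (dense_prod_grp G)) (le_rel (dense_prod_grp G))"
      by (rule linear_order_on_lin_ord(1)) (simp add: order_of_def)
    show "(a \<otimes>\<^bsub>dense_prod_grp G\<^esub> g, b \<otimes>\<^bsub>dense_prod_grp G\<^esub> g) \<in> le_rel (dense_prod_grp G)"
      "(g \<otimes>\<^bsub>dense_prod_grp G\<^esub> a, g \<otimes>\<^bsub>dense_prod_grp G\<^esub> b) \<in> le_rel (dense_prod_grp G)"
      if "(a, b) \<in> le_rel (dense_prod_grp G)" "g \<in> carrier (dense_prod_grp G)" for a b g
      using that mult_right_mono mult_left_mono by (auto simp: dense_prod_grp_def surd_add)
  qed
  ultimately show ?thesis by (simp add: ordered_group_def)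
qed

lemma lin_prod_singleton_left: "same_order_type (lin_prod (rat_lin {c}) X) X"
  unfolding same_order_type_def
proof (rule exI[of _ snd], intro conjI)
  show "bij_betw snd (fst (lin_prod (rat_lin {c}) X)) (fst X)"
    by (rule bij_betw_byWitness[where f' = "\<lambda>x. (c, x)"]) auto
qed (auto simp: snd_lin_prod)

text \<open>With either bit the product is countable and dense, so the more significant dense factor
  erases the bit and leaves the exponent alone.\<close>

lemma q_pow_times_dense:
  assumes "dense_lin Y" shows "same_order_type (lin_prod (q_pow \<epsilon>) Y) (q_pow 1)"
proof -
  have Q: "dense_lin (q_pow 1)" by (simp add: q_pow_def dense_rat_lin_ray)
  show ?thesis
  proof (cases "\<epsilon> = 0")
    case True
    have "same_order_type (lin_prod (q_pow \<epsilon>) Y) Y"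
      using lin_prod_singleton_left by (simp add: q_pow_def True)
    then show ?thesis using Cantor_isomorphism[OF assms Q] by (rule same_order_type_trans)
  next
    case False
    have "dense_lin (lin_prod (q_pow \<epsilon>) Y)"
      using False assms dense_rat_lin_ray(1)
      by (intro dense_lin_prod) (auto simp: q_pow_def dense_lin_def)
    then show ?thesis using Q by (rule Cantor_isomorphism)
  qed
qed

definition prod_univ :: "baire \<Rightarrow> nat \<Rightarrow> nat" where
  "prod_univ p n = (if baire_fst p (pfst n) = 0 then 0
     else if qa (psnd n) * qb (psnd n) + qc (psnd n) * qd (psnd n) = 0 then 1 else 0)"

definition prod_mult :: "baire \<Rightarrow> nat \<Rightarrow> nat" where
  "prod_mult p k = prod_encode (baire_fst (baire_snd p) (prod_encode (pfst (pfst k), pfst (psnd k))),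
     surd_add (psnd (pfst k)) (psnd (psnd k)))"

text \<open>The sum of both truncated differences vanishes exactly for equal second components. In
  that case the entry of the given name is passed on as it is, since any nonzero value means
  membership.\<close>

definition prod_le :: "baire \<Rightarrow> nat \<Rightarrow> nat" where
  "prod_le p k = (if prod_univ p (pfst k) = 0 then 0 else if prod_univ p (psnd k) = 0 then 0
     else if surd_less (psnd (pfst k)) (psnd (psnd k)) = 0
       then if (psnd (pfst k) - psnd (psnd k)) + (psnd (psnd k) - psnd (pfst k)) = 0
         then baire_snd (baire_snd p) (prod_encode (pfst (pfst k), pfst (psnd k))) else 0
       else 1)"

definition prod_name :: "baire \<Rightarrow> baire" where
  "prod_name p = baire_pair (prod_univ p) (baire_pair (prod_mult p) (prod_le p))"

lemmas total_rec_intros = total_rec_add total_rec_mult total_rec_diff total_rec_prod_encode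
  total_rec_pfst total_rec_psnd total_rec_const total_rec_nth total_rec_if

lemma computable_prod_name: "computable (\<lambda>p. Some (prod_name p))"
proof (rule computable_total_rec)
  have fst: "total_rec k (\<lambda>p xs. baire_fst p (f p xs))"
    "total_rec k (\<lambda>p xs. baire_fst (baire_snd p) (f p xs))"
    "total_rec k (\<lambda>p xs. baire_snd (baire_snd p) (f p xs))" if "total_rec k f" for k f
    unfolding baire_fst_def baire_snd_def
    by (intro total_rec_query total_rec_intros that)+
  have sel: "total_rec k (\<lambda>p xs. qa (f p xs))" "total_rec k (\<lambda>p xs. qb (f p xs))"
    "total_rec k (\<lambda>p xs. qc (f p xs))" "total_rec k (\<lambda>p xs. qd (f p xs))" if "total_rec k f" for k f
    unfolding qa_def qb_def qc_def qd_def by (intro total_rec_intros that)+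
  have univ: "total_rec k (\<lambda>p xs. prod_univ p (f p xs))" if "total_rec k f" for k f
    unfolding prod_univ_def by (intro total_rec_intros fst sel that)
  have add: "total_rec k (\<lambda>p xs. surd_add (f p xs) (g p xs))"
    and less: "total_rec k (\<lambda>p xs. surd_less (f p xs) (g p xs))"
    if "total_rec k f" "total_rec k g" for k f g
    unfolding surd_add_def quad_def surd_less_def Let_def
    by (intro total_rec_prod_encode total_rec_add total_rec_mult total_rec_diff total_rec_const sel that)+
  have nth: "total_rec 1 (\<lambda>p xs. xs ! 0)" by (rule total_rec_nth) simp
  have mult: "total_rec 1 (\<lambda>p xs. prod_mult p (xs ! 0))"
    unfolding prod_mult_def by (intro total_rec_prod_encode total_rec_pfst total_rec_psnd add fst(2) nth)
  have le: "total_rec 1 (\<lambda>p xs. prod_le p (xs ! 0))"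
    unfolding prod_le_def
    by (intro total_rec_if total_rec_prod_encode total_rec_add total_rec_diff total_rec_pfst
        total_rec_psnd total_rec_const less fst(3) univ nth)
  show "total_rec 1 (\<lambda>p xs. prod_name p (xs ! 0))"
    unfolding prod_name_def by (intro total_rec_pair univ[OF nth] mult le)
qed

lemma prod_name:
  assumes p: "ord_grp_rep p = Some G"
  shows "ord_grp_rep (prod_name p) = Some (decode_grp (prod_name p))"
    and "order_of (decode_grp (prod_name p)) = order_of (dense_prod_grp G)"
proof -
  have G: "ordered_group G" and GD: "G = decode_grp p"
    using p by (auto simp: ord_grp_rep_def split: if_splits)
  have c: "carrier G = {n. baire_fst p n \<noteq> 0}" by (simp add: GD decode_grp_def Let_def decode_set_def)
  have m: "mult G a b = baire_fst (baire_snd p) (prod_encode (a, b))" if "a \<in> carrier G" "b \<in> carrier G" for a b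
    using that unfolding c by (simp add: GD decode_grp_def Let_def decode_set_def)
  have l: "(a, b) \<in> le_rel G \<longleftrightarrow> baire_snd (baire_snd p) (prod_encode (a, b)) \<noteq> 0" for a b
    by (simp add: GD decode_grp_def Let_def decode_rel_def)
  have univ: "prod_univ p n \<noteq> 0 \<longleftrightarrow> pfst n \<in> carrier G \<and> psnd n \<in> surd" for n
    by (simp add: prod_univ_def c surd_def)
  have set: "decode_set (baire_fst (prod_name p)) = carrier (dense_prod_grp G)"
    by (simp add: decode_set_def prod_name_def univ dense_prod_grp_def del: neq0_conv)
  have mult: "baire_fst (baire_snd (prod_name p)) (prod_encode (a, b)) = mult (dense_prod_grp G) a b"
    if "a \<in> carrier (dense_prod_grp G)" "b \<in> carrier (dense_prod_grp G)" for a b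
    using that by (simp add: prod_name_def prod_mult_def dense_prod_grp_def m)
  have rel: "decode_rel (baire_snd (baire_snd (prod_name p))) = le_rel (dense_prod_grp G)"
  proof -
    have "prod_le p (prod_encode (a, b)) \<noteq> 0 \<longleftrightarrow> (a, b) \<in> le_rel (dense_prod_grp G)" for a b
    proof -
      have "prod_le p (prod_encode (a, b)) \<noteq> 0 \<longleftrightarrow> prod_univ p a \<noteq> 0 \<and> prod_univ p b \<noteq> 0 \<and>
        (surd_less (psnd a) (psnd b) > 0 \<or>
          psnd a = psnd b \<and> baire_snd (baire_snd p) (prod_encode (pfst a, pfst b)) \<noteq> 0)"
        by (auto simp: prod_le_def)
      then show ?thesis unfolding univ surd_less_iff l[symmetric] by (auto simp: dense_prod_grp_def)
    qed
    then show ?thesis by (auto simp: decode_rel_def prod_name_def)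
  qed
  show "ord_grp_rep (prod_name p) = Some (decode_grp (prod_name p))"
    "order_of (decode_grp (prod_name p)) = order_of (dense_prod_grp G)"
    using ord_grp_rep_name[OF ordered_group_dense_prod[OF G] set mult rel] by simp_all
qed

section \<open>The reductions\<close>

lemma in_solutions_alpha: "X \<in> solutions OG_alpha G \<longleftrightarrow> G \<in> points ord_grp_rep \<and> X \<in> ordinal_copies \<and>
    (\<exists>\<epsilon>\<in>{0, 1}. same_order_type (order_of G) (lin_prod (Z_pow X) (q_pow \<epsilon>)))"
  using has_type_ZQ_iff[of _ "order_of G" X] by (auto simp: OG_alpha_def)

lemma in_solutions_alpha_eps: "(X, \<epsilon>) \<in> solutions OG_alpha_eps G \<longleftrightarrow> G \<in> points ord_grp_rep \<and>
    X \<in> ordinal_copies \<and> \<epsilon> \<in> {0, 1} \<and> same_order_type (order_of G) (lin_prod (Z_pow X) (q_pow \<epsilon>))"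
  using has_type_ZQ_iff[of \<epsilon> "order_of G" X] by (auto simp: OG_alpha_eps_def)

lemma problem_reps [simp]:
  "in_rep OG_alpha = ord_grp_rep" "out_rep OG_alpha = ordinal_rep"
  "in_rep OG_alpha_eps = ord_grp_rep" "out_rep OG_alpha_eps = prod_rep ordinal_rep bit_rep"
  "in_rep (restrict_problem f D) = in_rep f" "out_rep (restrict_problem f D) = out_rep f"
  by (simp_all add: OG_alpha_def OG_alpha_eps_def restrict_problem_def)

lemma solutions_restrict [simp]: "solutions (restrict_problem f D) x = (if x \<in> D then solutions f x else {})"
  by (simp add: restrict_problem_def)

lemma restrict_le: "restrict_problem f D \<le>\<^sub>W f"
  unfolding weihrauch_le_def
proof (rule exI[of _ "\<lambda>p. Some p"], rule exI[of _ "\<lambda>p. Some (baire_snd p)"], intro conjI allI impI)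
  show "computable (\<lambda>p. Some p)" by (rule computable_id)
  show "computable (\<lambda>p. Some (baire_snd p))" by (rule computable_snd)
  fix p x assume "in_rep (restrict_problem f D) p = Some x \<and> x \<in> problem_dom (restrict_problem f D)"
  then have "in_rep f p = Some x" "x \<in> problem_dom f" "x \<in> D"
    by (auto simp: problem_dom_def split: if_splits)
  then show "\<exists>r z. Some p = Some r \<and> in_rep f r = Some z \<and> z \<in> problem_dom f \<and>
      (\<forall>q y. out_rep f q = Some y \<and> y \<in> solutions f z \<longrightarrow>
        (\<exists>s w. Some (baire_snd (baire_pair p q)) = Some s \<and>
          out_rep (restrict_problem f D) s = Some w \<and> w \<in> solutions (restrict_problem f D) x))"
    by auto
qed

lemma alpha_le_alpha_eps: "OG_alpha \<le>\<^sub>W OG_alpha_eps"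
  unfolding weihrauch_le_def
proof (rule exI[of _ "\<lambda>p. Some p"], rule exI[of _ "\<lambda>p. Some (baire_fst (baire_snd p))"], intro conjI allI impI)
  show "computable (\<lambda>p. Some p)" by (rule computable_id)
  show "computable (\<lambda>p. Some (baire_fst (baire_snd p)))" by (rule computable_fst_snd)
  fix p x assume px: "in_rep OG_alpha p = Some x \<and> x \<in> problem_dom OG_alpha"
  then obtain X where "X \<in> solutions OG_alpha x" by (auto simp: problem_dom_def)
  then obtain \<epsilon> where "(X, \<epsilon>) \<in> solutions OG_alpha_eps x"
    unfolding in_solutions_alpha in_solutions_alpha_eps by blast
  then have "x \<in> problem_dom OG_alpha_eps" by (auto simp: problem_dom_def)
  moreover have "\<exists>s w. Some (baire_fst (baire_snd (baire_pair p q))) = Some s \<and>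
      out_rep OG_alpha s = Some w \<and> w \<in> solutions OG_alpha x"
    if "out_rep OG_alpha_eps q = Some y \<and> y \<in> solutions OG_alpha_eps x" for q y
  proof -
    obtain Y \<epsilon> where y: "y = (Y, \<epsilon>)" by (cases y)
    have "ordinal_rep (baire_fst q) = Some Y"
      using that by (auto simp: prod_rep_def y split: option.splits)
    moreover have "Y \<in> solutions OG_alpha x"
      using that unfolding y in_solutions_alpha in_solutions_alpha_eps by blast
    ultimately show ?thesis by (intro exI[of _ "baire_fst q"] exI[of _ Y]) simp
  qed
  ultimately show "\<exists>r z. Some p = Some r \<and> in_rep OG_alpha_eps r = Some z \<and> z \<in> problem_dom OG_alpha_eps \<and>
      (\<forall>q y. out_rep OG_alpha_eps q = Some y \<and> y \<in> solutions OG_alpha_eps z \<longrightarrow>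
        (\<exists>s w. Some (baire_fst (baire_snd (baire_pair p q))) = Some s \<and>
          out_rep OG_alpha s = Some w \<and> w \<in> solutions OG_alpha x))"
    using px by (intro exI[of _ p] exI[of _ x]) auto
qed

text \<open>The product with the dense group is queried and the answer returned unchanged. By
  \<open>type_unique\<close> it has the order type of the exponent of \<open>G\<close>, whatever the
  bit of \<open>G\<close> is. A general \<open>D\<close> covers \<open>OG_alpha\<close> and
  \<open>OG_alpha_0\<close> at once.\<close>

lemma restrict_alpha_le_alpha_1: "restrict_problem OG_alpha D \<le>\<^sub>W OG_alpha_1"
  unfolding weihrauch_le_def
proof (rule exI[of _ "\<lambda>p. Some (prod_name p)"], rule exI[of _ "\<lambda>p. Some (baire_snd p)"], intro conjI allI impI)
  show "computable (\<lambda>p. Some (prod_name p))" by (rule computable_prod_name)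
  show "computable (\<lambda>p. Some (baire_snd p))" by (rule computable_snd)
  fix p G assume "in_rep (restrict_problem OG_alpha D) p = Some G \<and> G \<in> problem_dom (restrict_problem OG_alpha D)"
  then have p: "ord_grp_rep p = Some G" and GD: "G \<in> D" and "\<exists>X. X \<in> solutions OG_alpha G"
    by (auto simp: problem_dom_def split: if_splits)
  then obtain X \<epsilon> where X: "X \<in> ordinal_copies" "\<epsilon> \<in> {0, 1}"
    "same_order_type (order_of G) (lin_prod (Z_pow X) (q_pow \<epsilon>))"
    unfolding in_solutions_alpha by blast
  have Gpt: "G \<in> points ord_grp_rep" using p by (auto simp: ran_def)
  have G: "ordered_group G" using p by (auto simp: ord_grp_rep_def split: if_splits)
  have X': "lin_ord X" "wf (snd X)" using X(1) by (simp_all add: ordinal_copies_iff)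
  let ?H = "decode_grp (prod_name p)"
  note H = prod_name[OF p]
  have step: "same_order_type (order_of ?H) (lin_prod (order_of G) surd_lin)"
    unfolding H(2) by (rule same_order_type_sym[OF dense_prod_grp_type[OF G]])
  have "same_order_type (order_of ?H) (lin_prod (lin_prod (Z_pow X) (q_pow \<epsilon>)) surd_lin)"
    by (rule same_order_type_trans[OF step lin_prod_cong[OF X(3) same_order_type_refl]])
  then have "same_order_type (order_of ?H) (lin_prod (Z_pow X) (lin_prod (q_pow \<epsilon>) surd_lin))"
    by (rule same_order_type_trans[OF _ lin_prod_assoc])
  then have type: "same_order_type (order_of ?H) (lin_prod (Z_pow X) (q_pow 1))"
    by (rule same_order_type_trans[OF _ lin_prod_cong[OF same_order_type_refl q_pow_times_dense[OF dense_surd]]])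
  have "?H \<in> points ord_grp_rep" using H(1) by (auto simp: ran_def)
  then have "X \<in> solutions OG_alpha ?H" using X(1) type unfolding in_solutions_alpha by blast
  moreover have "has_type_ZQ (order_of ?H) X 1" using has_type_ZQ_iff[of 1 "order_of ?H" X] type by simp
  ultimately have dom: "?H \<in> problem_dom OG_alpha_1"
    using X(1) by (auto simp: problem_dom_def OG_alpha_1_def)
  have "Y \<in> solutions OG_alpha G" if "Y \<in> solutions OG_alpha_1 ?H" for Y
  proof -
    have "Y \<in> solutions OG_alpha ?H" using that by (auto simp: OG_alpha_1_def split: if_splits)
    then obtain \<delta> where Y: "Y \<in> ordinal_copies" "\<delta> \<in> {0, 1}"
      "same_order_type (order_of ?H) (lin_prod (Z_pow Y) (q_pow \<delta>))"
      unfolding in_solutions_alpha by blast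
    have Y': "lin_ord Y" "wf (snd Y)" using Y(1) by (simp_all add: ordinal_copies_iff)
    have "same_order_type X Y"
      using type_unique[OF X' Y' _ Y(2) same_order_type_trans[OF same_order_type_sym[OF type] Y(3)]] by simp
    then have "same_order_type (lin_prod (Z_pow X) (q_pow \<epsilon>)) (lin_prod (Z_pow Y) (q_pow \<epsilon>))"
      by (intro lin_prod_cong Z_pow_cong same_order_type_refl X' Y')
    then have "same_order_type (order_of G) (lin_prod (Z_pow Y) (q_pow \<epsilon>))"
      by (rule same_order_type_trans[OF X(3)])
    then show ?thesis using Gpt Y(1) X(2) unfolding in_solutions_alpha by blast
  qed
  then show "\<exists>r z. Some (prod_name p) = Some r \<and> in_rep OG_alpha_1 r = Some z \<and> z \<in> problem_dom OG_alpha_1 \<and>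
      (\<forall>q y. out_rep OG_alpha_1 q = Some y \<and> y \<in> solutions OG_alpha_1 z \<longrightarrow>
        (\<exists>s w. Some (baire_snd (baire_pair p q)) = Some s \<and>
          out_rep (restrict_problem OG_alpha D) s = Some w \<and> w \<in> solutions (restrict_problem OG_alpha D) G))"
    using H(1) dom GD by (intro exI[of _ "prod_name p"] exI[of _ ?H]) (auto simp: OG_alpha_1_def)
qed

section \<open>Witnessed isomorphisms\<close>

text \<open>The inverse \<open>h'\<close> is part of the witness, so that surjectivity needs no
  search. Each instance for \<open>i\<close> and \<open>j\<close> is then decided by finitely many
  values, and being an isomorphism becomes a closed condition.\<close>

definition iso_cond :: "nat lin \<Rightarrow> nat lin \<Rightarrow> baire \<Rightarrow> baire \<Rightarrow> nat \<Rightarrow> nat \<Rightarrow> bool" where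
  "iso_cond X Y h h' i j \<longleftrightarrow> (i \<in> fst X \<longrightarrow> h i \<in> fst Y \<and> h' (h i) = i) \<and>
     (i \<in> fst Y \<longrightarrow> h' i \<in> fst X \<and> h (h' i) = i) \<and>
     (i \<in> fst X \<and> j \<in> fst X \<longrightarrow> ((i, j) \<in> snd X \<longleftrightarrow> (h i, h j) \<in> snd Y))"

lemma same_order_type_witness:
  "same_order_type X Y \<longleftrightarrow> (\<exists>h h'. \<forall>i j. iso_cond X Y h h' i j)"
proof
  assume "same_order_type X Y"
  then obtain h where h: "bij_betw h (fst X) (fst Y)"
    "\<forall>a\<in>fst X. \<forall>b\<in>fst X. (a, b) \<in> snd X \<longleftrightarrow> (h a, h b) \<in> snd Y"
    unfolding same_order_type_def by blast
  have "iso_cond X Y h (inv_into (fst X) h) i j" for i j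
    unfolding iso_cond_def
    using h(2) bij_betw_apply[OF h(1), of i] bij_betw_inv_into_left[OF h(1), of i]
      bij_betw_inv_into_right[OF h(1), of i] bij_betw_apply[OF bij_betw_inv_into[OF h(1)], of i]
    by simp
  then show "\<exists>h h'. \<forall>i j. iso_cond X Y h h' i j" by blast
next
  assume "\<exists>h h'. \<forall>i j. iso_cond X Y h h' i j"
  then obtain h h' where h: "\<And>i j. iso_cond X Y h h' i j" by blast
  show "same_order_type X Y"
    unfolding same_order_type_def
  proof (intro exI[of _ h] conjI ballI)
    show "bij_betw h (fst X) (fst Y)"
      by (rule bij_betw_byWitness[where f' = h']) (use h in \<open>auto simp: iso_cond_def\<close>)
    show "(a, b) \<in> snd X \<longleftrightarrow> (h a, h b) \<in> snd Y" if "a \<in> fst X" "b \<in> fst X" for a b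
      using h[of a b] that unfolding iso_cond_def by blast
  qed
qed

lemma locally_const_iso_cond:
  assumes X: "\<And>i. locally_const (\<lambda>s. i \<in> fst (X s))" "\<And>i j. locally_const (\<lambda>s. (i, j) \<in> snd (X s))"
    and Y: "\<And>i. locally_const (\<lambda>s. i \<in> fst (Y s))" "\<And>i j. locally_const (\<lambda>s. (i, j) \<in> snd (Y s))"
    and h: "\<And>i. locally_const (\<lambda>s. h s i)" and h': "\<And>i. locally_const (\<lambda>s. h' s i)"
  shows "locally_const (\<lambda>s. iso_cond (X s) (Y s) (h s) (h' s) i j)"
proof -
  have imp: "locally_const (\<lambda>s. P s \<longrightarrow> Q s)" if "locally_const P" "locally_const Q" for P Q
    using that by (rule locally_const_comp2)
  have conj: "locally_const (\<lambda>s. P s \<and> Q s)" if "locally_const P" "locally_const Q" for P Q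
    using that by (rule locally_const_comp2)
  have iff: "locally_const (\<lambda>s. P s \<longleftrightarrow> Q s)" if "locally_const P" "locally_const Q" for P Q :: "baire \<Rightarrow> bool"
    using that by (rule locally_const_comp2)
  have eq: "locally_const (\<lambda>s. P s = i)" if "locally_const P" for P :: "baire \<Rightarrow> nat" and i
    using that by (rule locally_const_comp)
  have hY: "locally_const (\<lambda>s. h s i \<in> fst (Y s))"
    using locally_const_eval[of "\<lambda>s m. m \<in> fst (Y s)", OF Y(1) h] .
  have hX: "locally_const (\<lambda>s. h' s i \<in> fst (X s))"
    using locally_const_eval[of "\<lambda>s m. m \<in> fst (X s)", OF X(1) h'] .
  have hh: "locally_const (\<lambda>s. h' s (h s i))" "locally_const (\<lambda>s. h s (h' s i))"
    by (rule locally_const_eval[of h', OF h' h], rule locally_const_eval[of h, OF h h'])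
  have "locally_const (\<lambda>s. (h s i, n) \<in> snd (Y s))" for n
    using locally_const_eval[of "\<lambda>s m. (m, n) \<in> snd (Y s)", OF Y(2) h] .
  from locally_const_eval[of "\<lambda>s n. (h s i, n) \<in> snd (Y s)", OF this h]
  have rel: "locally_const (\<lambda>s. (h s i, h s j) \<in> snd (Y s))" .
  show ?thesis unfolding iso_cond_def
    by (intro conj imp iff eq X Y hY hX hh rel)
qed

text \<open>A copy on the natural numbers of the product of the power over \<open>A\<close> with
  \<open>M\<close>, in which every question about membership or order involves finitely many
  rationals only.\<close>

definition target :: "rat set \<Rightarrow> rat set \<Rightarrow> nat lin" where
  "target A M = ({m. codes A (pfst m) \<and> in_copy M (psnd m)},
     {(m, n). (codes A (pfst m) \<and> in_copy M (psnd m)) \<and> (codes A (pfst n) \<and> in_copy M (psnd n)) \<and>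
       (from_nat (psnd m) < (from_nat (psnd n) :: rat) \<or>
        psnd m = psnd n \<and> (dec (pfst m), dec (pfst n)) \<in> Z_rel)})"

lemma target_type: "same_order_type (target A M) (lin_prod (Z_pow (rat_lin A)) (rat_lin M))"
  unfolding same_order_type_def
proof (rule exI[of _ "\<lambda>m. (dec (pfst m), from_nat (psnd m))"], intro conjI ballI)
  show "bij_betw (\<lambda>m. (dec (pfst m), from_nat (psnd m))) (fst (target A M))
      (fst (lin_prod (Z_pow (rat_lin A)) (rat_lin M)))"
    by (rule bij_betw_byWitness[where f' = "\<lambda>(f, r). prod_encode (enc f, to_nat r)"])
      (auto simp: target_def codes_def in_copy_def dec_enc)
  fix m n assume "m \<in> fst (target A M)" "n \<in> fst (target A M)"
  then have mn: "codes A (pfst m)" "in_copy M (psnd m)" "codes A (pfst n)" "in_copy M (psnd n)"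
    by (simp_all add: target_def)
  then have "dec (pfst m) \<in> fin_supp A" "dec (pfst n) \<in> fin_supp A"
    "from_nat (psnd m) \<in> M" "from_nat (psnd n) \<in> M"
    by (simp_all add: codes_def in_copy_def)
  moreover have "psnd m = psnd n \<longleftrightarrow> from_nat (psnd m) = (from_nat (psnd n) :: rat)"
    using mn(2,4) unfolding in_copy_def by metis
  ultimately show "(m, n) \<in> snd (target A M) \<longleftrightarrow>
      ((dec (pfst m), from_nat (psnd m)), (dec (pfst n), from_nat (psnd n)))
      \<in> snd (lin_prod (Z_pow (rat_lin A)) (rat_lin M))"
    using mn Z_rel_iff[of "dec (pfst m)" A "dec (pfst n)"] by (auto simp: target_def snd_lin_prod)
qed

lemma locally_const_target:
  assumes A: "\<And>r. locally_const (\<lambda>s. r \<in> A s)" and M: "\<And>r. locally_const (\<lambda>s. r \<in> M s)"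
  shows "locally_const (\<lambda>s. i \<in> fst (target (A s) (M s)))"
    and "locally_const (\<lambda>s. (i, j) \<in> snd (target (A s) (M s)))"
proof -
  have mem: "locally_const (\<lambda>s. codes (A s) (pfst m) \<and> in_copy (M s) (psnd m))" for m
    by (rule locally_const_comp2[of _ _ "(\<and>)"])
      (rule locally_const_codes[OF A] locally_const_in_copy[OF M])+
  then show "locally_const (\<lambda>s. i \<in> fst (target (A s) (M s)))" by (simp add: target_def)
  show "locally_const (\<lambda>s. (i, j) \<in> snd (target (A s) (M s)))"
    using locally_const_comp2[OF mem[of i] mem[of j], of "\<lambda>a b. a \<and> b \<and>
      (from_nat (psnd i) < (from_nat (psnd j) :: rat) \<or> psnd i = psnd j \<and> (dec (pfst i), dec (pfst j)) \<in> Z_rel)"]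
    by (simp add: target_def)
qed

lemma locally_const_order:
  assumes "\<And>n. locally_const (\<lambda>s. r s n)"
  shows "locally_const (\<lambda>s. i \<in> fst (order_of (decode_grp (r s))))"
    and "locally_const (\<lambda>s. (i, j) \<in> snd (order_of (decode_grp (r s))))"
proof -
  have "locally_const (\<lambda>s. r s (2 * i) \<noteq> 0)" using assms by (rule locally_const_comp)
  then show "locally_const (\<lambda>s. i \<in> fst (order_of (decode_grp (r s))))"
    by (simp add: order_of_def decode_grp_def Let_def decode_set_def baire_fst_def)
  \<comment> \<open>The index at which taking the second component twice finds the entry for the
    pair of \<open>i\<close> and \<open>j\<close>.\<close>
  have "locally_const (\<lambda>s. r s (2 * (2 * prod_encode (i, j) + 1) + 1) \<noteq> 0 \<and> i \<noteq> j)"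
    using assms by (rule locally_const_comp)
  then show "locally_const (\<lambda>s. (i, j) \<in> snd (order_of (decode_grp (r s))))"
    by (simp add: order_of_def decode_grp_def Let_def decode_rel_def baire_snd_def)
qed

section \<open>The separations\<close>

lemma same_order_type_embeds:
  assumes "same_order_type (UNIV, W) X"
  shows "\<exists>k. \<forall>a b. (a, b) \<in> W \<longrightarrow> (k a, k b) \<in> snd X"
  using assms unfolding same_order_type_def by auto

lemma all_pfst_psnd: "(\<forall>i. R (pfst i) (psnd i)) \<longleftrightarrow> (\<forall>i j. R i j)"
  by (metis pfst_encode psnd_encode)

lemma closed_locally_const:
  assumes P: "\<And>i. locally_const (P i)" and n: "\<And>n. \<exists>t\<in>{s. \<forall>i. P i s}. agree n s t"
  shows "s \<in> {s. \<forall>i. P i s}"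
proof -
  have "P i s" for i by (rule locally_const_closed[OF P]) (use n in blast)
  then show ?thesis by simp
qed

text \<open>In a reduction of \<open>OG_alpha_1\<close> to \<open>OG_alpha_0\<close>, the groups that are queried have type
  \<open>\<int>\<^sup>\<beta>\<close>, so every linear order \<open>x\<close> for which the queried group has type \<open>\<int>\<^sup>x\<close> is a well-order and
  a correct answer. Hence the well-founded parts of all linear orders form an analytic set.\<close>

theorem not_alpha_1_le_alpha_0: "\<not> OG_alpha_1 \<le>\<^sub>W OG_alpha_0"
proof
  assume "OG_alpha_1 \<le>\<^sub>W OG_alpha_0"
  then obtain \<Phi> \<Psi> where comp: "computable \<Phi>" "computable \<Psi>" and
    red: "\<And>p x. in_rep OG_alpha_1 p = Some x \<and> x \<in> problem_dom OG_alpha_1 \<Longrightarrow>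
        (\<exists>r z. \<Phi> p = Some r \<and> in_rep OG_alpha_0 r = Some z \<and> z \<in> problem_dom OG_alpha_0 \<and>
          (\<forall>q y. out_rep OG_alpha_0 q = Some y \<and> y \<in> solutions OG_alpha_0 z \<longrightarrow>
            (\<exists>s w. \<Psi> (baire_pair p q) = Some s \<and> out_rep OG_alpha_1 s = Some w \<and>
              w \<in> solutions OG_alpha_1 x)))"
    unfolding weihrauch_le_def by blast
  obtain e where e: "\<And>p q n. \<Phi> p = Some q \<Longrightarrow> computes p e [n] (q n)"
    using comp(1) unfolding computable_def by blast
  obtain e' where e': "\<And>p q n. \<Psi> p = Some q \<Longrightarrow> computes p e' [n] (q n)"
    using comp(2) unfolding computable_def by blast
  \<comment> \<open>The positive rationals make \<open>A s\<close> ill-founded for every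
    \<open>s\<close>. Hence the power over it is always an admissible input, and the query
    \<open>r\<close> is defined and continuous everywhere.\<close>
  define A where "A s = rat_set (part 0 s) \<union> {0<..}" for s
  define x where "x s = rat_set (part 1 s)" for s
  define r where "r s = the (\<Phi> (Z_name (A s)))" for s
  have ill: "\<not> wf (snd (rat_lin (A s)))" for s
  proof
    assume wf: "wf (snd (rat_lin (A s)))"
    have "(1 :: rat) \<in> {0<..}" by simp
    from wfE_min[OF wf this] obtain z :: rat where z: "z \<in> {0<..}"
      "\<And>y. (y, z) \<in> snd (rat_lin (A s)) \<Longrightarrow> y \<notin> {0<..}" by blast
    show False using z(2)[of "z / 2"] z(1) by (auto simp: A_def)
  qed
  have dom: "\<exists>z. \<Phi> (Z_name (A s)) = Some (r s) \<and> in_rep OG_alpha_0 (r s) = Some z \<and> z \<in> problem_dom OG_alpha_0 \<and>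
      (\<forall>q y. out_rep OG_alpha_0 q = Some y \<and> y \<in> solutions OG_alpha_0 z \<longrightarrow>
        (\<exists>s' w. \<Psi> (baire_pair (Z_name (A s)) q) = Some s' \<and> out_rep OG_alpha_1 s' = Some w \<and>
          w \<in> solutions OG_alpha_1 (decode_grp (Z_name (A s)))))" for s
  proof -
    let ?G = "decode_grp (Z_name (A s))"
    obtain I \<epsilon> where I: "I \<subseteq> A s" "wf (snd (rat_lin I))" "\<epsilon> \<in> {0, 1}" "\<epsilon> = 0 \<longleftrightarrow> wf (snd (rat_lin (A s)))"
      "same_order_type (Z_pow (rat_lin (A s))) (lin_prod (Z_pow (rat_lin I)) (q_pow \<epsilon>))"
      using Z_pow_type[of "A s"] by (elim exE conjE) (rule that)
    have "\<epsilon> = 1" using I(3,4) ill by auto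
    have "same_order_type (order_of ?G) (lin_prod (Z_pow (copy I)) (q_pow 1))"
      using same_order_type_trans[OF Z_name(2) I(5)]
        lin_prod_cong[OF Z_pow_cong[OF copy_type lin_ord_rat_lin lin_ord_copy] same_order_type_refl]
      unfolding \<open>\<epsilon> = 1\<close> by (rule same_order_type_trans)
    moreover have "?G \<in> points ord_grp_rep" using Z_name(1) by (auto simp: ran_def)
    ultimately have "copy I \<in> solutions OG_alpha ?G" "has_type_ZQ (order_of ?G) (copy I) 1"
      using copy_ordinal[OF I(2)] has_type_ZQ_iff[of 1 "order_of ?G" "copy I"]
      unfolding in_solutions_alpha by auto
    then have "?G \<in> problem_dom OG_alpha_1"
      using copy_ordinal[OF I(2)] by (auto simp: problem_dom_def OG_alpha_1_def)
    then have "in_rep OG_alpha_1 (Z_name (A s)) = Some ?G \<and> ?G \<in> problem_dom OG_alpha_1"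
      using Z_name(1) by (simp add: OG_alpha_1_def)
    from red[OF this] show ?thesis by (auto simp: r_def)
  qed
  let ?z = "\<lambda>s. decode_grp (r s)"
  have z: "ord_grp_rep (r s) = Some (?z s)" and zdom: "?z s \<in> problem_dom OG_alpha_0"
    and \<Phi>: "\<Phi> (Z_name (A s)) = Some (r s)"
    and \<Psi>: "\<And>q Y. ordinal_rep q = Some Y \<Longrightarrow> Y \<in> solutions OG_alpha_0 (?z s) \<Longrightarrow>
        \<exists>s' w. \<Psi> (baire_pair (Z_name (A s)) q) = Some s' \<and> ordinal_rep s' = Some w \<and>
          w \<in> solutions OG_alpha_1 (decode_grp (Z_name (A s)))" for s
  proof -
    obtain z where *: "\<Phi> (Z_name (A s)) = Some (r s)" "ord_grp_rep (r s) = Some z" "z \<in> problem_dom OG_alpha_0"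
      "\<And>q y. ordinal_rep q = Some y \<Longrightarrow> y \<in> solutions OG_alpha_0 z \<Longrightarrow>
        (\<exists>s' w. \<Psi> (baire_pair (Z_name (A s)) q) = Some s' \<and> ordinal_rep s' = Some w \<and>
          w \<in> solutions OG_alpha_1 (decode_grp (Z_name (A s))))"
      using dom[of s] by (auto simp: OG_alpha_0_def OG_alpha_1_def)
    have zz: "z = ?z s" using *(2) by (auto simp: ord_grp_rep_def split: if_splits)
    show "ord_grp_rep (r s) = Some (?z s)" "?z s \<in> problem_dom OG_alpha_0" "\<Phi> (Z_name (A s)) = Some (r s)"
      using * zz by auto
    show "\<exists>s' w. \<Psi> (baire_pair (Z_name (A s)) q) = Some s' \<and> ordinal_rep s' = Some w \<and>
          w \<in> solutions OG_alpha_1 (decode_grp (Z_name (A s)))"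
      if "ordinal_rep q = Some Y" "Y \<in> solutions OG_alpha_0 (?z s)" for q Y
      using *(4)[OF that(1)] that(2) zz by simp
  qed
  have zX: "\<exists>X :: nat lin. lin_ord X \<and> wf (snd X) \<and> same_order_type (order_of (?z s)) (lin_prod (Z_pow X) (q_pow 0))" for s
  proof -
    obtain X where "X \<in> ordinal_copies" "has_type_ZQ (order_of (?z s)) X 0"
      using zdom[of s] by (auto simp: problem_dom_def OG_alpha_0_def split: if_splits)
    then show ?thesis
      using has_type_ZQ_iff[of 0 "order_of (?z s)" X]
      by (intro exI[of _ X]) (simp add: ordinal_copies_iff)
  qed
  \<comment> \<open>\<open>part 1\<close> codes a linear order \<open>x\<close>, parts 2 and 3 an
    isomorphism of the queried group with the power over \<open>x\<close> and its inverse.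
    Well-foundedness of \<open>x\<close> is not demanded, as it would not be closed.\<close>
  define P where "P i s = iso_cond (order_of (?z s)) (target (x s) {0}) (part 2 s) (part 3 s) (pfst i) (psnd i)"
    for i s
  define S where "S = {s. \<forall>i. P i s}"
  define out where "out s = the (\<Psi> (baire_pair (Z_name (A s)) (copy_name (x s))))" for s
  define F where "F s = decode_rel (baire_snd (out s))" for s
  have lcA: "locally_const (\<lambda>s. q \<in> A s)" for q
  proof -
    have "locally_const (\<lambda>s. q \<in> rat_set (part 0 s))"
      by (rule locally_const_compose[OF locally_const_rat_set locally_const_part])
    then have "locally_const (\<lambda>s. q \<in> rat_set (part 0 s) \<or> 0 < q)" by (rule locally_const_comp)
    then show ?thesis by (simp add: A_def)
  qed
  have lcx: "locally_const (\<lambda>s. q \<in> x s)" for q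
    unfolding x_def by (rule locally_const_compose[OF locally_const_rat_set locally_const_part])
  have lcr: "locally_const (\<lambda>s. r s n)" for n
    by (rule locally_const_computable[OF e[OF \<Phi>] locally_const_Z_name[OF lcA]])
  have lcpair: "locally_const (\<lambda>s. baire_pair (Z_name (A s)) (copy_name (x s)) n)" for n
    by (rule locally_const_pair[OF locally_const_Z_name[OF lcA] locally_const_copy_name[OF lcx]])
  have lcP: "locally_const (P i)" for i
    unfolding P_def
    by (rule locally_const_iso_cond[OF locally_const_order[OF lcr] locally_const_target[OF lcx locally_const_const]
        locally_const_part locally_const_part])
  have inS: "s \<in> S \<longleftrightarrow> (\<forall>i j. iso_cond (order_of (?z s)) (target (x s) {0}) (part 2 s) (part 3 s) i j)" for s
    unfolding S_def P_def mem_Collect_eq by (rule all_pfst_psnd)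
  have target0: "same_order_type (target B {0}) (lin_prod (Z_pow (rat_lin B)) (q_pow 0))" for B
    using target_type[of B "{0}"] by (simp add: q_pow_def)
  have main: "\<exists>w. \<Psi> (baire_pair (Z_name (A s)) (copy_name (x s))) = Some (out s) \<and> snd w = F s \<and>
      w \<in> solutions OG_alpha_1 (decode_grp (Z_name (A s)))" if s: "s \<in> S" for s
  proof -
    have "same_order_type (order_of (?z s)) (target (x s) {0})"
      using s same_order_type_witness unfolding inS by blast
    then have zx: "same_order_type (order_of (?z s)) (lin_prod (Z_pow (rat_lin (x s))) (q_pow 0))"
      using target0 by (rule same_order_type_trans)
    obtain X :: "nat lin" where X: "lin_ord X" "wf (snd X)" "same_order_type (order_of (?z s)) (lin_prod (Z_pow X) (q_pow 0))"
      using zX by blast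
    have "same_order_type (Z_pow (rat_lin (x s))) (lin_prod (Z_pow X) (q_pow 0))"
      by (rule same_order_type_trans[OF same_order_type_trans[OF Z_pow_type_wf same_order_type_sym[OF zx]] X(3)])
    \<comment> \<open>The queried group has bit \<open>0\<close>, so the isomorphism by itself shows
      \<open>x s\<close> to be a well-order and thus a correct answer.\<close>
    then have wf: "wf (snd (rat_lin (x s)))" using X(1,2) by (rule wf_exponent)
    have ty: "same_order_type (order_of (?z s)) (lin_prod (Z_pow (copy (x s))) (q_pow 0))"
      using zx lin_prod_cong[OF Z_pow_cong[OF copy_type lin_ord_rat_lin lin_ord_copy] same_order_type_refl]
      by (rule same_order_type_trans)
    have "?z s \<in> points ord_grp_rep" using z by (auto simp: ran_def)
    then have "copy (x s) \<in> solutions OG_alpha (?z s)" "has_type_ZQ (order_of (?z s)) (copy (x s)) 0"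
      using copy_ordinal[OF wf] ty has_type_ZQ_iff[of 0 "order_of (?z s)" "copy (x s)"]
      unfolding in_solutions_alpha by auto
    then have "copy (x s) \<in> solutions OG_alpha_0 (?z s)"
      using copy_ordinal[OF wf] by (auto simp: OG_alpha_0_def)
    then obtain s' w where w: "\<Psi> (baire_pair (Z_name (A s)) (copy_name (x s))) = Some s'" "ordinal_rep s' = Some w"
      "w \<in> solutions OG_alpha_1 (decode_grp (Z_name (A s)))"
      using \<Psi>[OF ordinal_rep_copy_name[OF wf]] by blast
    have "snd w = decode_rel (baire_snd s')" using w(2) by (auto simp: ordinal_rep_def Let_def split: if_splits)
    then show ?thesis using w by (intro exI[of _ w]) (simp add: F_def out_def)
  qed
  have "\<exists>W :: (nat list \<times> nat list) option rel. lin_ord (UNIV, W) \<and> wf W \<and>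
    (\<forall>s\<in>S. \<not> (\<exists>k. \<forall>a b. (a, b) \<in> W \<longrightarrow> (k a, k b) \<in> F s))"
  proof (rule boundedness)
    show "s \<in> S" if "\<And>n. \<exists>t\<in>S. agree n s t" for s
      using closed_locally_const[of P, OF lcP] that unfolding S_def by blast
    show "wf (F s)" if s: "s \<in> S" for s
    proof -
      obtain w where w: "snd w = F s" "w \<in> solutions OG_alpha_1 (decode_grp (Z_name (A s)))"
        using main[OF s] by blast
      then have "w \<in> ordinal_copies" by (auto simp: OG_alpha_1_def in_solutions_alpha split: if_splits)
      then show ?thesis using w(1) by (simp add: ordinal_copies_iff)
    qed
    show "\<exists>n. \<forall>t\<in>S. agree n s t \<longrightarrow> (a, b) \<in> F t \<longrightarrow> (a, b) \<in> F s" if s: "s \<in> S" for s a b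
    proof -
      \<comment> \<open>The entry of the returned name that decides the pair. The answer is known to
        exist only on \<open>S\<close>, so continuity is shown for points of \<open>S\<close>
        only.\<close>
      let ?k = "2 * prod_encode (a, b) + 1"
      obtain N where N: "\<And>q. agree N (baire_pair (Z_name (A s)) (copy_name (x s))) q \<Longrightarrow> computes q e' [?k] (out s ?k)"
        using computes_use[OF e'] main[OF s] by blast
      obtain M where M: "\<And>t. agree M s t \<Longrightarrow> agree N (baire_pair (Z_name (A s)) (copy_name (x s)))
          (baire_pair (Z_name (A t)) (copy_name (x t)))"
        using locally_const_agree[of "\<lambda>s. baire_pair (Z_name (A s)) (copy_name (x s))", OF lcpair] by blast
      have "out t ?k = out s ?k" if t: "t \<in> S" "agree M s t" for t
      proof -
        have "\<Psi> (baire_pair (Z_name (A t)) (copy_name (x t))) = Some (out t)" using main[OF t(1)] by blast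
        from e'[OF this] show ?thesis using N[OF M[OF t(2)]] by (rule computes_deterministic)
      qed
      then have "\<forall>t\<in>S. agree M s t \<longrightarrow> (a, b) \<in> F t \<longrightarrow> (a, b) \<in> F s"
        by (simp add: F_def decode_rel_def baire_snd_def)
      then show ?thesis ..
    qed
  qed
  then obtain W :: "(nat list \<times> nat list) option rel" where W: "lin_ord (UNIV, W)" "wf W"
    and bound: "\<And>s. s \<in> S \<Longrightarrow> \<not> (\<exists>k. \<forall>a b. (a, b) \<in> W \<longrightarrow> (k a, k b) \<in> F s)" by blast
  \<comment> \<open>The bound \<open>W\<close> is placed among the negative rationals. Below the
    positive ones it becomes the well-founded part, so the reduction has to return a copy of
    \<open>W\<close>.\<close>
  obtain B where B: "B \<subseteq> {..<0}" "same_order_type (UNIV, W) (rat_lin B)"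
    using countable_embeds_in_dense[OF W(1) _ dense_rat_lin_ray(3)] by auto
  have wfB: "wf (snd (rat_lin B))"
    by (rule wf_same_order_type[OF same_order_type_sym[OF B(2)]]) (use W(2) in auto)
  obtain a where a: "rat_set a = B" using ex_rat_set by blast
  let ?A = "B \<union> {0<..}"
  \<comment> \<open>The queried group depends on \<open>part 0\<close> alone; \<open>s0\<close>
    fixes it before the remaining witnesses are chosen.\<close>
  obtain s0 where "part 0 s0 = a" using ex_part[of "\<lambda>i. a"] by blast
  obtain X :: "nat lin" where X: "lin_ord X" "wf (snd X)"
    "same_order_type (order_of (?z s0)) (lin_prod (Z_pow X) (q_pow 0))" using zX by blast
  obtain D where D: "same_order_type X (rat_lin D)"
    using countable_embeds_in_dense[OF X(1) countableI_type dense_rat_lin_ray(1)] by blast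
  obtain d where d: "rat_set d = D" using ex_rat_set by blast
  have "same_order_type (order_of (?z s0)) (lin_prod (Z_pow (rat_lin D)) (q_pow 0))"
    using X(3) lin_prod_cong[OF Z_pow_cong[OF D X(1) lin_ord_rat_lin] same_order_type_refl]
    by (rule same_order_type_trans)
  then have "same_order_type (order_of (?z s0)) (target D {0})"
    using same_order_type_sym[OF target0] by (rule same_order_type_trans)
  then obtain h h' where h: "\<And>i j. iso_cond (order_of (?z s0)) (target D {0}) h h' i j"
    unfolding same_order_type_witness by blast
  obtain s where s: "\<And>i. part i s = (if i = 0 then a else if i = 1 then d else if i = 2 then h else h')"
    using ex_part[of "\<lambda>i. if i = 0 then a else if i = 1 then d else if i = 2 then h else h'"] by blast
  have As: "A s = ?A" using a by (simp add: A_def s)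
  have "A s0 = ?A" using a \<open>part 0 s0 = a\<close> by (simp add: A_def)
  then have "r s = r s0" by (simp add: r_def As)
  moreover have "x s = D" using d by (simp add: x_def s)
  ultimately have "s \<in> S" unfolding inS by (intro allI) (simp add: s h)
  obtain w where w: "snd w = F s" "w \<in> solutions OG_alpha_1 (decode_grp (Z_name (A s)))"
    using main[OF \<open>s \<in> S\<close>] by blast
  then have "w \<in> solutions OG_alpha (decode_grp (Z_name (A s)))" by (auto simp: OG_alpha_1_def split: if_splits)
  then obtain \<epsilon> where w': "lin_ord w" "wf (snd w)" "\<epsilon> \<in> {0, 1}"
    "same_order_type (order_of (decode_grp (Z_name (A s)))) (lin_prod (Z_pow w) (q_pow \<epsilon>))"
    unfolding in_solutions_alpha ordinal_copies_iff by blast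
  have pos: "?A - B = {0<..}" using B(1) by auto
  have "same_order_type (Z_pow (rat_lin ?A)) (lin_prod (Z_pow (rat_lin B)) (q_pow 1))"
  proof (rule Z_pow_type_ill)
    show "initial_seg (rat_lin ?A) B" using B(1) by (force simp: initial_seg_def)
    have "(1 :: rat) \<in> {0<..}" by simp
    then show "?A - B \<noteq> {}" unfolding pos by blast
    show "\<exists>b\<in>?A - B. b < c" if "c \<in> ?A - B" for c
      using that dense[of 0 c] unfolding pos by auto
  qed
  then have "same_order_type (order_of (decode_grp (Z_name (A s)))) (lin_prod (Z_pow (rat_lin B)) (q_pow 1))"
    unfolding As by (rule same_order_type_trans[OF Z_name(2)])
  note same_order_type_trans[OF same_order_type_sym[OF this] w'(4)]
  then have "same_order_type (rat_lin B) w"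
    using type_unique[OF lin_ord_rat_lin wfB w'(1,2) _ w'(3)] by blast
  with B(2) have "same_order_type (UNIV, W) w" by (rule same_order_type_trans)
  then have "\<exists>k. \<forall>a b. (a, b) \<in> W \<longrightarrow> (k a, k b) \<in> F s" using same_order_type_embeds w(1) by metis
  then show False using bound[OF \<open>s \<in> S\<close>] by blast
qed

text \<open>The bit is entry \<open>0\<close> of the second component, which is entry
  \<open>1\<close> of the pair.\<close>

lemma bit_rep_prod:
  assumes "prod_rep \<delta> bit_rep s = Some (w, b)" shows "s 1 = b"
  using assms by (auto simp: prod_rep_def bit_rep_def baire_snd_def split: option.splits if_splits)

text \<open>Either comparability gives the claim directly, or \<open>x\<close> embeds into its
  finite subset \<open>y\<close>, and counting gives \<open>y = x\<close>.\<close>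

lemma finite_initial_seg:
  assumes y: "finite y" "y \<subseteq> x" and x: "wf (snd (rat_lin x))"
  shows "\<exists>I. initial_seg (rat_lin x) I \<and> same_order_type (rat_lin y) (rat_lin I)"
proof -
  have wfy: "wf (snd (rat_lin y))" by (rule wf_subset[OF x]) (use y in auto)
  have restr: "restr (rat_lin z) I = rat_lin I" if "initial_seg (rat_lin z) I" for z I
    using that by (auto simp: restr_def rat_lin_def initial_seg_def)
  from wf_comparable[OF lin_ord_rat_lin wfy lin_ord_rat_lin x] show ?thesis
  proof (elim disjE exE conjE)
    fix I assume I: "initial_seg (rat_lin x) I" "same_order_type (rat_lin y) (restr (rat_lin x) I)"
    then show ?thesis using restr[OF I(1)] by auto
  next
    fix I assume I: "initial_seg (rat_lin y) I" "same_order_type (rat_lin x) (restr (rat_lin y) I)"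
    then have "I \<subseteq> y" by (simp add: initial_seg_def)
    obtain h where h: "bij_betw h x I"
      using I(2) unfolding restr[OF I(1)] same_order_type_def by auto
    have "finite x" using bij_betw_finite[OF h] finite_subset[OF \<open>I \<subseteq> y\<close> y(1)] by simp
    moreover have "card x \<le> card y" using bij_betw_same_card[OF h] card_mono[OF y(1) \<open>I \<subseteq> y\<close>] by simp
    ultimately have "y = x" using card_seteq[of x y] y(2) by simp
    then show ?thesis
      by (intro exI[of _ x]) (simp add: initial_seg_def same_order_type_refl)
  qed
qed

lemma same_order_type_concat:
  assumes X: "lin_ord X" and I: "initial_seg X I"
    and y: "same_order_type (restr X I) (rat_lin y)" and z: "same_order_type (restr X (- I)) (rat_lin z)"
    and less: "\<And>a b. a \<in> y \<Longrightarrow> b \<in> z \<Longrightarrow> a < b"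
  shows "same_order_type X (rat_lin (y \<union> z))"
proof -
  have IX: "fst X \<inter> I = I" "fst X \<inter> - I = fst X - I" "I \<union> (fst X - I) = fst X" using I by (auto simp: initial_seg_def)
  obtain h where h: "bij_betw h I y" "\<And>a b. a \<in> I \<Longrightarrow> b \<in> I \<Longrightarrow> (a, b) \<in> snd X \<Longrightarrow> h a < h b"
    using y unfolding same_order_type_def by (auto simp: IX)
  obtain k where k: "bij_betw k (fst X - I) z"
    "\<And>a b. a \<in> fst X - I \<Longrightarrow> b \<in> fst X - I \<Longrightarrow> (a, b) \<in> snd X \<Longrightarrow> k a < k b"
    using z unfolding same_order_type_def by (auto simp: IX)
  define g where "g a = (if a \<in> I then h a else k a)" for a
  have gI: "bij_betw g I y" using h(1) by (subst bij_betw_cong[of I g h]) (simp_all add: g_def)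
  have gk: "bij_betw g (fst X - I) z" using k(1) by (subst bij_betw_cong[of "fst X - I" g k]) (simp_all add: g_def)
  have "y \<inter> z = {}" using less by fastforce
  show ?thesis
  proof (rule same_order_typeI[OF X lin_ord_rat_lin])
    show bij: "bij_betw g (fst X) (fst (rat_lin (y \<union> z)))"
      using bij_betw_combine[OF gI gk \<open>y \<inter> z = {}\<close>] by (simp only: IX(3) fst_rat_lin)
    show "(g a, g b) \<in> snd (rat_lin (y \<union> z))" if ab: "(a, b) \<in> snd X" for a b
    proof -
      have m: "a \<in> fst X" "b \<in> fst X" using lin_ord_mem[OF X ab] by auto
      have "g a \<in> y \<union> z" "g b \<in> y \<union> z" using bij_betw_apply[OF bij] m by auto
      moreover have "g a < g b"
      proof (cases "b \<in> I")
        case True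
        then have "a \<in> I" using I ab by (auto simp: initial_seg_def)
        then show ?thesis using h(2) ab True by (simp add: g_def)
      next
        case False
        then have b: "g b \<in> z" using bij_betw_apply[OF gk] m by auto
        show ?thesis
        proof (cases "a \<in> I")
          case True
          then show ?thesis using less[OF bij_betw_apply[OF gI] b] by simp
        next
          case a: False
          then show ?thesis using k(2) ab False m by (simp add: g_def)
        qed
      qed
      ultimately show ?thesis by simp
    qed
  qed
qed

lemma agree_pair: "agree N p p' \<Longrightarrow> agree N q q' \<Longrightarrow> agree N (baire_pair p q) (baire_pair p' q')"
  by (auto simp: agree_def baire_pair_def)

text \<open>In a reduction of \<open>OG_alpha_eps\<close> to \<open>OG_alpha\<close>, the bit \<open>0\<close> is output after a finite part \<open>y\<close> of
  the order on a copy of \<open>\<beta>\<close> has been read. Every ordinal of at least the size of \<open>y\<close> has a copy that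
  extends this part, and it is an analytic condition on the queried group that its exponent is that large.
  Hence the well-orders form an analytic set.\<close>

theorem not_alpha_eps_le_alpha: "\<not> OG_alpha_eps \<le>\<^sub>W OG_alpha"
proof
  assume "OG_alpha_eps \<le>\<^sub>W OG_alpha"
  then obtain \<Phi> \<Psi> where comp: "computable \<Phi>" "computable \<Psi>" and
    red: "\<And>p x. in_rep OG_alpha_eps p = Some x \<and> x \<in> problem_dom OG_alpha_eps \<Longrightarrow>
        (\<exists>r z. \<Phi> p = Some r \<and> in_rep OG_alpha r = Some z \<and> z \<in> problem_dom OG_alpha \<and>
          (\<forall>q y. out_rep OG_alpha q = Some y \<and> y \<in> solutions OG_alpha z \<longrightarrow>
            (\<exists>s w. \<Psi> (baire_pair p q) = Some s \<and> out_rep OG_alpha_eps s = Some w \<and>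
              w \<in> solutions OG_alpha_eps x)))"
    unfolding weihrauch_le_def by blast
  obtain e where e: "\<And>p q n. \<Phi> p = Some q \<Longrightarrow> computes p e [n] (q n)"
    using comp(1) unfolding computable_def by blast
  obtain e' where e': "\<And>p q n. \<Psi> p = Some q \<Longrightarrow> computes p e' [n] (q n)"
    using comp(2) unfolding computable_def by blast
  define r where "r A = the (\<Phi> (Z_name A))" for A
  let ?z = "\<lambda>A. decode_grp (r A)"
  have z: "ord_grp_rep (r A) = Some (?z A)" and zdom: "?z A \<in> problem_dom OG_alpha"
    and \<Phi>: "\<Phi> (Z_name A) = Some (r A)"
    and \<Psi>: "\<And>q Y. ordinal_rep q = Some Y \<Longrightarrow> Y \<in> solutions OG_alpha (?z A) \<Longrightarrow>
        \<exists>s w b. \<Psi> (baire_pair (Z_name A) q) = Some s \<and> s 1 = b \<and>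
          (w, b) \<in> solutions OG_alpha_eps (decode_grp (Z_name A))" for A
  proof -
    let ?G = "decode_grp (Z_name A)"
    obtain I \<epsilon> where I: "I \<subseteq> A" "wf (snd (rat_lin I))" "\<epsilon> \<in> {0, 1}" "\<epsilon> = 0 \<longleftrightarrow> wf (snd (rat_lin A))"
      "same_order_type (Z_pow (rat_lin A)) (lin_prod (Z_pow (rat_lin I)) (q_pow \<epsilon>))"
      using Z_pow_type[of A] by (elim exE conjE) (rule that)
    have "same_order_type (order_of ?G) (lin_prod (Z_pow (copy I)) (q_pow \<epsilon>))"
      using same_order_type_trans[OF Z_name(2) I(5)]
        lin_prod_cong[OF Z_pow_cong[OF copy_type lin_ord_rat_lin lin_ord_copy] same_order_type_refl]
      by (rule same_order_type_trans)
    moreover have "?G \<in> points ord_grp_rep" using Z_name(1) by (auto simp: ran_def)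
    ultimately have "(copy I, \<epsilon>) \<in> solutions OG_alpha_eps ?G"
      using copy_ordinal[OF I(2)] I(3) unfolding in_solutions_alpha_eps by blast
    then have "in_rep OG_alpha_eps (Z_name A) = Some ?G \<and> ?G \<in> problem_dom OG_alpha_eps"
      using Z_name(1) by (auto simp: problem_dom_def)
    from red[OF this] obtain z where *: "\<Phi> (Z_name A) = Some (r A)" "ord_grp_rep (r A) = Some z" "z \<in> problem_dom OG_alpha"
      "\<And>q y. ordinal_rep q = Some y \<Longrightarrow> y \<in> solutions OG_alpha z \<Longrightarrow>
        (\<exists>s w. \<Psi> (baire_pair (Z_name A) q) = Some s \<and> prod_rep ordinal_rep bit_rep s = Some w \<and>
          w \<in> solutions OG_alpha_eps ?G)"
      by (auto simp: r_def)
    have zz: "z = ?z A" using *(2) by (auto simp: ord_grp_rep_def split: if_splits)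
    show "ord_grp_rep (r A) = Some (?z A)" "?z A \<in> problem_dom OG_alpha" "\<Phi> (Z_name A) = Some (r A)"
      using * zz by auto
    show "\<exists>s w b. \<Psi> (baire_pair (Z_name A) q) = Some s \<and> s 1 = b \<and> (w, b) \<in> solutions OG_alpha_eps ?G"
      if q: "ordinal_rep q = Some Y" "Y \<in> solutions OG_alpha (?z A)" for q Y
    proof -
      obtain s w where sw: "\<Psi> (baire_pair (Z_name A) q) = Some s" "prod_rep ordinal_rep bit_rep s = Some w"
        "w \<in> solutions OG_alpha_eps ?G" using *(4)[OF q(1)] q(2) zz by auto
      obtain v b where w: "w = (v, b)" by (cases w)
      show ?thesis using sw bit_rep_prod[of ordinal_rep s v b] unfolding w by blast
    qed
  qed
  have zpt: "?z A \<in> points ord_grp_rep" for A using z by (auto simp: ran_def)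
  have zX: "\<exists>(X :: nat lin) \<epsilon>. X \<in> ordinal_copies \<and> \<epsilon> \<in> {0, 1} \<and>
      same_order_type (order_of (?z A)) (lin_prod (Z_pow X) (q_pow \<epsilon>))" for A
  proof -
    obtain X where "X \<in> solutions OG_alpha (?z A)" using zdom[of A] by (auto simp: problem_dom_def)
    then show ?thesis unfolding in_solutions_alpha by blast
  qed
  have answer: "\<exists>s w b. \<Psi> (baire_pair (Z_name A) (copy_name D)) = Some s \<and> s 1 = b \<and>
      (w, b) \<in> solutions OG_alpha_eps (decode_grp (Z_name A))"
    if X: "X \<in> ordinal_copies" "\<epsilon> \<in> {0, 1}" "same_order_type (order_of (?z A)) (lin_prod (Z_pow X) (q_pow \<epsilon>))"
      and D: "same_order_type X (rat_lin D)" for A D \<epsilon> and X :: "nat lin"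
  proof -
    have lX: "lin_ord X" "wf (snd X)" using X(1) by (simp_all add: ordinal_copies_iff)
    have wfD: "wf (snd (rat_lin D))"
      by (rule wf_same_order_type[OF same_order_type_sym[OF D] lX(2)]) auto
    have "same_order_type (lin_prod (Z_pow X) (q_pow \<epsilon>)) (lin_prod (Z_pow (copy D)) (q_pow \<epsilon>))"
      by (intro lin_prod_cong Z_pow_cong same_order_type_refl same_order_type_trans[OF D copy_type] lX lin_ord_copy)
    from same_order_type_trans[OF X(3) this]
    have "copy D \<in> solutions OG_alpha (?z A)"
      using zpt copy_ordinal[OF wfD] X(2) unfolding in_solutions_alpha by blast
    then show ?thesis using \<Psi>[OF ordinal_rep_copy_name[OF wfD]] by blast
  qed
  define A where "A s = rat_set (part 0 s)" for s
  define x where "x s = rat_set (part 1 s)" for s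
  define N where "N s = part 5 s 0" for s
  define y where "y s = {q \<in> x s. to_nat q < N s}" for s
  define M where "M s = rat_set (part 2 s)" for s
  \<comment> \<open>The first \<open>N s\<close> entries of both names already force the program to
    output the bit \<open>0\<close>, however they are continued.\<close>
  define Q where "Q s \<longleftrightarrow> (\<forall>p q. agree (N s) (Z_name (A s)) p \<and> agree (N s) (copy_name (x s)) q \<longrightarrow>
      computes (baire_pair p q) e' [1] 0)" for s
  \<comment> \<open>The factor \<open>M s\<close> is an arbitrary suborder of the rationals. The
    isomorphism thus only bounds the exponent of the queried group from below by the finite order
    \<open>y s\<close>.\<close>
  define P where "P i s \<longleftrightarrow> Q s \<and>
      iso_cond (order_of (?z (A s))) (target (y s) (M s)) (part 3 s) (part 4 s) (pfst i) (psnd i)" for i s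
  define S where "S = {s. \<forall>i. P i s}"
  have lc: "locally_const (\<lambda>s. q \<in> rat_set (part i s))" for q i
    by (rule locally_const_compose[OF locally_const_rat_set locally_const_part])
  have lcA: "locally_const (\<lambda>s. q \<in> A s)" and lcx: "locally_const (\<lambda>s. q \<in> x s)" and lcM: "locally_const (\<lambda>s. q \<in> M s)" for q
    unfolding A_def x_def M_def by (rule lc)+
  have lcN: "locally_const N" unfolding N_def by (rule locally_const_part)
  have lcy: "locally_const (\<lambda>s. q \<in> y s)" for q
    using locally_const_comp2[OF lcx[of q] lcN, of "\<lambda>a n. a \<and> to_nat q < n"] by (simp add: y_def)
  have lcr: "locally_const (\<lambda>s. r (A s) n)" for n
    by (rule locally_const_computable[OF e[OF \<Phi>] locally_const_Z_name[OF lcA]])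
  have lcQ: "locally_const Q"
    unfolding locally_const_def
  proof
    fix s
    obtain K where K: "\<And>t. agree K s t \<Longrightarrow> N t = N s" using lcN unfolding locally_const_def by blast
    obtain L where L: "\<And>t. agree L s t \<Longrightarrow> agree (N s) (Z_name (A s)) (Z_name (A t))"
      using locally_const_agree[of "\<lambda>s. Z_name (A s)", OF locally_const_Z_name[OF lcA]] by blast
    obtain L' where L': "\<And>t. agree L' s t \<Longrightarrow> agree (N s) (copy_name (x s)) (copy_name (x t))"
      using locally_const_agree[of "\<lambda>s. copy_name (x s)", OF locally_const_copy_name[OF lcx]] by blast
    \<comment> \<open>\<open>Q\<close> depends only on the number \<open>N s\<close> and on the
      first \<open>N s\<close> entries of the two names, all of which are locally constant.\<close>
    have "Q t = Q s" if "agree (max K (max L L')) s t" for t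
    proof -
      have t: "N t = N s" "agree (N s) (Z_name (A s)) (Z_name (A t))" "agree (N s) (copy_name (x s)) (copy_name (x t))"
        using that K[of t] L[of t] L'[of t] unfolding agree_max by blast+
      have "agree (N s) (Z_name (A s)) p \<longleftrightarrow> agree (N s) (Z_name (A t)) p"
        "agree (N s) (copy_name (x s)) p \<longleftrightarrow> agree (N s) (copy_name (x t)) p" for p
        using agree_trans[OF t(2), of p] agree_trans[OF agree_sym[OF t(2)], of p]
          agree_trans[OF t(3), of p] agree_trans[OF agree_sym[OF t(3)], of p] by blast+
      then show ?thesis unfolding Q_def t(1) by simp
    qed
    then show "\<exists>n. \<forall>t. agree n s t \<longrightarrow> Q t = Q s" by blast
  qed
  have lcP: "locally_const (P i)" for i
    unfolding P_def
    by (rule locally_const_comp2[OF lcQ locally_const_iso_cond[OF locally_const_order[OF lcr]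
        locally_const_target[OF lcy lcM] locally_const_part locally_const_part]])
  have inS: "s \<in> S \<longleftrightarrow> Q s \<and>
      (\<forall>i j. iso_cond (order_of (?z (A s))) (target (y s) (M s)) (part 3 s) (part 4 s) i j)" for s
    unfolding all_pfst_psnd[symmetric, of "iso_cond _ _ _ _"] S_def P_def by simp
  have finy: "finite {q :: rat. to_nat q < n}" for n
  proof -
    have "{q :: rat. to_nat q < n} \<subseteq> from_nat ` {..<n}"
      by (metis (mono_tags, lifting) from_nat_to_nat image_eqI lessThan_iff mem_Collect_eq subsetI)
    then show ?thesis by (rule finite_subset) simp
  qed
  have wfA: "wf (snd (rat_lin (A s)))" if s: "s \<in> S" for s
  proof -
    have Q: "Q s" and "same_order_type (order_of (?z (A s))) (target (y s) (M s))"
      using s unfolding inS same_order_type_witness by blast+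
    then have zy: "same_order_type (order_of (?z (A s))) (lin_prod (Z_pow (rat_lin (y s))) (rat_lin (M s)))"
      using target_type by (blast intro: same_order_type_trans)
    obtain X :: "nat lin" and \<epsilon> where X: "X \<in> ordinal_copies" "\<epsilon> \<in> {0, 1}"
      "same_order_type (order_of (?z (A s))) (lin_prod (Z_pow X) (q_pow \<epsilon>))" using zX by blast
    have lX: "lin_ord X" "wf (snd X)" using X(1) by (simp_all add: ordinal_copies_iff)
    have "finite (y s)" by (rule finite_subset[OF _ finy[of "N s"]]) (auto simp: y_def)
    then have "finite (snd (rat_lin (y s)))" by (rule_tac finite_subset[of _ "y s \<times> y s"]) auto
    moreover have "acyclic (snd (rat_lin (y s)))"
      by (rule acyclicI_order[where f = "\<lambda>q. - q"]) auto
    ultimately have wfy: "wf (snd (rat_lin (y s)))" by (rule finite_acyclic_wf)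
    obtain I where I: "initial_seg X I" "same_order_type (rat_lin (y s)) (restr X I)"
      using exponent_initial_seg[OF lin_ord_rat_lin wfy lX lin_ord_rat_lin
          same_order_type_trans[OF same_order_type_sym[OF X(3)] zy]] by blast
    \<comment> \<open>No rational with code below \<open>N s\<close> exceeds \<open>c\<close>, so
      points beyond \<open>c\<close> can be added without touching the part that was read. The
      inserted \<open>0\<close> keeps the maximum meaningful when there are no such
      rationals.\<close>
    define c where "c = Max (insert 0 {q :: rat. to_nat q < N s})"
    have c: "q \<le> c" if "to_nat q < N s" for q
      unfolding c_def using that finy by (intro Max_ge) auto
    obtain B where B: "B \<subseteq> {c<..}" "same_order_type (restr X (- I)) (rat_lin B)"
      using countable_embeds_in_dense[OF lin_ord_restr[OF lX(1)] countableI_type dense_rat_lin_ray(2)] by blast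
    \<comment> \<open>The part \<open>y s\<close> that was read is completed to a copy of the true
      exponent \<open>X\<close>, which is a correct answer to the query.\<close>
    have "same_order_type X (rat_lin (y s \<union> B))"
    proof (rule same_order_type_concat[OF lX(1) I(1) same_order_type_sym[OF I(2)] B(2)])
      show "a < b" if "a \<in> y s" "b \<in> B" for a b using c[of a] that B(1) by (auto simp: y_def)
    qed
    from answer[OF X this] obtain s' w b where
      w: "\<Psi> (baire_pair (Z_name (A s)) (copy_name (y s \<union> B))) = Some s'" "s' 1 = b"
      "(w, b) \<in> solutions OG_alpha_eps (decode_grp (Z_name (A s)))" by blast
    \<comment> \<open>This answer agrees with \<open>x s\<close> as far as it was read, so the bit
      \<open>0\<close> is output for it too. Being output for a correct answer, the bit is true of
      the input.\<close>
    have "q \<in> x s \<longleftrightarrow> q \<in> y s \<union> B" if "to_nat q < N s" for q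
      using that c[OF that] B(1) by (auto simp: y_def)
    then have "agree (N s) (copy_name (x s)) (copy_name (y s \<union> B))" by (rule agree_copy_name)
    then have "computes (baire_pair (Z_name (A s)) (copy_name (y s \<union> B))) e' [1] 0"
      using Q unfolding Q_def by simp
    then have "b = 0" using computes_deterministic[OF e'[OF w(1), of 1]] w(2) by simp
    then have "lin_ord w" "wf (snd w)"
      "same_order_type (order_of (decode_grp (Z_name (A s)))) (lin_prod (Z_pow w) (q_pow 0))"
      using w(3) unfolding in_solutions_alpha_eps ordinal_copies_iff by blast+
    then show ?thesis using wf_exponent same_order_type_trans[OF same_order_type_sym[OF Z_name(2)]] by blast
  qed
  have "\<exists>W :: (nat list \<times> nat list) option rel. lin_ord (UNIV, W) \<and> wf W \<and>
    (\<forall>s\<in>S. \<not> (\<exists>k. \<forall>a b. (a, b) \<in> W \<longrightarrow> (k a, k b) \<in> snd (copy (A s))))"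
  proof (rule boundedness)
    show "s \<in> S" if "\<And>n. \<exists>t\<in>S. agree n s t" for s
      using closed_locally_const[of P, OF lcP] that unfolding S_def by blast
    show "wf (snd (copy (A s)))" if s: "s \<in> S" for s
      using copy_ordinal[OF wfA[OF s]] by (simp add: ordinal_copies_iff)
    have "locally_const (\<lambda>s. (a, b) \<in> snd (copy (A s)))" for a b
      using locally_const_comp2[OF locally_const_in_copy[of A, OF lcA] locally_const_in_copy[of A, OF lcA],
          of "\<lambda>P Q. P \<and> Q \<and> from_nat a < (from_nat b :: rat)" a b] by (simp add: copy_def)
    then show "\<exists>n. \<forall>t\<in>S. agree n s t \<longrightarrow> (a, b) \<in> snd (copy (A t)) \<longrightarrow> (a, b) \<in> snd (copy (A s))"
      if s: "s \<in> S" for s a b unfolding locally_const_def by blast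
  qed
  then obtain W :: "(nat list \<times> nat list) option rel" where W: "lin_ord (UNIV, W)" "wf W"
    and bound: "\<And>s. s \<in> S \<Longrightarrow> \<not> (\<exists>k. \<forall>a b. (a, b) \<in> W \<longrightarrow> (k a, k b) \<in> snd (copy (A s)))" by blast
  obtain B where B: "same_order_type (UNIV, W) (rat_lin B)"
    using countable_embeds_in_dense[OF W(1) _ dense_rat_lin_ray(1)] by auto
  have wfB: "wf (snd (rat_lin B))"
    by (rule wf_same_order_type[OF same_order_type_sym[OF B]]) (use W(2) in auto)
  obtain X :: "nat lin" and \<epsilon> where X: "X \<in> ordinal_copies" "\<epsilon> \<in> {0, 1}"
    "same_order_type (order_of (?z B)) (lin_prod (Z_pow X) (q_pow \<epsilon>))" using zX by blast
  have lX: "lin_ord X" "wf (snd X)" using X(1) by (simp_all add: ordinal_copies_iff)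
  obtain D where D: "same_order_type X (rat_lin D)" "wf (snd (rat_lin D))"
    using ordinal_subset_rat[OF X(1) dense_rat_lin_ray(1)] by blast
  from answer[OF X D(1)] obtain s' w b where
    w: "\<Psi> (baire_pair (Z_name B) (copy_name D)) = Some s'" "s' 1 = b"
    "(w, b) \<in> solutions OG_alpha_eps (decode_grp (Z_name B))" by blast
  have w': "lin_ord w" "wf (snd w)" "b \<in> {0, 1}"
    "same_order_type (order_of (decode_grp (Z_name B))) (lin_prod (Z_pow w) (q_pow b))"
    using w(3) unfolding in_solutions_alpha_eps ordinal_copies_iff by blast+
  have "same_order_type (lin_prod (Z_pow (rat_lin B)) (q_pow 0)) (lin_prod (Z_pow w) (q_pow b))"
    by (rule same_order_type_trans[OF same_order_type_trans[OF same_order_type_sym[OF Z_pow_type_wf]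
          same_order_type_sym[OF Z_name(2)]] w'(4)])
  \<comment> \<open>\<open>B\<close> is a well-order, so the correct bit is \<open>0\<close>; the
    finite use of its computation determines the number \<open>n\<close>.\<close>
  then have "0 = b" using type_unique[OF lin_ord_rat_lin wfB w'(1,2) _ w'(3)] by simp
  then have "computes (baire_pair (Z_name B) (copy_name D)) e' [1] 0" using e'[OF w(1), of 1] w(2) by simp
  from computes_use[OF this] obtain n where
    n: "\<And>q. agree n (baire_pair (Z_name B) (copy_name D)) q \<Longrightarrow> computes q e' [1] 0" by blast
  let ?y = "{q \<in> D. to_nat q < n}"
  have "finite ?y" by (rule finite_subset[OF _ finy[of n]]) auto
  then obtain I where I: "initial_seg (rat_lin D) I" "same_order_type (rat_lin ?y) (rat_lin I)"
    using finite_initial_seg[OF _ _ D(2), of ?y] by auto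
  \<comment> \<open>The part of the exponent above \<open>I\<close>, together with the factor for
    the bit, is absorbed into one order \<open>E\<close> of rationals, which takes the role of
    \<open>M\<close>.\<close>
  let ?R = "lin_prod (Z_pow (restr (rat_lin D) (- I))) (q_pow \<epsilon>)"
  have "lin_ord ?R" by (intro lin_ord_prod lin_ord_Z_pow lin_ord_restr lin_ord_rat_lin lin_ord_q_pow)
  moreover have "countable (fst ?R)" by (auto intro: countable_fin_supp)
  ultimately obtain E where E: "same_order_type ?R (rat_lin E)"
    using countable_embeds_in_dense[OF _ _ dense_rat_lin_ray(1)] by blast
  have rI: "restr (rat_lin D) I = rat_lin I"
    using I(1) by (auto simp: restr_def rat_lin_def initial_seg_def)
  have st: "same_order_type (order_of (?z B)) (lin_prod (Z_pow (rat_lin D)) (q_pow \<epsilon>))"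
    by (rule same_order_type_trans[OF X(3) lin_prod_cong[OF Z_pow_cong[OF D(1) lX(1) lin_ord_rat_lin] same_order_type_refl]])
  have "same_order_type (order_of (?z B))
      (lin_prod (lin_prod (Z_pow (rat_lin I)) (Z_pow (restr (rat_lin D) (- I)))) (q_pow \<epsilon>))"
    by (rule same_order_type_trans[OF st lin_prod_cong[OF Z_pow_split[OF lin_ord_rat_lin I(1), unfolded rI] same_order_type_refl]])
  then have "same_order_type (order_of (?z B)) (lin_prod (Z_pow (rat_lin I)) ?R)"
    by (rule same_order_type_trans[OF _ lin_prod_assoc])
  then have "same_order_type (order_of (?z B)) (lin_prod (Z_pow (rat_lin ?y)) (rat_lin E))"
    by (rule same_order_type_trans[OF _ lin_prod_cong[OF Z_pow_cong[OF same_order_type_sym[OF I(2)] lin_ord_rat_lin lin_ord_rat_lin] E]])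
  then have "same_order_type (order_of (?z B)) (target ?y E)"
    by (rule same_order_type_trans[OF _ same_order_type_sym[OF target_type]])
  then obtain h h' where h: "\<And>i j. iso_cond (order_of (?z B)) (target ?y E) h h' i j"
    unfolding same_order_type_witness by blast
  obtain a d m where adm: "rat_set a = B" "rat_set d = D" "rat_set m = E" using ex_rat_set by metis
  obtain s where s: "\<And>i. part i s = (if i = 0 then a else if i = 1 then d else if i = 2 then m
      else if i = 3 then h else if i = 4 then h' else (\<lambda>_. n))"
    using ex_part[of "\<lambda>i. if i = 0 then a else if i = 1 then d else if i = 2 then m
      else if i = 3 then h else if i = 4 then h' else (\<lambda>_. n)"] by blast
  have eqs: "A s = B" "x s = D" "M s = E" "N s = n" using adm by (simp_all add: A_def x_def M_def N_def s)
  then have "y s = ?y" by (simp add: y_def)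
  \<comment> \<open>Agreement of both components up to \<open>n\<close> gives agreement of the pairs
    up to \<open>n\<close>, which is all that the use requires.\<close>
  moreover have "Q s" unfolding Q_def eqs using n agree_pair by blast
  ultimately have "s \<in> S" unfolding inS by (intro conjI allI) (simp_all add: eqs s h)
  have "same_order_type (UNIV, W) (copy (A s))"
    unfolding eqs by (rule same_order_type_trans[OF B copy_type])
  then show False using bound[OF \<open>s \<in> S\<close>] same_order_type_embeds by blast
qed

theorem corollary2p29:
  shows "OG_alpha_0 <\<^sub>W OG_alpha_1 \<and> OG_alpha_1 \<equiv>\<^sub>W OG_alpha \<and> OG_alpha <\<^sub>W OG_alpha_eps"
proof -
  have "restrict_problem OG_alpha UNIV = OG_alpha" by (simp add: restrict_problem_def)
  then have "OG_alpha \<le>\<^sub>W OG_alpha_1" using restrict_alpha_le_alpha_1[of UNIV] by simp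
  moreover have "OG_alpha_0 \<le>\<^sub>W OG_alpha_1" unfolding OG_alpha_0_def by (rule restrict_alpha_le_alpha_1)
  moreover have "OG_alpha_1 \<le>\<^sub>W OG_alpha" unfolding OG_alpha_1_def by (rule restrict_le)
  ultimately show ?thesis
    using not_alpha_1_le_alpha_0 not_alpha_eps_le_alpha alpha_le_alpha_eps
    unfolding weihrauch_less_def weihrauch_equiv_def by simp
qed

end
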